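(* Let $I$ be a proper ideal of $\mathcal O_n$ such that $V(I)\subseteq V(x_1\cdots x_n)$. Then $$1\leq \operatorname{lct}(I)\,\mathcal L_{x_1\cdots x_n}(I),$$ and equality holds when $\overline I$ is a monomial ideal.
   Context: $\mathcal O_n$ is the ring of complex analytic function germs $(\mathbb C^n,0)\to\mathbb C$ in the coordinates $x_1,\dots,x_n$; $V(\cdot)$ denotes the germ of the zero set at $0$; $\overline I$ is the integral closure of $I$; a monomial ideal is one generated by monomials. $\mathcal L_{x_1\cdots x_n}(I)$ is the Łojasiewicz exponent of $I$ with respect to the ideal $\langle x_1\cdots x_n\rangle$: if $I=\langle f_1,\dots,f_p\rangle$ and $f=(f_1,\dots,f_p)$, it is the infimum of those $\alpha\in\mathbb R_{\geq0}$ for which there are $C>0$ and a neighbourhood $U$ of $0$ with $|x_1\cdots x_n|^\alpha\leq C\|f(x)\|$ for all $x\in U$. $\operatorname{lct}(I)=\sup\{s\in\mathbb R_{\geq0}:(|f_1(x)|^2+\cdots+|f_p(x)|^2)^{-s}\text{ is integrable on some compact neighbourhood of }0\}$. *)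

theory Defs
  imports "HOL-Analysis.Analysis"
begin

section \<open>The ring of analytic germs at the origin\<close>

definition monom_fun :: "('n::finite \<Rightarrow> nat) \<Rightarrow> complex ^ 'n \<Rightarrow> complex" where
  "monom_fun m x = (\<Prod>i\<in>UNIV. (x $ i) ^ m i)"

text \<open>A function is analytic at the origin if it is the sum of a power series on some polydisc.
  The multi-indices are the functions from the index type to the natural numbers.\<close>

definition analytic0 :: "(complex ^ 'n::finite \<Rightarrow> complex) \<Rightarrow> bool" where
  "analytic0 f \<longleftrightarrow> (\<exists>(a :: ('n \<Rightarrow> nat) \<Rightarrow> complex) r. r > 0 \<and>
     (\<forall>x. (\<forall>i. cmod (x $ i) < r) \<longrightarrow> ((\<lambda>m. a m * monom_fun m x) has_sum f x) UNIV))"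

lemma eventually_polydisc:
  assumes "r > 0"
  shows "\<forall>\<^sub>F x in nhds (0 :: complex ^ 'n::finite). \<forall>i. cmod (x $ i) < r"
proof -
  have "\<forall>i\<in>(UNIV :: 'n set). \<forall>\<^sub>F x in nhds (0 :: complex ^ 'n). cmod (x $ i) < r"
  proof
    fix i :: 'n
    have "((\<lambda>x :: complex ^ 'n. cmod (x $ i)) \<longlongrightarrow> cmod ((0 :: complex ^ 'n) $ i)) (nhds 0)"
      by (intro tendsto_intros filterlim_ident)
    then show "\<forall>\<^sub>F x in nhds (0 :: complex ^ 'n). cmod (x $ i) < r"
      using assms by (auto intro: order_tendstoD)
  qed
  then show ?thesis
    by (simp add: eventually_ball_finite_distrib flip: eventually_ball_finite_distrib)
       (use eventually_ball_finite[of "UNIV :: 'n set"] in auto)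
qed

lemma monom_fun_add: "monom_fun (\<lambda>i. k i + l i) x = monom_fun k x * monom_fun l x"
  by (simp add: monom_fun_def power_add prod.distrib)

lemma analytic0_monom_fun: "analytic0 (monom_fun m)"
proof -
  have "((\<lambda>k. (if k = m then 1 else 0) * monom_fun k x) has_sum monom_fun m x) UNIV" for x
    by (rule has_sum_finite_neutralI[where B = "{m}"]) auto
  then show ?thesis
    unfolding analytic0_def by (intro exI[of _ "\<lambda>k. if k = m then 1 else 0"] exI[of _ 1]) auto
qed

lemma analytic0_const: "analytic0 (\<lambda>_. c)"
proof -
  have "((\<lambda>k. (if k = (\<lambda>_. 0) then c else 0) * monom_fun k x) has_sum c) UNIV"
    for x :: "complex ^ 'a"
    by (rule has_sum_finite_neutralI[where B = "{\<lambda>_. 0}"]) (auto simp: monom_fun_def)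
  then show ?thesis
    unfolding analytic0_def
    by (intro exI[of _ "\<lambda>k. if k = (\<lambda>_. 0) then c else 0"] exI[of _ 1]) auto
qed

lemma analytic0_add:
  assumes "analytic0 f" "analytic0 g"
  shows "analytic0 (\<lambda>x. f x + g x)"
proof -
  obtain a r where a: "r > 0"
    "\<And>x. (\<forall>i. cmod (x $ i) < r) \<Longrightarrow> ((\<lambda>m. a m * monom_fun m x) has_sum f x) UNIV"
    using assms(1) unfolding analytic0_def by blast
  obtain b s where b: "s > 0"
    "\<And>x. (\<forall>i. cmod (x $ i) < s) \<Longrightarrow> ((\<lambda>m. b m * monom_fun m x) has_sum g x) UNIV"
    using assms(2) unfolding analytic0_def by blast
  show ?thesis
    unfolding analytic0_def
  proof (intro exI[of _ "\<lambda>m. a m + b m"] exI[of _ "min r s"] conjI allI impI)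
    show "min r s > 0" using a b by simp
    fix x :: "complex ^ 'a" assume "\<forall>i. cmod (x $ i) < min r s"
    then show "((\<lambda>m. (a m + b m) * monom_fun m x) has_sum f x + g x) UNIV"
      using has_sum_add[OF a(2)[of x] b(2)[of x]] by (simp add: distrib_right)
  qed
qed

lemma has_sum_product_complex:
  fixes F :: "'a \<Rightarrow> complex" and G :: "'b \<Rightarrow> complex"
  assumes F: "(F has_sum S) UNIV" and G: "(G has_sum T) UNIV"
  shows "((\<lambda>(k, l). F k * G l) has_sum S * T) (UNIV \<times> UNIV)"
proof -
  have aF: "(\<lambda>k. cmod (F k)) summable_on UNIV" and aG: "(\<lambda>l. cmod (G l)) summable_on UNIV"
    using F G has_sum_imp_summable summable_on_iff_abs_summable_on_complex by blast+
  have "(\<lambda>p. cmod ((\<lambda>(k, l). F k * G l) p)) summable_on (UNIV \<times> UNIV)"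
    unfolding Infinite_Sum.abs_summable_on_Sigma_iff
  proof (intro conjI ballI)
    show "(\<lambda>l. cmod (case (k, l) of (k, l) \<Rightarrow> F k * G l)) summable_on UNIV" for k
      using summable_on_cmult_right[OF aG, of "norm (F k)"] by (simp add: norm_mult)
    have "(\<lambda>k. norm (F k) * infsum (\<lambda>l. norm (G l)) UNIV) summable_on UNIV"
      by (rule summable_on_cmult_left[OF aF])
    moreover have "norm (\<Sum>\<^sub>\<infinity>l. norm (case (k, l) of (k, l) \<Rightarrow> F k * G l))
        = norm (F k) * infsum (\<lambda>l. norm (G l)) UNIV" for k
      by (simp add: norm_mult infsum_cmult_right' abs_mult infsum_nonneg)
    ultimately show "(\<lambda>k. norm (\<Sum>\<^sub>\<infinity>l. norm (case (k, l) of (k, l) \<Rightarrow> F k * G l))) summable_on UNIV"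
      by simp
  qed
  then have "(\<lambda>(k, l). F k * G l) summable_on (UNIV \<times> UNIV)"
    by (rule abs_summable_summable)
  then show ?thesis
    by (rule has_sum_SigmaI[rotated 2, where g = "\<lambda>k. F k * T"])
       (auto intro!: has_sum_cmult_right has_sum_cmult_left F G)
qed

lemma finite_multi_index_le: "finite {k :: 'n::finite \<Rightarrow> nat. \<forall>i. k i \<le> m i}"
proof (rule finite_subset)
  show "{k. \<forall>i. k i \<le> m i} \<subseteq> PiE UNIV (\<lambda>i. {..m i})" by auto
qed (auto intro: finite_PiE)

lemma analytic0_mult:
  fixes f g :: "complex ^ 'n::finite \<Rightarrow> complex"
  assumes "analytic0 f" "analytic0 g"
  shows "analytic0 (\<lambda>x. f x * g x)"
proof -
  obtain a r where a: "r > 0"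
    "\<And>x. (\<forall>i. cmod (x $ i) < r) \<Longrightarrow> ((\<lambda>m. a m * monom_fun m x) has_sum f x) UNIV"
    using assms(1) unfolding analytic0_def by blast
  obtain b s where b: "s > 0"
    "\<And>x. (\<forall>i. cmod (x $ i) < s) \<Longrightarrow> ((\<lambda>m. b m * monom_fun m x) has_sum g x) UNIV"
    using assms(2) unfolding analytic0_def by blast
  define c where "c m = (\<Sum>k | \<forall>i. k i \<le> m i. a k * b (\<lambda>i. m i - k i))" for m
  show ?thesis
    unfolding analytic0_def
  proof (intro exI[of _ c] exI[of _ "min r s"] conjI allI impI)
    show "min r s > 0" using a b by simp
    fix x :: "complex ^ 'n" assume x: "\<forall>i. cmod (x $ i) < min r s"
    let ?F = "\<lambda>k. a k * monom_fun k x" and ?G = "\<lambda>l. b l * monom_fun l x"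
    let ?B = "\<lambda>m. {k :: 'n \<Rightarrow> nat. \<forall>i. k i \<le> m i}"
    let ?H = "\<lambda>(m, k). ?F k * ?G (\<lambda>i. m i - k i)"
    have "((\<lambda>(k, l). ?F k * ?G l) has_sum f x * g x) (UNIV \<times> UNIV)"
      using x by (intro has_sum_product_complex a b) auto
    also have "?this \<longleftrightarrow> (?H has_sum f x * g x) (Sigma UNIV ?B)"
      by (rule has_sum_reindex_bij_witness[where
            j = "\<lambda>(k, l). (\<lambda>i. k i + l i, k)" and i = "\<lambda>(m, k). (k, \<lambda>i. m i - k i)"]) auto
    finally have "(?H has_sum f x * g x) (Sigma UNIV ?B)" .
    then show "((\<lambda>m. c m * monom_fun m x) has_sum f x * g x) UNIV"
    proof (rule has_sum_SigmaD)
      fix m :: "'n \<Rightarrow> nat"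
      have "?F k * ?G (\<lambda>i. m i - k i) = a k * b (\<lambda>i. m i - k i) * monom_fun m x"
        if "k \<in> ?B m" for k
        using monom_fun_add[of k "\<lambda>i. m i - k i" x] that by (simp add: mult_ac)
      then have "(\<Sum>k\<in>?B m. ?H (m, k)) = c m * monom_fun m x"
        unfolding c_def sum_distrib_right by (intro sum.cong) auto
      then show "((\<lambda>k. ?H (m, k)) has_sum c m * monom_fun m x) (?B m)"
        by (intro has_sum_finiteI) (auto simp: finite_multi_index_le)
    qed
  qed
qed

lemma analytic0_uminus: "analytic0 f \<Longrightarrow> analytic0 (\<lambda>x. - f x)"
  using analytic0_mult[OF analytic0_const[of "-1"], of f] by simp

definition germ_rel ::
  "(complex ^ 'n::finite \<Rightarrow> complex) \<Rightarrow> (complex ^ 'n \<Rightarrow> complex) \<Rightarrow> bool" where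
  "germ_rel f g \<longleftrightarrow> analytic0 f \<and> analytic0 g \<and> (\<forall>\<^sub>F x in nhds 0. f x = g x)"

quotient_type 'n germ = "complex ^ 'n::finite \<Rightarrow> complex" / partial: germ_rel
proof (rule part_equivpI)
  show "\<exists>f :: complex ^ 'n \<Rightarrow> complex. germ_rel f f"
    using analytic0_const[of 0] by (auto simp: germ_rel_def)
  show "symp (germ_rel :: (complex ^ 'n \<Rightarrow> complex) \<Rightarrow> _)"
    by (auto simp: symp_def germ_rel_def eq_commute)
  show "transp (germ_rel :: (complex ^ 'n \<Rightarrow> complex) \<Rightarrow> _)"
    by (auto simp: transp_def germ_rel_def elim: eventually_elim2)
qed

text \<open>On functions that are not analytic at the origin, the function \<open>abs_germ\<close> has no
  meaning.\<close>

instantiation germ :: (finite) comm_ring_1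
begin

lift_definition zero_germ :: "'a germ" is "\<lambda>_. 0"
  by (simp add: germ_rel_def analytic0_const)

lift_definition one_germ :: "'a germ" is "\<lambda>_. 1"
  by (simp add: germ_rel_def analytic0_const)

lift_definition plus_germ :: "'a germ \<Rightarrow> 'a germ \<Rightarrow> 'a germ" is "\<lambda>f g x. f x + g x"
  by (auto simp: germ_rel_def analytic0_add elim: eventually_elim2)

lift_definition times_germ :: "'a germ \<Rightarrow> 'a germ \<Rightarrow> 'a germ" is "\<lambda>f g x. f x * g x"
  by (auto simp: germ_rel_def analytic0_mult elim: eventually_elim2)

lift_definition uminus_germ :: "'a germ \<Rightarrow> 'a germ" is "\<lambda>f x. - f x"
  by (auto simp: germ_rel_def analytic0_uminus elim: eventually_mono)

definition minus_germ :: "'a germ \<Rightarrow> 'a germ \<Rightarrow> 'a germ" where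
  "minus_germ f g = f + - g"

instance
proof
  show "(0 :: 'a germ) \<noteq> 1"
    by transfer (auto simp: germ_rel_def dest: eventually_nhds_x_imp_x)
qed (transfer; simp add: germ_rel_def analytic0_const analytic0_add analytic0_mult
      analytic0_uminus algebra_simps minus_germ_def; fail | simp add: minus_germ_def)+

end

lift_definition monom_germ :: "('n::finite \<Rightarrow> nat) \<Rightarrow> 'n germ" is monom_fun
  by (simp add: germ_rel_def analytic0_monom_fun)


section \<open>Ideals, powers, integral closure, monomial ideals\<close>

text \<open>Ideals are the submodules of the ring regarded as a module over itself.\<close>

global_interpretation self_module: module "(*) :: 'a::comm_ring_1 \<Rightarrow> 'a \<Rightarrow> 'a"
  defines is_ideal = self_module.subspace and ideal_gen = self_module.span
  by standard (auto simp: algebra_simps)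

definition ideal_mult :: "'a::comm_ring_1 set \<Rightarrow> 'a set \<Rightarrow> 'a set" where
  "ideal_mult I J = ideal_gen {a * b | a b. a \<in> I \<and> b \<in> J}"

primrec ideal_power :: "'a::comm_ring_1 set \<Rightarrow> nat \<Rightarrow> 'a set" where
  "ideal_power I 0 = UNIV"
| "ideal_power I (Suc k) = ideal_mult I (ideal_power I k)"

definition integral_closure :: "'a::comm_ring_1 set \<Rightarrow> 'a set" where
  "integral_closure I = {h. \<exists>k a. k \<ge> 1 \<and> (\<forall>i\<in>{1..k}. a i \<in> ideal_power I i) \<and>
     h ^ k + (\<Sum>i=1..k. a i * h ^ (k - i)) = 0}"

definition monomial_ideal :: "'n::finite germ set \<Rightarrow> bool" where
  "monomial_ideal I \<longleftrightarrow> (\<exists>M. I = ideal_gen (monom_germ ` M))"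


section \<open>Zero sets, Lojasiewicz exponent and log canonical threshold\<close>

definition generates :: "(complex ^ 'n::finite \<Rightarrow> complex) list \<Rightarrow> 'n germ set \<Rightarrow> bool" where
  "generates fs I \<longleftrightarrow> (\<forall>f\<in>set fs. analytic0 f) \<and> I = ideal_gen (abs_germ ` set fs)"

text \<open>The invariants of an ideal are those of some tuple of representatives of generators
  (one exists because the ring is Noetherian). The lemmas named \<open>_eqI\<close> below show
  that the choice does not matter.\<close>

definition some_generators :: "'n::finite germ set \<Rightarrow> (complex ^ 'n \<Rightarrow> complex) list" where
  "some_generators I = (SOME fs. generates fs I)"

definition common_zeros :: "(complex ^ 'n::finite \<Rightarrow> complex) list \<Rightarrow> (complex ^ 'n) set" where
  "common_zeros fs = {x. \<forall>f\<in>set fs. f x = 0}"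

text \<open>Only the germ of this set at the origin is meaningful.\<close>

definition zero_set :: "'n::finite germ set \<Rightarrow> (complex ^ 'n) set" where
  "zero_set I = common_zeros (some_generators I)"

definition germ_subset :: "(complex ^ 'n::finite) set \<Rightarrow> (complex ^ 'n) set \<Rightarrow> bool" where
  "germ_subset A B \<longleftrightarrow> (\<forall>\<^sub>F x in nhds 0. x \<in> A \<longrightarrow> x \<in> B)"

definition coord_prod :: "complex ^ 'n::finite \<Rightarrow> complex" where
  "coord_prod x = (\<Prod>i\<in>UNIV. x $ i)"

definition norm_sq :: "(complex ^ 'n::finite \<Rightarrow> complex) list \<Rightarrow> complex ^ 'n \<Rightarrow> real" where
  "norm_sq fs x = (\<Sum>f\<leftarrow>fs. (cmod (f x))\<^sup>2)"

text \<open>Powers of non-negative reals with \<open>0\<^sup>0 = 1\<close>; the library has \<open>0 powr 0 = 0\<close>.\<close>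

definition rpow :: "real \<Rightarrow> real \<Rightarrow> real" where
  "rpow t s = (if s = 0 then 1 else t powr s)"

text \<open>The infimum is taken in the extended reals, so it is \<open>\<infinity>\<close> if there is no such exponent.\<close>

definition loj_tuple :: "(complex ^ 'n::finite \<Rightarrow> complex) list \<Rightarrow> ereal" where
  "loj_tuple fs = Inf (ereal ` {\<alpha>. \<alpha> \<ge> 0 \<and> (\<exists>C>0. \<exists>U. open U \<and> 0 \<in> U \<and>
     (\<forall>x\<in>U. rpow (cmod (coord_prod x)) \<alpha> \<le> C * sqrt (norm_sq fs x)))})"

definition loj_exponent :: "'n::finite germ set \<Rightarrow> ereal" where
  "loj_exponent I = loj_tuple (some_generators I)"

text \<open>The integrand takes the value \<open>\<infinity>\<close> at the common zeros if \<open>s > 0\<close>, because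
  \<open>inverse 0 = \<infinity>\<close> in \<^typ>\<open>ennreal\<close>.\<close>

definition lct_tuple :: "(complex ^ 'n::finite \<Rightarrow> complex) list \<Rightarrow> ereal" where
  "lct_tuple fs = Sup (ereal ` {s. s \<ge> 0 \<and> (\<exists>K. compact K \<and> 0 \<in> interior K \<and>
     (\<integral>\<^sup>+x\<in>K. inverse (ennreal (rpow (norm_sq fs x) s)) \<partial>lborel) < \<infinity>)})"

definition lct :: "'n::finite germ set \<Rightarrow> ereal" where
  "lct I = lct_tuple (some_generators I)"


subsection \<open>Independence of the generators\<close>

lemma abs_germ_eq_iff:
  assumes "analytic0 f" "analytic0 g"
  shows "abs_germ f = abs_germ g \<longleftrightarrow> (\<forall>\<^sub>F x in nhds 0. f x = g x)"
  using Quotient_rel[OF Quotient_germ, of f g] assms by (auto simp: germ_rel_def)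

lemma ex_rep_germ: "\<exists>f. analytic0 f \<and> abs_germ f = h"
  using Quotient_abs_rep[OF Quotient_germ, of h] Quotient_rep_reflp[OF Quotient_germ, of h]
  by (auto simp: germ_rel_def)

lemma abs_germ_mult_add:
  assumes "analytic0 c" "analytic0 f" "analytic0 g"
  shows "abs_germ c * abs_germ f + abs_germ g = abs_germ (\<lambda>x. c x * f x + g x)"
  using assms
  by (simp add: times_germ.abs_eq plus_germ.abs_eq germ_rel_def analytic0_mult)

lemma analytic0_bounded:
  fixes f :: "complex ^ 'n::finite \<Rightarrow> complex"
  assumes "analytic0 f"
  obtains C where "C > 0" "\<forall>\<^sub>F x in nhds 0. cmod (f x) \<le> C"
proof -
  obtain a r where a: "r > 0"
    "\<And>x. (\<forall>i. cmod (x $ i) < r) \<Longrightarrow> ((\<lambda>m. a m * monom_fun m x) has_sum f x) UNIV"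
    using assms unfolding analytic0_def by blast
  define y :: "complex ^ 'n" where "y = (\<chi> i. of_real (r / 2))"
  have "((\<lambda>m. a m * monom_fun m y) has_sum f y) UNIV"
    using a(1) by (intro a(2)) (auto simp: y_def norm_divide)
  then have sy: "(\<lambda>m. cmod (a m * monom_fun m y)) summable_on UNIV"
    by (rule iffD1[OF summable_on_iff_abs_summable_on_complex has_sum_imp_summable])
  have "cmod (f x) \<le> (\<Sum>\<^sub>\<infinity>m. cmod (a m * monom_fun m y))" if "\<forall>i. cmod (x $ i) < r / 2" for x
  proof -
    have hx: "((\<lambda>m. a m * monom_fun m x) has_sum f x) UNIV"
      using a(1) that by (intro a(2)) (smt (verit) field_sum_of_halves)
    then have sx: "(\<lambda>m. cmod (a m * monom_fun m x)) summable_on UNIV"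
      by (rule iffD1[OF summable_on_iff_abs_summable_on_complex has_sum_imp_summable])
    have "cmod (f x) \<le> (\<Sum>\<^sub>\<infinity>m. cmod (a m * monom_fun m x))"
      using norm_infsum_bound[of "\<lambda>m. a m * monom_fun m x" UNIV] sx infsumI[OF hx] by simp
    also have "\<dots> \<le> (\<Sum>\<^sub>\<infinity>m. cmod (a m * monom_fun m y))"
    proof (rule infsum_mono[OF sx sy])
      fix m
      have "cmod (monom_fun m x) \<le> cmod (monom_fun m y)"
        unfolding monom_fun_def prod_norm[symmetric] norm_power
        using that a(1) by (intro prod_mono conjI power_mono)
          (auto simp: y_def norm_divide intro: less_imp_le)
      then show "cmod (a m * monom_fun m x) \<le> cmod (a m * monom_fun m y)"
        by (simp add: norm_mult mult_left_mono)
    qed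
    finally show ?thesis .
  qed
  then have "\<forall>\<^sub>F x in nhds 0. cmod (f x) \<le> (\<Sum>\<^sub>\<infinity>m. cmod (a m * monom_fun m y)) + 1"
    using a(1) by (intro eventually_mono[OF eventually_polydisc[of "r / 2"]])
      (auto intro: add_increasing2)
  moreover have "(\<Sum>\<^sub>\<infinity>m. cmod (a m * monom_fun m y)) \<ge> 0"
    by (rule infsum_nonneg) simp
  ultimately show ?thesis
    by (intro that[of "(\<Sum>\<^sub>\<infinity>m. cmod (a m * monom_fun m y)) + 1"]) auto
qed

lemma norm_sq_nonneg: "norm_sq fs x \<ge> 0"
  unfolding norm_sq_def by (intro sum_list_nonneg) auto

lemma norm_le_norm_sq:
  assumes "f \<in> set fs"
  shows "cmod (f x) \<le> sqrt (norm_sq fs x)"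
proof -
  have "(cmod (f x))\<^sup>2 \<le> norm_sq fs x"
    unfolding norm_sq_def by (rule member_le_sum_list) (use assms in auto)
  then show ?thesis
    by (rule real_le_rsqrt)
qed

lemma norm_sq_eq_0_iff: "norm_sq fs x = 0 \<longleftrightarrow> x \<in> common_zeros fs"
  unfolding norm_sq_def common_zeros_def
  by (subst sum_list_nonneg_eq_0_iff) auto

lemma ideal_gen_bound:
  fixes gs :: "(complex ^ 'n::finite \<Rightarrow> complex) list"
  assumes h: "h \<in> ideal_gen (abs_germ ` set gs)" and gs: "\<forall>g\<in>set gs. analytic0 g"
  shows "\<forall>f. analytic0 f \<and> abs_germ f = h \<longrightarrow>
    (\<exists>C>0. \<forall>\<^sub>F x in nhds 0. cmod (f x) \<le> C * sqrt (norm_sq gs x))"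
  using h
proof (induction rule: self_module.span_induct_alt)
  case base
  have "\<forall>\<^sub>F x in nhds 0. cmod (f x) \<le> 1 * sqrt (norm_sq gs x)"
    if f: "analytic0 f" "abs_germ f = 0" for f :: "complex ^ 'n \<Rightarrow> complex"
  proof -
    have "\<forall>\<^sub>F x in nhds 0. f x = 0"
      using f abs_germ_eq_iff[OF f(1) analytic0_const[of 0]] by (simp add: zero_germ.abs_eq)
    then show ?thesis
      by eventually_elim (simp add: norm_sq_nonneg)
  qed
  then show ?case
    using zero_less_one by blast
next
  case (step c x y)
  obtain c' where c': "analytic0 c'" "abs_germ c' = c" using ex_rep_germ by blast
  obtain y' where y': "analytic0 y'" "abs_germ y' = y" using ex_rep_germ by blast
  obtain g where g: "g \<in> set gs" "x = abs_germ g" using step(1) by auto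
  obtain B where B: "B > 0" "\<forall>\<^sub>F x in nhds 0. cmod (c' x) \<le> B"
    using analytic0_bounded[OF c'(1)] .
  obtain C where C: "C > 0" "\<forall>\<^sub>F x in nhds 0. cmod (y' x) \<le> C * sqrt (norm_sq gs x)"
    using step(2) y' by blast
  have "\<forall>\<^sub>F x in nhds 0. cmod (f x) \<le> (B + C) * sqrt (norm_sq gs x)"
    if f: "analytic0 f" "abs_germ f = c * x + y" for f
  proof -
    have "abs_germ f = abs_germ (\<lambda>x. c' x * g x + y' x)"
      using f c' y' g gs abs_germ_mult_add[of c' g y'] by simp
    then have "\<forall>\<^sub>F x in nhds 0. f x = c' x * g x + y' x"
      using abs_germ_eq_iff[OF f(1) analytic0_add[OF analytic0_mult[OF c'(1)] y'(1)]] g gs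
      by auto
    then show ?thesis
      using B(2) C(2)
    proof eventually_elim
      case (elim x)
      have "cmod (f x) \<le> cmod (c' x) * cmod (g x) + cmod (y' x)"
        using elim(1) norm_triangle_ineq[of "c' x * g x" "y' x"] by (simp add: norm_mult)
      also have "\<dots> \<le> B * sqrt (norm_sq gs x) + C * sqrt (norm_sq gs x)"
        using elim B(1) norm_le_norm_sq[OF g(1), of x] by (intro add_mono mult_mono) auto
      finally show ?case by (simp add: distrib_right)
    qed
  qed
  moreover have "B + C > 0" using B C by simp
  ultimately show ?case by blast
qed

lemma generates_bound:
  assumes fs: "generates fs I" and gs: "generates gs I"
  obtains C where "C > 0" "\<forall>\<^sub>F x in nhds 0. norm_sq fs x \<le> C * norm_sq gs x"
proof -
  have "\<exists>C>0. \<forall>\<^sub>F x in nhds 0. norm_sq hs x \<le> C * norm_sq gs x" if "set hs \<subseteq> set fs" for hs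
    using that
  proof (induction hs)
    case Nil
    have "norm_sq [] x \<le> 1 * norm_sq gs x" for x :: "complex ^ 'a"
      using norm_sq_nonneg[of gs x] by (simp add: norm_sq_def)
    then show ?case by (intro exI[of _ 1]) auto
  next
    case (Cons f hs)
    obtain C where C: "C > 0" "\<forall>\<^sub>F x in nhds 0. norm_sq hs x \<le> C * norm_sq gs x"
      using Cons by auto
    have f: "analytic0 f" "abs_germ f \<in> ideal_gen (abs_germ ` set gs)"
      using Cons(2) fs gs self_module.span_base[of "abs_germ f" "abs_germ ` set fs"]
      by (auto simp: generates_def)
    obtain B where B: "B > 0" "\<forall>\<^sub>F x in nhds 0. cmod (f x) \<le> B * sqrt (norm_sq gs x)"
      using ideal_gen_bound[OF f(2)] f(1) gs by (auto simp: generates_def)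
    have "\<forall>\<^sub>F x in nhds 0. norm_sq (f # hs) x \<le> (B\<^sup>2 + C) * norm_sq gs x"
      using B(2) C(2)
    proof eventually_elim
      case (elim x)
      have "(cmod (f x))\<^sup>2 \<le> (B * sqrt (norm_sq gs x))\<^sup>2"
        using elim by (intro power_mono) auto
      then have "(cmod (f x))\<^sup>2 \<le> B\<^sup>2 * norm_sq gs x"
        by (simp add: power_mult_distrib norm_sq_nonneg)
      then show ?case
        using elim by (simp add: norm_sq_def distrib_right)
    qed
    moreover have "B\<^sup>2 + C > 0" using C by (simp add: add_nonneg_pos)
    ultimately show ?case by blast
  qed
  then show ?thesis using that by blast
qed

lemma generates_some_generators: "generates fs I \<Longrightarrow> generates (some_generators I) I"
  unfolding some_generators_def by (rule someI)

lemma common_zeros_mono: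
  assumes "generates fs I" "generates gs I"
  shows "germ_subset (common_zeros gs) (common_zeros fs)"
proof -
  obtain C where C: "C > 0" "\<forall>\<^sub>F x in nhds 0. norm_sq fs x \<le> C * norm_sq gs x"
    using generates_bound[OF assms] .
  show ?thesis
    unfolding germ_subset_def using C(2)
  proof eventually_elim
    case (elim x)
    then show ?case
      using norm_sq_nonneg[of fs x] by (auto simp flip: norm_sq_eq_0_iff)
  qed
qed

lemma zero_set_eqI:
  assumes "generates fs I"
  shows "\<forall>\<^sub>F x in nhds 0. x \<in> zero_set I \<longleftrightarrow> x \<in> common_zeros fs"
  using common_zeros_mono[OF assms generates_some_generators[OF assms]]
    common_zeros_mono[OF generates_some_generators[OF assms] assms]
  unfolding zero_set_def germ_subset_def by eventually_elim auto

lemma loj_tuple_le: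
  fixes fs gs :: "(complex ^ 'n::finite \<Rightarrow> complex) list"
  assumes "generates fs I" "generates gs I"
  shows "loj_tuple gs \<le> loj_tuple fs"
  unfolding loj_tuple_def
proof (intro Inf_superset_mono image_mono Collect_mono impI conjI; elim conjE exE)
  obtain C where C: "C > 0" "\<forall>\<^sub>F x in nhds 0. norm_sq fs x \<le> C * norm_sq gs x"
    using generates_bound[OF assms] .
  then obtain V where V: "open V" "0 \<in> V" "\<And>x. x \<in> V \<Longrightarrow> norm_sq fs x \<le> C * norm_sq gs x"
    by (auto simp: eventually_nhds)
  fix \<alpha> B :: real and U :: "(complex ^ 'n) set"
  assume B: "0 < B" and U: "open U" "0 \<in> U"
    "\<forall>x\<in>U. rpow (cmod (coord_prod x)) \<alpha> \<le> B * sqrt (norm_sq fs x)"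
  have "rpow (cmod (coord_prod x)) \<alpha> \<le> (B * sqrt C) * sqrt (norm_sq gs x)"
    if "x \<in> U \<inter> V" for x
  proof -
    have "rpow (cmod (coord_prod x)) \<alpha> \<le> B * sqrt (norm_sq fs x)" using U that by auto
    also have "\<dots> \<le> B * sqrt (C * norm_sq gs x)"
      using B V(3)[of x] that by (intro mult_left_mono real_sqrt_le_mono) auto
    finally show ?thesis by (simp only: real_sqrt_mult mult.assoc)
  qed
  then show "\<exists>C>0. \<exists>U. open U \<and> 0 \<in> U \<and>
      (\<forall>x\<in>U. rpow (cmod (coord_prod x)) \<alpha> \<le> C * sqrt (norm_sq gs x))"
    using B C(1) U V by (intro exI[of _ "B * sqrt C"] conjI exI[of _ "U \<inter> V"]) auto
qed

lemma loj_exponent_eqI: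
  assumes "generates fs I"
  shows "loj_exponent I = loj_tuple fs"
  unfolding loj_exponent_def
  by (intro antisym loj_tuple_le[of _ I] assms generates_some_generators[OF assms])

lemma nn_integral_cmult_le:
  fixes c :: real
  assumes "c > 0"
  shows "(\<integral>\<^sup>+x. ennreal c * f x \<partial>M) \<le> ennreal c * (\<integral>\<^sup>+x. f x \<partial>M)"
  unfolding nn_integral_def[of M "\<lambda>x. ennreal c * f x"]
proof (rule SUP_least, clarify)
  fix g assume g: "simple_function M g" "g \<le> (\<lambda>x. ennreal c * f x)"
  have c: "ennreal c * (ennreal (1 / c) * y) = y" for y
    using assms by (simp add: mult.assoc[symmetric] flip: ennreal_mult)
  have c': "ennreal (1 / c) * (ennreal c * y) = y" for y
    using assms by (simp add: mult.assoc[symmetric] flip: ennreal_mult)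
  have m: "(\<lambda>x. ennreal (1 / c) * g x) \<in> borel_measurable M"
    using borel_measurable_simple_function[OF g(1)] by simp
  have "integral\<^sup>S M g = (\<integral>\<^sup>+x. ennreal c * (ennreal (1 / c) * g x) \<partial>M)"
    using g(1) by (simp add: c nn_integral_eq_simple_integral)
  also have "\<dots> = ennreal c * (\<integral>\<^sup>+x. ennreal (1 / c) * g x \<partial>M)"
    by (rule nn_integral_cmult[OF m])
  also have "\<dots> \<le> ennreal c * (\<integral>\<^sup>+x. ennreal (1 / c) * (ennreal c * f x) \<partial>M)"
    using g(2) by (intro mult_left_mono nn_integral_mono) (auto simp: le_fun_def)
  finally show "integral\<^sup>S M g \<le> ennreal c * (\<integral>\<^sup>+x. f x \<partial>M)"
    by (simp add: c')
qed

lemma lct_tuple_le: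
  fixes fs gs :: "(complex ^ 'n::finite \<Rightarrow> complex) list"
  assumes "generates fs I" "generates gs I"
  shows "lct_tuple fs \<le> lct_tuple gs"
  unfolding lct_tuple_def
proof (intro Sup_subset_mono image_mono Collect_mono impI conjI; elim conjE exE)
  obtain C where C: "C > 0" "\<forall>\<^sub>F x in nhds 0. norm_sq fs x \<le> C * norm_sq gs x"
    using generates_bound[OF assms] .
  then obtain V where V: "open V" "0 \<in> V" "\<And>x. x \<in> V \<Longrightarrow> norm_sq fs x \<le> C * norm_sq gs x"
    by (auto simp: eventually_nhds)
  then obtain e where e: "e > 0" "cball 0 e \<subseteq> V"
    using open_contains_cball by blast
  fix s :: real and K :: "(complex ^ 'n) set"
  let ?h = "\<lambda>fs x. inverse (ennreal (rpow (norm_sq fs x) s))"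
  assume s: "0 \<le> s" and K: "compact K" "0 \<in> interior K"
    and fin: "(\<integral>\<^sup>+x\<in>K. ?h fs x \<partial>lborel) < \<infinity>"
  define D where "D = rpow C s"
  have D: "D > 0" using C(1) by (simp add: D_def rpow_def)
  let ?L = "K \<inter> cball 0 e"
  have le: "?h gs x \<le> ennreal D * ?h fs x" if "x \<in> ?L" for x
  proof -
    have le: "rpow (norm_sq fs x) s \<le> D * rpow (norm_sq gs x) s"
    proof (cases "s = 0")
      case False
      have "norm_sq fs x powr s \<le> (C * norm_sq gs x) powr s"
        using s V(3)[of x] e that by (intro powr_mono2 norm_sq_nonneg) auto
      then show ?thesis
        using False C(1) by (simp add: D_def rpow_def powr_mult norm_sq_nonneg)
    qed (simp add: D_def rpow_def)
    have nn: "rpow (norm_sq hs x) s \<ge> 0" for hs by (simp add: rpow_def)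
    show ?thesis
    proof (cases "rpow (norm_sq fs x) s = 0")
      case True
      then show ?thesis using D by (simp add: ennreal_mult_top)
    next
      case False
      then have p: "rpow (norm_sq fs x) s > 0" using nn[of fs] by simp
      then have q: "rpow (norm_sq gs x) s > 0"
        using le D nn[of gs] by (smt (verit) mult_nonneg_nonpos)
      have "inverse (rpow (norm_sq gs x) s) \<le> D * inverse (rpow (norm_sq fs x) s)"
        using le p q D by (simp add: field_simps)
      then show ?thesis
        using p q D by (simp add: inverse_ennreal flip: ennreal_mult)
    qed
  qed
  have "(\<integral>\<^sup>+x\<in>?L. ?h gs x \<partial>lborel) \<le> (\<integral>\<^sup>+x. ennreal D * (?h fs x * indicator K x) \<partial>lborel)"
    by (rule nn_integral_mono) (auto simp: indicator_def le)
  also have "\<dots> \<le> ennreal D * (\<integral>\<^sup>+x\<in>K. ?h fs x \<partial>lborel)"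
    by (rule nn_integral_cmult_le[OF D])
  also have "\<dots> < \<infinity>"
    using fin by (simp add: ennreal_mult_less_top)
  finally have "(\<integral>\<^sup>+x\<in>?L. ?h gs x \<partial>lborel) < \<infinity>" .
  moreover have "compact ?L" "0 \<in> interior ?L"
    using K e by (auto intro: compact_Int simp: interior_cball)
  ultimately show "\<exists>K. compact K \<and> 0 \<in> interior K \<and> (\<integral>\<^sup>+x\<in>K. ?h gs x \<partial>lborel) < \<infinity>"
    by blast
qed

lemma lct_eqI:
  assumes "generates fs I"
  shows "lct I = lct_tuple fs"
  unfolding lct_def
  by (intro antisym lct_tuple_le[of _ I] assms generates_some_generators[OF assms])

end

theory Submission
  imports Defs "HOL-Complex_Analysis.Cauchy_Integral_Formula" "HOL-Computational_Algebra.Primes"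
begin

text \<open>Let \<open>f\<close> be a tuple of generators of \<open>I\<close>, \<open>\<bar>f\<bar>\<close> its norm and \<open>p = x\<^sub>1 \<cdots> x\<^sub>n\<close>.

\<^bold>\<open>The inequality.\<close> If \<open>\<bar>p\<bar>\<^sup>\<alpha> \<le> C \<bar>f\<bar>\<close> near \<open>0\<close>, then \<open>\<bar>f\<bar>\<close> to the power \<open>-2s\<close> is at most
a constant times \<open>\<bar>p\<bar>\<close> to the power \<open>-2s\<alpha>\<close>, and this is integrable near \<open>0\<close> when \<open>s\<alpha> < 1\<close>. So every
\<open>s < 1/\<alpha>\<close> is admissible for the log canonical threshold
(\<open>lct_admissible_of_loj_admissible\<close>). Since \<open>I\<close> is proper, its elements vanish at \<open>0\<close>, and on the diagonal
\<open>(t, \<dots>, t)\<close> they are \<open>O(t)\<close> while \<open>p = t\<^sup>n\<close>; hence \<open>\<alpha> \<ge> 1/n\<close> (\<open>loj_admissible_ge\<close>), and the product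
of the two invariants is not of the form \<open>\<infinity> \<cdot> 0\<close>. If no exponent \<open>\<alpha>\<close> exists, the Lojasiewicz exponent is
\<open>\<infinity>\<close>, and it remains to see that the threshold is positive. This is true because \<open>I\<close> contains a nonzero
germ \<open>g\<close>, and a small negative power of \<open>\<bar>g\<bar>\<close> is integrable near \<open>0\<close> (\<open>local_integrability\<close>).

\<^bold>\<open>The equality.\<close> If the integral closure of \<open>I\<close> is monomial, then \<open>\<bar>f\<bar>\<^sup>2\<close> is comparable to a finite sum
of the \<open>\<bar>x\<^sup>m\<bar>\<^sup>2\<close> (\<open>monomial_integral_closure_comparison\<close>), which increases with every \<open>\<bar>x\<^sub>i\<bar>\<close>. On the
polydisc with radii \<open>\<bar>a\<^sub>i\<bar>\<close> the integrand of the threshold is then at least a constant times its value at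
\<open>a\<close>. The volume of this polydisc is a constant times \<open>\<bar>p(a)\<bar>\<^sup>2\<close>, so a finite integral gives
\<open>\<bar>p(a)\<bar>\<^sup>2 \<le> C (\<bar>f(a)\<bar>\<^sup>2)\<^sup>s\<close>, which says that \<open>1/s\<close> is an admissible Lojasiewicz exponent
(\<open>loj_admissible_of_lct_admissible\<close>).

\<^bold>\<open>Two analytic inputs.\<close> The invariants of an ideal are those of some finite tuple of generators, so the
ring of germs must be Noetherian. This is obtained from a division theorem of Grauert's type
(\<open>power_series_division\<close>): with respect to a monomial order, a power series can be divided by finitely many
others so that no monomial of the remainder is divisible by the leading monomial of a divisor. If the leading
monomials of the divisors generate those of all elements of the ideal, the remainder of an element of the
ideal is zero.
The order compares \<open>m\<close> through the integer \<open>\<Prod>p\<^sub>i ^ m\<^sub>i\<close> for distinct primes \<open>p\<^sub>i\<close>, which turns power series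
into Dirichlet series and makes the convergence of the division an elementary induction.

Local integrability of \<open>\<bar>g\<bar>\<close> to the power \<open>-s\<close> is a question about slices \<open>t \<mapsto> g (x + t v)\<close> with real \<open>t\<close>. If
\<open>v\<close> is chosen well, some derivative of order \<open>d\<close> of the slices is close to a nonzero constant for all small
\<open>x\<close> and \<open>t\<close>. Rolle's theorem then gives a bounded number of points such that the slice is at least a constant
times a fixed power of the distance to the nearest of them (\<open>lower_bound_by_distance\<close>). Averaging over translates of
a polydisc in the direction \<open>v\<close> passes from the slices to the whole space.\<close>

section \<open>A monomial order and Dickson's lemma\<close>

text \<open>Only the coordinates in a finite set \<open>A\<close> are compared, and \<open>A\<close> grows by one coordinate \<open>i\<close> at a time. A finite
set that works for \<open>A\<close> also works for the elements whose entry at \<open>i\<close> is large. The others fall into finitely many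
classes according to this entry, and each class has its own finite set for \<open>A\<close>.\<close>
lemma dickson_lemma:
  fixes S :: "('n::finite \<Rightarrow> nat) set"
  obtains F where "finite F" "F \<subseteq> S" "\<And>m. m \<in> S \<Longrightarrow> \<exists>k\<in>F. k \<le> m"
proof -
  have "\<exists>F. finite F \<and> F \<subseteq> S \<and> (\<forall>m\<in>S. \<exists>k\<in>F. \<forall>i\<in>A. k i \<le> m i)"
    if "finite A" for A :: "'n set" and S :: "('n \<Rightarrow> nat) set"
    using that
  proof (induction A arbitrary: S rule: finite_induct)
    case empty
    show ?case
    proof (cases "S = {}")
      case False
      then obtain m where "m \<in> S" by blast
      then show ?thesis by (intro exI[of _ "{m}"]) auto
    qed auto
  next
    case (insert i A)
    obtain F0 where F0: "finite F0" "F0 \<subseteq> S" "\<forall>m\<in>S. \<exists>k\<in>F0. \<forall>i\<in>A. k i \<le> m i"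
      using insert.IH[of S] by blast
    define N where "N = (\<Sum>k\<in>F0. k i)"
    have N: "k i \<le> N" if "k \<in> F0" for k
      unfolding N_def using F0(1) that by (intro member_le_sum) auto
    have "\<forall>v. \<exists>F. finite F \<and> F \<subseteq> {m\<in>S. m i = v} \<and>
        (\<forall>m\<in>{m\<in>S. m i = v}. \<exists>k\<in>F. \<forall>i\<in>A. k i \<le> m i)"
      using insert.IH by blast
    from choice[OF this] obtain G where G: "\<forall>v. finite (G v) \<and> G v \<subseteq> {m\<in>S. m i = v} \<and>
        (\<forall>m\<in>{m\<in>S. m i = v}. \<exists>k\<in>G v. \<forall>i\<in>A. k i \<le> m i)"
      by blast
    show ?case
    proof (intro exI[of _ "F0 \<union> (\<Union>v<N. G v)"] conjI ballI)
      show "finite (F0 \<union> (\<Union>v<N. G v))" using F0 G by auto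
      show "F0 \<union> (\<Union>v<N. G v) \<subseteq> S" using F0 G by blast
      fix m assume m: "m \<in> S"
      show "\<exists>k\<in>F0 \<union> (\<Union>v<N. G v). \<forall>i\<in>insert i A. k i \<le> m i"
      proof (cases "m i < N")
        case True
        obtain k where "k \<in> G (m i)" "\<forall>i\<in>A. k i \<le> m i" using G m by blast
        moreover from this(1) have "k i = m i" using G by blast
        ultimately show ?thesis using True by (intro bexI[of _ k]) auto
      next
        case False
        obtain k where "k \<in> F0" "\<forall>i\<in>A. k i \<le> m i" using F0(3) m by blast
        moreover from this(1) have "k i \<le> m i" using N[of k] False by simp
        ultimately show ?thesis by (intro bexI[of _ k]) auto
      qed
    qed
  qed
  from this[OF finite, where A = UNIV and S = S] show ?thesis
    using that by (auto simp: le_fun_def)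
qed

definition coord_prime :: "'n::finite \<Rightarrow> nat" where
  "coord_prime = (SOME p. inj p \<and> (\<forall>i. prime (p i)))"

text \<open>The integer that defines the monomial order. Unique factorization makes it injective, so that it orders the
multi-indices totally, and it is multiplicative. Moreover \<open>1 / weight m ^ t\<close> is the value of the
monomial \<open>x\<^sup>m\<close> at the point with coordinates \<open>1 / p\<^sub>i ^ t\<close>, so that it measures convergence as well.\<close>
definition weight :: "('n::finite \<Rightarrow> nat) \<Rightarrow> nat" where
  "weight m = (\<Prod>i\<in>UNIV. coord_prime i ^ m i)"

lemma coord_prime: "inj (coord_prime :: 'n::finite \<Rightarrow> nat)" "prime (coord_prime (i :: 'n))"
proof -
  obtain P where P: "P \<subseteq> {p::nat. prime p}" "finite P" "card P = CARD('n)"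
    using infinite_arbitrarily_large[OF primes_infinite] by blast
  then obtain p :: "'n \<Rightarrow> nat" where "bij_betw p UNIV P"
    using finite_same_card_bij[of "UNIV :: 'n set" P] by auto
  then have "inj p \<and> (\<forall>i. prime (p i))"
    using P(1) by (auto simp: bij_betw_def)
  then have "\<exists>p :: 'n \<Rightarrow> nat. inj p \<and> (\<forall>i. prime (p i))" by blast
  then have *: "inj (coord_prime :: 'n \<Rightarrow> nat) \<and> (\<forall>i::'n. prime (coord_prime i))"
    unfolding coord_prime_def by (rule someI_ex)
  show "inj (coord_prime :: 'n::finite \<Rightarrow> nat)" "prime (coord_prime (i :: 'n))"
    using * by blast+
qed

lemma weight_pos: "weight m > 0"
  unfolding weight_def by (intro prod_pos) (use coord_prime(2) prime_gt_0_nat in auto)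

lemma weight_add: "weight (\<lambda>i. k i + l i) = weight k * weight l"
  by (simp add: weight_def power_add prod.distrib)

lemma inj_weight: "inj (weight :: ('n::finite \<Rightarrow> nat) \<Rightarrow> nat)"
proof (rule injI, rule ext)
  fix k l :: "'n \<Rightarrow> nat" and i :: 'n
  assume eq: "weight k = weight l"
  have "multiplicity (coord_prime i) (weight m) = m i" for m :: "'n \<Rightarrow> nat"
  proof -
    have "weight m = (\<Prod>q\<in>range (coord_prime :: 'n \<Rightarrow> nat). q ^ m (inv coord_prime q))"
      unfolding weight_def using coord_prime(1) by (subst prod.reindex) auto
    then show ?thesis
      using coord_prime(2) by (subst \<open>weight m = _\<close>, subst multiplicity_prod_prime_powers)
        (auto simp: inv_f_f[OF coord_prime(1)])
  qed
  then show "k i = l i" using eq by metis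
qed

lemma weight_inverse_power:
  fixes m :: "'n::finite \<Rightarrow> nat"
  shows "(\<Prod>i\<in>UNIV. (1 / real (coord_prime i) ^ t) ^ m i) = 1 / real (weight m) ^ t"
  by (simp add: weight_def power_divide prod_dividef prod_power_distrib power_mult[symmetric] mult.commute)

lemma weight_diff: "k \<le> m \<Longrightarrow> weight m = weight k * weight (\<lambda>i. m i - k i)"
  by (subst weight_add[symmetric]) (auto simp: le_fun_def)

text \<open>In the division algorithm, cancelling a term of exponent \<open>m - l + j\<close> with a divisor of leading exponent
\<open>j\<close> creates a term of exponent \<open>m\<close> for each further exponent \<open>l\<close> of the divisor. The new exponents are larger.\<close>
lemma weight_replace_less:
  assumes "l \<le> m" "weight j < weight l"
  shows "weight (\<lambda>i. m i - l i + j i) < weight m"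
  using assms weight_pos[of "\<lambda>i. m i - l i"] by (simp add: weight_add weight_diff)

lemma summable_on_weight: "(\<lambda>m :: 'n::finite \<Rightarrow> nat. 1 / real (weight m) ^ 2) summable_on UNIV"
proof -
  have "(\<lambda>n. 1 / real n ^ 2) summable_on UNIV"
    using inverse_power_summable[of 2, where 'a = real]
    by (subst summable_on_UNIV_nonneg_real_iff) (auto simp: inverse_eq_divide)
  then have "(\<lambda>n. 1 / real n ^ 2) summable_on range (weight :: ('n \<Rightarrow> nat) \<Rightarrow> nat)"
    by (rule summable_on_subset_banach) auto
  then show ?thesis
    by (subst (asm) summable_on_reindex[OF inj_weight]) (simp add: o_def)
qed

section \<open>Power series expansions and the growth of coefficients\<close>

text \<open>The radius and the coefficients are kept explicit: the division algorithm works on coefficients, and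
convergence on a common polydisc is what makes its results functions again.\<close>
definition expands ::
  "(('n::finite \<Rightarrow> nat) \<Rightarrow> complex) \<Rightarrow> real \<Rightarrow> (complex ^ 'n \<Rightarrow> complex) \<Rightarrow> bool" where
  "expands a r f \<longleftrightarrow> r > 0 \<and>
     (\<forall>x. (\<forall>i. cmod (x $ i) < r) \<longrightarrow> ((\<lambda>m. a m * monom_fun m x) has_sum f x) UNIV)"

lemma analytic0_iff_expands: "analytic0 f \<longleftrightarrow> (\<exists>a r. expands a r f)"
  by (auto simp: analytic0_def expands_def)

lemma expands_shrink: "expands a r f \<Longrightarrow> 0 < s \<Longrightarrow> s \<le> r \<Longrightarrow> expands a s f"
  unfolding expands_def by (meson order_less_le_trans)

definition convolve ::
  "(('n::finite \<Rightarrow> nat) \<Rightarrow> complex) \<Rightarrow> (('n \<Rightarrow> nat) \<Rightarrow> complex) \<Rightarrow> ('n \<Rightarrow> nat) \<Rightarrow> complex" where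
  "convolve a b m = (\<Sum>k | k \<le> m. a k * b (\<lambda>i. m i - k i))"

lemma expands_mult:
  fixes f g :: "complex ^ 'n::finite \<Rightarrow> complex"
  assumes a: "expands a r f" and b: "expands b r g"
  shows "expands (convolve a b) r (\<lambda>x. f x * g x)"
  unfolding expands_def
proof (intro conjI allI impI)
  show "r > 0" using a by (simp add: expands_def)
  fix x :: "complex ^ 'n" assume x: "\<forall>i. cmod (x $ i) < r"
  let ?F = "\<lambda>k. a k * monom_fun k x" and ?G = "\<lambda>l. b l * monom_fun l x"
  let ?B = "\<lambda>m. {k :: 'n \<Rightarrow> nat. k \<le> m}"
  let ?H = "\<lambda>(m, k). ?F k * ?G (\<lambda>i. m i - k i)"
  have "((\<lambda>(k, l). ?F k * ?G l) has_sum f x * g x) (UNIV \<times> UNIV)"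
    using x a b by (intro has_sum_product_complex) (auto simp: expands_def)
  also have "?this \<longleftrightarrow> (?H has_sum f x * g x) (Sigma UNIV ?B)"
    by (rule has_sum_reindex_bij_witness[where
          j = "\<lambda>(k, l). (\<lambda>i. k i + l i, k)" and i = "\<lambda>(m, k). (k, \<lambda>i. m i - k i)"])
      (auto simp: le_fun_def)
  finally have "(?H has_sum f x * g x) (Sigma UNIV ?B)" .
  then show "((\<lambda>m. convolve a b m * monom_fun m x) has_sum f x * g x) UNIV"
  proof (rule has_sum_SigmaD)
    fix m :: "'n \<Rightarrow> nat"
    have "?F k * ?G (\<lambda>i. m i - k i) = a k * b (\<lambda>i. m i - k i) * monom_fun m x"
      if "k \<in> ?B m" for k
    proof -
      have "(\<lambda>i. k i + (m i - k i)) = m"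
        using that by (auto simp: le_fun_def fun_eq_iff)
      then have "monom_fun m x = monom_fun k x * monom_fun (\<lambda>i. m i - k i) x"
        using monom_fun_add[of k "\<lambda>i. m i - k i" x] by (simp only:)
      then show ?thesis by (simp only: mult_ac)
    qed
    then have "(\<Sum>k\<in>?B m. ?H (m, k)) = convolve a b m * monom_fun m x"
      unfolding convolve_def sum_distrib_right by (intro sum.cong) auto
    then show "((\<lambda>k. ?H (m, k)) has_sum convolve a b m * monom_fun m x) (?B m)"
      using finite_multi_index_le[of m] by (intro has_sum_finiteI) (auto simp: le_fun_def)
  qed
qed

lemma expands_add: "expands a r f \<Longrightarrow> expands b r g \<Longrightarrow> expands (\<lambda>m. a m + b m) r (\<lambda>x. f x + g x)"
  unfolding expands_def by (auto simp: distrib_right intro: has_sum_add)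

lemma expands_cmult:
  assumes "expands a r f"
  shows "expands (\<lambda>m. c * a m) r (\<lambda>x. c * f x)"
  unfolding expands_def mult.assoc
proof (intro conjI allI impI has_sum_cmult_right)
  show "r > 0" using assms unfolding expands_def by (rule conjunct1)
  fix x :: "complex ^ 'a" assume "\<forall>i. cmod (x $ i) < r"
  then show "((\<lambda>m. a m * monom_fun m x) has_sum f x) UNIV"
    using assms unfolding expands_def by blast
qed

lemma expands_zero: "r > 0 \<Longrightarrow> expands (\<lambda>_. 0) r (\<lambda>_. 0)"
  unfolding expands_def by simp

lemma expands_sum:
  assumes "finite F" "\<And>j. j \<in> F \<Longrightarrow> expands (a j) r (f j)" "r > 0"
  shows "expands (\<lambda>m. \<Sum>j\<in>F. a j m) r (\<lambda>x. \<Sum>j\<in>F. f j x)"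
  using assms by (induction F rule: finite_induct) (simp_all add: expands_zero expands_add)

lemma expands_unique:
  assumes "expands a r f" "expands a s g"
  shows "\<forall>\<^sub>F x in nhds 0. f x = g x"
proof -
  have "r > 0" "s > 0" using assms by (auto simp: expands_def)
  show ?thesis
    using eventually_polydisc[OF \<open>r > 0\<close>] eventually_polydisc[OF \<open>s > 0\<close>]
  proof eventually_elim
    case (elim x)
    then have "((\<lambda>m. a m * monom_fun m x) has_sum f x) UNIV"
      "((\<lambda>m. a m * monom_fun m x) has_sum g x) UNIV"
      using assms by (simp_all add: expands_def)
    then show ?case by (rule has_sum_unique)
  qed
qed

text \<open>The sum is the absolute series at the point with coordinates \<open>1 / p\<^sub>i ^ t\<close>, which lies in the polydisc of
convergence when \<open>t\<close> is large.\<close>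
lemma coeffs_growth:
  assumes "expands a r f"
  shows "\<forall>\<^sub>F t in sequentially. (\<lambda>m. cmod (a m) / real (weight m) ^ t) summable_on UNIV"
proof -
  have "(\<lambda>t. (1/2::real) ^ t) \<longlonglongrightarrow> 0" by (intro LIMSEQ_power_zero) auto
  then have "\<forall>\<^sub>F t in sequentially. (1/2::real) ^ t < r"
    using assms by (intro order_tendstoD) (auto simp: expands_def)
  then show ?thesis
  proof eventually_elim
    case (elim t)
    define y :: "complex ^ 'a" where "y = (\<chi> i. of_real (1 / real (coord_prime i) ^ t))"
    have "cmod (y $ i) < r" for i
    proof -
      have "2 \<le> real (coord_prime i)" using prime_ge_2_nat[OF coord_prime(2)[of i]] by simp
      then have "1 / real (coord_prime i) ^ t \<le> (1/2) ^ t"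
        by (simp add: power_one_over field_simps power_mono)
      then show ?thesis using elim by (simp add: y_def norm_divide norm_power)
    qed
    then have "((\<lambda>m. a m * monom_fun m y) has_sum f y) UNIV"
      using assms by (auto simp: expands_def)
    then have "(\<lambda>m. cmod (a m * monom_fun m y)) summable_on UNIV"
      by (rule iffD1[OF summable_on_iff_abs_summable_on_complex has_sum_imp_summable])
    moreover have "monom_fun m y = of_real (1 / real (weight m) ^ t)" for m
      unfolding monom_fun_def y_def weight_inverse_power[symmetric] of_real_prod of_real_power by simp
    ultimately show ?case
      by (simp add: norm_mult norm_divide norm_power)
  qed
qed

text \<open>The converse of the growth estimate. On a polydisc with \<open>\<bar>x\<^sub>i\<bar> \<le> 1 / p\<^sub>i ^ (t + 2)\<close> the terms are dominated by
\<open>B / (weight m)\<^sup>2\<close>. The radius depends on \<open>t\<close> only, so that it serves several series at once.\<close>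
lemma expands_of_growth:
  "\<exists>r>0. \<forall>(a :: ('n::finite \<Rightarrow> nat) \<Rightarrow> complex) B.
     (\<forall>m. cmod (a m) \<le> B * real (weight m) ^ t) \<longrightarrow> (\<exists>f. expands a r f)"
proof -
  define r where "r = 1 / real (weight (\<lambda>_::'n. 1)) ^ (t + 2)"
  have r: "r > 0" unfolding r_def using weight_pos[of "\<lambda>_::'n. 1"] by simp
  have r': "r \<le> 1 / real (coord_prime i) ^ (t + 2)" for i :: 'n
  proof -
    have "coord_prime i dvd weight (\<lambda>_::'n. 1)"
      unfolding weight_def by (simp add: dvd_prodI)
    then have "coord_prime i \<le> weight (\<lambda>_::'n. 1)"
      using weight_pos by (rule dvd_imp_le)
    then have "real (coord_prime i) ^ (t + 2) \<le> real (weight (\<lambda>_::'n. 1)) ^ (t + 2)"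
      by (intro power_mono) auto
    moreover have "coord_prime i > 0" using coord_prime(2) prime_gt_0_nat by blast
    ultimately show ?thesis
      unfolding r_def by (intro divide_left_mono) (use weight_pos[of "\<lambda>_::'n. 1"] in auto)
  qed
  have "\<exists>f. expands a r f" if a: "\<And>m. cmod (a m) \<le> B * real (weight m) ^ t"
    for a :: "('n \<Rightarrow> nat) \<Rightarrow> complex" and B
  proof -
    have "(\<lambda>m. a m * monom_fun m x) summable_on UNIV" if x: "\<forall>i. cmod (x $ i) < r" for x
    proof -
      have "cmod (a m * monom_fun m x) \<le> B * (1 / real (weight m) ^ 2)" for m
      proof -
        have "cmod (monom_fun m x) \<le> (\<Prod>i\<in>UNIV. (1 / real (coord_prime i) ^ (t + 2)) ^ m i)"
          unfolding monom_fun_def prod_norm[symmetric] norm_power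
          using x by (intro prod_mono conjI power_mono order_trans[OF _ r']) (auto intro: less_imp_le)
        also have "\<dots> = 1 / real (weight m) ^ (t + 2)"
          by (rule weight_inverse_power)
        finally have "cmod (a m * monom_fun m x) \<le> (B * real (weight m) ^ t) * (1 / real (weight m) ^ (t + 2))"
          unfolding norm_mult using order_trans[OF norm_ge_zero a] by (intro mult_mono a) auto
        then show ?thesis
          using weight_pos[of m] by (simp add: power_add power2_eq_square)
      qed
      then have "(\<lambda>m. cmod (a m * monom_fun m x)) summable_on UNIV"
        by (intro Infinite_Sum.abs_summable_on_comparison_test'[OF
              summable_on_cmult_right[OF summable_on_weight, of B]]) auto
      then show ?thesis
        by (rule abs_summable_summable)
    qed
    then show ?thesis
      using r by (intro exI[of _ "\<lambda>x. \<Sum>\<^sub>\<infinity>m. a m * monom_fun m x"]) (auto simp: expands_def)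
  qed
  with r show ?thesis by blast
qed

section \<open>Division of convergent power series\<close>

definition divisor_below :: "('n::finite \<Rightarrow> nat) set \<Rightarrow> ('n \<Rightarrow> nat) \<Rightarrow> ('n \<Rightarrow> nat)" where
  "divisor_below F m = (SOME j. j \<in> F \<and> j \<le> m)"

text \<open>For power series \<open>a\<close> and divisors \<open>c j\<close> with leading exponent \<open>j \<in> F\<close> and leading coefficient \<open>1\<close>, the division
identity \<open>a = (\<Sum>j\<in>F. c j * q j) + r\<close> is solved with one unknown series \<open>g\<close>: its part
on the exponents assigned to \<open>j\<close> is \<open>x\<^sup>j q j\<close>, and its part on the exponents that lie above no element of
\<open>F\<close> is \<open>r\<close>. Comparing coefficients at \<open>m\<close> expresses \<open>g m\<close> by values of \<open>g\<close> at exponents of smaller weight.\<close>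
function division_coeff ::
  "('n::finite \<Rightarrow> nat) set \<Rightarrow> (('n \<Rightarrow> nat) \<Rightarrow> ('n \<Rightarrow> nat) \<Rightarrow> complex) \<Rightarrow> (('n \<Rightarrow> nat) \<Rightarrow> complex) \<Rightarrow>
    ('n \<Rightarrow> nat) \<Rightarrow> complex" where
  "division_coeff F c a m = a m - (\<Sum>j\<in>F. \<Sum>l | l \<le> m \<and> weight j < weight l.
     c j l * (if divisor_below F (\<lambda>i. m i - l i + j i) = j
       then division_coeff F c a (\<lambda>i. m i - l i + j i) else 0))"
  by pat_completeness auto
termination
  by (relation "Wellfounded.measure (\<lambda>(F, c, a, m). weight m)") (auto intro: weight_replace_less)

declare division_coeff.simps [simp del]

definition quotient_coeff where
  "quotient_coeff F c a j k = (if divisor_below F (\<lambda>i. k i + j i) = j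
     then division_coeff F c a (\<lambda>i. k i + j i) else 0)"

definition remainder_coeff where
  "remainder_coeff F c a m = (if \<exists>j\<in>F. j \<le> m then 0 else division_coeff F c a m)"

lemma finite_multi_indices_below: "finite {k :: 'n::finite \<Rightarrow> nat. k \<le> m \<and> P k}"
  by (rule finite_subset[OF _ finite_multi_index_le[of m]]) (auto simp: le_fun_def)

lemma division_coeff_eq:
  "division_coeff F c a m = a m - (\<Sum>j\<in>F. \<Sum>l | l \<le> m \<and> weight j < weight l.
     c j l * quotient_coeff F c a j (\<lambda>i. m i - l i))"
  by (subst division_coeff.simps) (simp add: quotient_coeff_def)

text \<open>In the product \<open>c j * q j\<close> the leading term of \<open>c j\<close> contributes the part of \<open>g\<close> assigned to \<open>j\<close>. Together
with the remainder these parts add up to \<open>g\<close>, and the other terms are those subtracted in the recursion.\<close>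
lemma division_coeff_identity:
  assumes F: "finite F" and c: "\<And>j. j \<in> F \<Longrightarrow> c j j = 1"
    and c0: "\<And>j l. j \<in> F \<Longrightarrow> weight l < weight j \<Longrightarrow> c j l = 0"
  shows "a m = (\<Sum>j\<in>F. convolve (c j) (quotient_coeff F c a j) m) + remainder_coeff F c a m"
proof -
  let ?q = "quotient_coeff F c a" and ?g = "division_coeff F c a"
  have "convolve (c j) (?q j) m =
      (\<Sum>l | l \<le> m \<and> weight j < weight l. c j l * ?q j (\<lambda>i. m i - l i)) +
      (if j \<le> m then if divisor_below F m = j then ?g m else 0 else 0)" if j: "j \<in> F" for j
  proof -
    let ?X = "\<lambda>l. c j l * ?q j (\<lambda>i. m i - l i)"
    have "convolve (c j) (?q j) m = (\<Sum>l | l \<le> m \<and> weight j \<le> weight l. ?X l)"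
      unfolding convolve_def using finite_multi_indices_below[of m "\<lambda>_. True"] c0[OF j]
      by (intro sum.mono_neutral_right) (auto simp: not_le)
    also have "{l. l \<le> m \<and> weight j \<le> weight l} =
        {l. l \<le> m \<and> weight j < weight l} \<union> (if j \<le> m then {j} else {})"
      using injD[OF inj_weight, of j] by (auto simp: le_less)
    also have "(\<Sum>l\<in>\<dots>. ?X l) = (\<Sum>l | l \<le> m \<and> weight j < weight l. ?X l) + (\<Sum>l\<in>(if j \<le> m then {j} else {}). ?X l)"
      using finite_multi_indices_below by (intro sum.union_disjoint) auto
    also have "(\<Sum>l\<in>(if j \<le> m then {j} else {}). ?X l) = (if j \<le> m then if divisor_below F m = j then ?g m else 0 else 0)"
    proof (cases "j \<le> m")
      case True
      then have "(\<lambda>i. m i - j i + j i) = m" by (auto simp: le_fun_def)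
      then have "?q j (\<lambda>i. m i - j i) = (if divisor_below F m = j then ?g m else 0)"
        unfolding quotient_coeff_def by (simp only:)
      then show ?thesis using True c[OF j] by simp
    qed simp
    finally show ?thesis .
  qed
  then have "(\<Sum>j\<in>F. convolve (c j) (?q j) m) = (a m - ?g m) +
      (\<Sum>j\<in>F. if j \<le> m then if divisor_below F m = j then ?g m else 0 else 0)"
    unfolding division_coeff_eq[of F c a m] by (simp add: sum.distrib)
  also have "(\<Sum>j\<in>F. if j \<le> m then if divisor_below F m = j then ?g m else 0 else 0) = ?g m - remainder_coeff F c a m"
  proof (cases "\<exists>j\<in>F. j \<le> m")
    case True
    then have d: "divisor_below F m \<in> F \<and> divisor_below F m \<le> m"
      unfolding divisor_below_def by (intro someI_ex[of "\<lambda>j. j \<in> F \<and> j \<le> m"]) blast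
    have "(\<Sum>j\<in>F. if j \<le> m then if divisor_below F m = j then ?g m else 0 else 0)
        = (\<Sum>j\<in>F. if divisor_below F m = j then ?g m else 0)"
      using d by (intro sum.cong) auto
    also have "\<dots> = ?g m" using d F by simp
    finally show ?thesis using True by (simp add: remainder_coeff_def)
  next
    case False
    then have "(\<Sum>j\<in>F. if j \<le> m then if divisor_below F m = j then ?g m else 0 else 0) = 0"
      by (intro sum.neutral) auto
    then show ?thesis using False by (simp add: remainder_coeff_def)
  qed
  finally show ?thesis by simp
qed

text \<open>Induction along the recursion: the earlier values occur with total weight at most \<open>1/2\<close> relative to
\<open>weight m ^ t\<close>, so the bound \<open>2 * B\<close> reproduces itself as \<open>B + (2 * B) / 2\<close>.\<close>
lemma division_coeff_bound:
  assumes F: "finite F"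
    and small: "\<And>j L. j \<in> F \<Longrightarrow> finite L \<Longrightarrow> L \<subseteq> {l. weight j < weight l} \<Longrightarrow>
      (\<Sum>l\<in>L. cmod (c j l) * (real (weight j) / real (weight l)) ^ t) \<le> \<epsilon>"
    and \<epsilon>: "real (card F) * \<epsilon> \<le> 1/2"
    and a: "\<And>m. cmod (a m) \<le> B * real (weight m) ^ t" and B: "B \<ge> 0"
  shows "cmod (division_coeff F c a m) \<le> 2 * B * real (weight m) ^ t"
proof (induction m rule: measure_induct_rule[of weight])
  case (less m)
  let ?q = "quotient_coeff F c a"
  have "cmod (\<Sum>l | l \<le> m \<and> weight j < weight l. c j l * ?q j (\<lambda>i. m i - l i))
      \<le> \<epsilon> * (2 * B * real (weight m) ^ t)" if j: "j \<in> F" for j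
  proof -
    have "cmod (c j l * ?q j (\<lambda>i. m i - l i))
        \<le> cmod (c j l) * (real (weight j) / real (weight l)) ^ t * (2 * B * real (weight m) ^ t)"
      if l: "l \<le> m" "weight j < weight l" for l
    proof -
      have w: "weight (\<lambda>i. m i - l i + j i) < weight m"
        using l by (rule weight_replace_less)
      have "weight (\<lambda>i. m i - l i + j i) * weight l = weight m * weight j"
        using weight_diff[OF l(1)] by (simp add: weight_add)
      then have "real (weight (\<lambda>i. m i - l i + j i)) * real (weight l) = real (weight m) * real (weight j)"
        by (metis of_nat_mult)
      then have e: "real (weight (\<lambda>i. m i - l i + j i)) = real (weight j) / real (weight l) * real (weight m)"
        using weight_pos[of l] by (simp add: field_simps)
      have "cmod (?q j (\<lambda>i. m i - l i)) \<le> 2 * B * real (weight (\<lambda>i. m i - l i + j i)) ^ t"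
        using less[OF w] B by (simp add: quotient_coeff_def)
      also have "\<dots> = (real (weight j) / real (weight l)) ^ t * (2 * B * real (weight m) ^ t)"
        unfolding e power_mult_distrib by (simp only: mult_ac)
      finally show ?thesis
        unfolding norm_mult mult.assoc by (intro mult_left_mono) auto
    qed
    then have "cmod (\<Sum>l | l \<le> m \<and> weight j < weight l. c j l * ?q j (\<lambda>i. m i - l i))
        \<le> (\<Sum>l | l \<le> m \<and> weight j < weight l.
            cmod (c j l) * (real (weight j) / real (weight l)) ^ t * (2 * B * real (weight m) ^ t))"
      by (intro sum_norm_le) auto
    also have "\<dots> \<le> \<epsilon> * (2 * B * real (weight m) ^ t)"
      unfolding sum_distrib_right[symmetric]
      using B finite_multi_indices_below by (intro mult_right_mono small[OF j]) auto
    finally show ?thesis .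
  qed
  then have "cmod (\<Sum>j\<in>F. \<Sum>l | l \<le> m \<and> weight j < weight l. c j l * ?q j (\<lambda>i. m i - l i))
      \<le> real (card F) * (\<epsilon> * (2 * B * real (weight m) ^ t))"
    by (intro order_trans[OF norm_sum sum_bounded_above])
  also have "\<dots> = (real (card F) * \<epsilon>) * (2 * B * real (weight m) ^ t)" by simp
  also have "\<dots> \<le> 1/2 * (2 * B * real (weight m) ^ t)"
    using \<epsilon> B by (intro mult_right_mono) auto
  finally have "cmod (\<Sum>j\<in>F. \<Sum>l | l \<le> m \<and> weight j < weight l. c j l * ?q j (\<lambda>i. m i - l i))
      \<le> B * real (weight m) ^ t" by simp
  then show ?case
    unfolding division_coeff_eq[of F c a m]
    using a[of m] by (intro order_trans[OF norm_triangle_ineq4]) linarith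
qed

text \<open>Each quotient of weights occurring here is at most \<open>w / (w + 1)\<close> with \<open>w = weight j\<close>, so raising \<open>t\<close> by \<open>e\<close> gains
at least the factor \<open>(w / (w + 1)) ^ e\<close> over an exponent for which the series converges.\<close>
lemma tail_sum_small:
  fixes c :: "('n::finite \<Rightarrow> nat) \<Rightarrow> complex" and j :: "'n \<Rightarrow> nat"
  assumes "expands c r f" "\<epsilon> > 0"
  shows "\<forall>\<^sub>F t in sequentially. \<forall>L. finite L \<and> L \<subseteq> {l. weight j < weight l} \<longrightarrow>
      (\<Sum>l\<in>L. cmod (c l) * (real (weight j) / real (weight l)) ^ t) \<le> \<epsilon>"
proof -
  obtain t0 where t0: "(\<lambda>m. cmod (c m) / real (weight m) ^ t0) summable_on UNIV"
    using coeffs_growth[OF assms(1)] eventually_happens' sequentially_bot by blast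
  define S where "S = (\<Sum>\<^sub>\<infinity>m. cmod (c m) / real (weight m) ^ t0)"
  define w where "w = real (weight j)"
  define q where "q = w / (w + 1)"
  have w: "w > 0" unfolding w_def using weight_pos[of j] by simp
  have q: "q \<ge> 0" "q < 1" using w by (auto simp: q_def)
  have "(\<lambda>e. w ^ t0 * S * q ^ e) \<longlonglongrightarrow> w ^ t0 * S * 0"
    using q by (intro tendsto_intros LIMSEQ_power_zero) auto
  then have "\<forall>\<^sub>F e in sequentially. w ^ t0 * S * q ^ e < \<epsilon>"
    using assms(2) by (intro order_tendstoD) auto
  then have "\<forall>\<^sub>F t in sequentially. w ^ t0 * S * q ^ (t - t0) < \<epsilon>"
    by (rule eventually_compose_filterlim[OF _ filterlim_minus_const_nat_at_top])
  then show ?thesis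
    using eventually_ge_at_top[of t0]
  proof eventually_elim
    case (elim t)
    show ?case
    proof (intro allI impI, elim conjE)
      fix L :: "('n \<Rightarrow> nat) set" assume L: "finite L" "L \<subseteq> {l. weight j < weight l}"
      have "cmod (c l) * (w / real (weight l)) ^ t \<le> (w ^ t0 * q ^ (t - t0)) * (cmod (c l) / real (weight l) ^ t0)"
        if "l \<in> L" for l
      proof -
        have l: "w + 1 \<le> real (weight l)" using L(2) that unfolding w_def by fastforce
        have "(w / real (weight l)) ^ t = (w / real (weight l)) ^ t0 * (w / real (weight l)) ^ (t - t0)"
          using elim(2) by (simp flip: power_add)
        also have "\<dots> \<le> (w / real (weight l)) ^ t0 * q ^ (t - t0)"
          using l w unfolding q_def
          by (intro mult_left_mono power_mono divide_left_mono) auto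
        finally have "cmod (c l) * (w / real (weight l)) ^ t \<le> cmod (c l) * ((w / real (weight l)) ^ t0 * q ^ (t - t0))"
          by (intro mult_left_mono) auto
        then show ?thesis
          by (simp only: power_divide times_divide_eq_right times_divide_eq_left mult_ac)
      qed
      then have "(\<Sum>l\<in>L. cmod (c l) * (w / real (weight l)) ^ t)
          \<le> (\<Sum>l\<in>L. (w ^ t0 * q ^ (t - t0)) * (cmod (c l) / real (weight l) ^ t0))"
        by (rule sum_mono)
      also have "\<dots> = (w ^ t0 * q ^ (t - t0)) * (\<Sum>l\<in>L. cmod (c l) / real (weight l) ^ t0)"
        by (rule sum_distrib_left[symmetric])
      also have "\<dots> \<le> (w ^ t0 * q ^ (t - t0)) * S"
        unfolding S_def using w q L(1) by (intro mult_left_mono finite_sum_le_infsum t0) auto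
      also have "\<dots> = w ^ t0 * S * q ^ (t - t0)" by (simp only: mult_ac)
      also have "\<dots> \<le> \<epsilon>" using elim(1) by simp
      finally show "(\<Sum>l\<in>L. cmod (c l) * (real (weight j) / real (weight l)) ^ t) \<le> \<epsilon>"
        by (simp add: w_def)
    qed
  qed
qed

lemma coeffs_bound:
  assumes "expands a r f"
  shows "\<forall>\<^sub>F t in sequentially. \<exists>B\<ge>0. \<forall>m. cmod (a m) \<le> B * real (weight m) ^ t"
  using coeffs_growth[OF assms]
proof eventually_elim
  case (elim t)
  let ?B = "\<Sum>\<^sub>\<infinity>m. cmod (a m) / real (weight m) ^ t"
  have "cmod (a m) \<le> ?B * real (weight m) ^ t" for m
  proof -
    have "(\<Sum>k\<in>{m}. cmod (a k) / real (weight k) ^ t) \<le> ?B"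
      by (intro finite_sum_le_infsum elim) auto
    then show ?thesis using weight_pos[of m] by (simp add: field_simps)
  qed
  moreover have "?B \<ge> 0" by (intro infsum_nonneg) auto
  ultimately show ?case by blast
qed

text \<open>The growth estimates for the coefficients of the quotients and of the remainder make them convergent, and
the identity of coefficients becomes an identity of functions on a common polydisc.\<close>
lemma power_series_division:
  fixes f :: "complex ^ 'n::finite \<Rightarrow> complex"
  assumes F: "finite F" and c: "\<And>j. j \<in> F \<Longrightarrow> c j j = 1"
    and c0: "\<And>j l. j \<in> F \<Longrightarrow> weight l < weight j \<Longrightarrow> c j l = 0"
    and h: "\<And>j. j \<in> F \<Longrightarrow> expands (c j) (s j) (h j)"
    and f: "analytic0 f"
  obtains q b \<rho> r where "\<And>j. j \<in> F \<Longrightarrow> analytic0 (q j)" "expands b \<rho> r"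
    "\<And>m j. j \<in> F \<Longrightarrow> j \<le> m \<Longrightarrow> b m = 0"
    "\<forall>\<^sub>F x in nhds 0. f x = (\<Sum>j\<in>F. h j x * q j x) + r x"
proof -
  obtain a r0 where a: "expands a r0 f" using f analytic0_iff_expands by blast
  \<comment> \<open>One exponent \<open>t\<close> must serve the dividend and all divisors; the \<open>+ 1\<close> allows \<open>F = {}\<close>.\<close>
  define \<epsilon> where "\<epsilon> = 1 / (2 * (real (card F) + 1))"
  have \<epsilon>: "\<epsilon> > 0" "real (card F) * \<epsilon> \<le> 1/2" by (auto simp: \<epsilon>_def field_simps)
  have "\<forall>\<^sub>F t in sequentially. \<forall>j\<in>F. \<forall>L. finite L \<and> L \<subseteq> {l. weight j < weight l} \<longrightarrow>
      (\<Sum>l\<in>L. cmod (c j l) * (real (weight j) / real (weight l)) ^ t) \<le> \<epsilon>"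
    using F tail_sum_small[OF h \<epsilon>(1)] by (intro eventually_ball_finite) auto
  from eventually_happens'[OF sequentially_bot eventually_conj[OF coeffs_bound[OF a] this]]
  obtain t where t0: "\<exists>B\<ge>0. \<forall>m. cmod (a m) \<le> B * real (weight m) ^ t"
    "\<forall>j\<in>F. \<forall>L. finite L \<and> L \<subseteq> {l. weight j < weight l} \<longrightarrow>
      (\<Sum>l\<in>L. cmod (c j l) * (real (weight j) / real (weight l)) ^ t) \<le> \<epsilon>"
    by (rule exE) (erule conjE, rule that)
  from t0(1) obtain B where B: "B \<ge> 0" "\<forall>m. cmod (a m) \<le> B * real (weight m) ^ t"
    by (rule exE) (erule conjE, rule that)
  let ?g = "division_coeff F c a"
  have g: "cmod (?g m) \<le> 2 * B * real (weight m) ^ t" for m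
    using t0(2) by (intro division_coeff_bound[OF F _ \<epsilon>(2) B(2)[rule_format] B(1)]) simp
  have "\<exists>\<rho>>0. \<forall>(a :: ('n \<Rightarrow> nat) \<Rightarrow> complex) B.
      (\<forall>m. cmod (a m) \<le> B * real (weight m) ^ t) \<longrightarrow> (\<exists>f. expands a \<rho> f)"
    by (rule expands_of_growth)
  then obtain \<rho> where \<rho>: "\<rho> > 0" "\<forall>(a :: ('n \<Rightarrow> nat) \<Rightarrow> complex) B.
      (\<forall>m. cmod (a m) \<le> B * real (weight m) ^ t) \<longrightarrow> (\<exists>f. expands a \<rho> f)"
    by (rule exE) (erule conjE, rule that)
  have "\<exists>q. expands (quotient_coeff F c a j) \<rho> q" for j
  proof (rule \<rho>(2)[rule_format])
    fix k
    have "cmod (quotient_coeff F c a j k) \<le> 2 * B * real (weight (\<lambda>i. k i + j i)) ^ t"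
      using g[of "\<lambda>i. k i + j i"] B(1) by (simp add: quotient_coeff_def)
    also have "\<dots> = (2 * B * real (weight j) ^ t) * real (weight k) ^ t"
      unfolding weight_add of_nat_mult power_mult_distrib by (simp only: mult_ac)
    finally show "cmod (quotient_coeff F c a j k) \<le> (2 * B * real (weight j) ^ t) * real (weight k) ^ t" .
  qed
  then obtain q where q: "\<And>j. expands (quotient_coeff F c a j) \<rho> (q j)" by metis
  have "\<exists>r. expands (remainder_coeff F c a) \<rho> r"
    using g B(1) by (intro \<rho>(2)[rule_format, of _ "2 * B"]) (simp add: remainder_coeff_def)
  then obtain r where r: "expands (remainder_coeff F c a) \<rho> r" by blast
  define \<sigma> where "\<sigma> = Min (insert \<rho> (s ` F))"
  have \<sigma>: "\<sigma> > 0" "\<sigma> \<le> \<rho>" "\<And>j. j \<in> F \<Longrightarrow> \<sigma> \<le> s j"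
    using F \<rho>(1) h by (auto simp: \<sigma>_def expands_def)
  have "expands (\<lambda>m. (\<Sum>j\<in>F. convolve (c j) (quotient_coeff F c a j) m) + remainder_coeff F c a m) \<sigma>
      (\<lambda>x. (\<Sum>j\<in>F. h j x * q j x) + r x)"
    using F \<sigma>
    by (intro expands_add expands_sum expands_mult expands_shrink[OF h] expands_shrink[OF q] expands_shrink[OF r]) auto
  moreover have "(\<lambda>m. (\<Sum>j\<in>F. convolve (c j) (quotient_coeff F c a j) m) + remainder_coeff F c a m) = a"
    by (intro ext, rule sym, rule division_coeff_identity) (use F c c0 in auto)
  ultimately have "expands a \<sigma> (\<lambda>x. (\<Sum>j\<in>F. h j x * q j x) + r x)" by simp
  then have "\<forall>\<^sub>F x in nhds 0. f x = (\<Sum>j\<in>F. h j x * q j x) + r x"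
    by (rule expands_unique[OF a])
  moreover have "analytic0 (q j)" for j using q analytic0_iff_expands by blast
  moreover have "remainder_coeff F c a m = 0" if "j \<in> F" "j \<le> m" for m j
    using that by (auto simp: remainder_coeff_def)
  ultimately show ?thesis using r that by blast
qed

section \<open>Finite generation of ideals\<close>

lemma abs_germ_add:
  "analytic0 f \<Longrightarrow> analytic0 g \<Longrightarrow> abs_germ (\<lambda>x. f x + g x) = abs_germ f + abs_germ g"
  by (simp add: plus_germ.abs_eq germ_rel_def)

lemma abs_germ_mult:
  "analytic0 f \<Longrightarrow> analytic0 g \<Longrightarrow> abs_germ (\<lambda>x. f x * g x) = abs_germ f * abs_germ g"
  by (simp add: times_germ.abs_eq germ_rel_def)

lemma abs_germ_sum:
  assumes "finite F" "\<And>j. j \<in> F \<Longrightarrow> analytic0 (g j)"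
  shows "analytic0 (\<lambda>x. \<Sum>j\<in>F. g j x) \<and> abs_germ (\<lambda>x. \<Sum>j\<in>F. g j x) = (\<Sum>j\<in>F. abs_germ (g j))"
  using assms
proof (induction F rule: finite_induct)
  case empty
  then show ?case using analytic0_const[of 0] by (simp add: zero_germ.abs_eq)
next
  case (insert j F)
  then have "analytic0 (g j)" "analytic0 (\<lambda>x. \<Sum>j\<in>F. g j x)"
    "abs_germ (\<lambda>x. \<Sum>j\<in>F. g j x) = (\<Sum>j\<in>F. abs_germ (g j))" by auto
  then show ?case
    using insert.hyps abs_germ_add[of "g j" "\<lambda>x. \<Sum>j\<in>F. g j x"]
      analytic0_add[of "g j" "\<lambda>x. \<Sum>j\<in>F. g j x"] by simp
qed

definition leading_exponents :: "'n::finite germ set \<Rightarrow> ('n \<Rightarrow> nat) set" where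
  "leading_exponents I = {m. \<exists>c s h. expands c s h \<and> abs_germ h \<in> I \<and> c m = 1 \<and>
     (\<forall>l. weight l < weight m \<longrightarrow> c l = 0)}"

text \<open>The exponent of least weight with nonzero coefficient is a leading exponent after rescaling.\<close>
lemma leading_exponent_of_nonzero:
  fixes r :: "complex ^ 'n::finite \<Rightarrow> complex"
  assumes I: "is_ideal I" and r: "expands b \<rho> r" "abs_germ r \<in> I" "abs_germ r \<noteq> 0"
  obtains m where "m \<in> leading_exponents I" "b m \<noteq> 0"
proof -
  have an: "analytic0 r" using r analytic0_iff_expands by blast
  have "\<exists>m. b m \<noteq> 0"
  proof (rule ccontr)
    assume "\<not> ?thesis"
    then have b: "b = (\<lambda>_. 0)" by auto
    have "\<rho> > 0" using r(1) unfolding expands_def by (rule conjunct1)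
    then have "\<forall>\<^sub>F x in nhds 0. r x = 0"
      using expands_unique[OF r(1)[unfolded b] expands_zero] by blast
    then have "abs_germ r = abs_germ (\<lambda>_. 0)"
      using abs_germ_eq_iff[OF an analytic0_const[of 0]] by blast
    then show False using r(3) by (simp add: zero_germ.abs_eq)
  qed
  then obtain m where m: "b m \<noteq> 0" "\<And>l. b l \<noteq> 0 \<Longrightarrow> weight m \<le> weight l"
    using ex_has_least_nat[of "\<lambda>m. b m \<noteq> 0" _ weight] by blast
  have "expands (\<lambda>l. (1 / b m) * b l) \<rho> (\<lambda>x. (1 / b m) * r x)"
    by (rule expands_cmult[OF r(1)])
  moreover have "abs_germ (\<lambda>x. (1 / b m) * r x) \<in> I"
    unfolding abs_germ_mult[OF analytic0_const an]
    using I r(2) by (rule self_module.subspace_scale)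
  moreover have "\<forall>l. weight l < weight m \<longrightarrow> (1 / b m) * b l = 0"
    using m(2) by (metis mult_zero_right not_less)
  moreover have "(1 / b m) * b m = 1" using m(1) by simp
  ultimately have "m \<in> leading_exponents I"
    unfolding leading_exponents_def by blast
  then show ?thesis using m(1) that by blast
qed

text \<open>By Dickson's lemma finitely many leading exponents lie below all the others. Dividing an element of the ideal
by corresponding elements leaves a remainder in the ideal, none of whose exponents is a leading
exponent of the ideal; so it vanishes.\<close>
lemma ideal_finitely_generated:
  fixes I :: "'n::finite germ set"
  assumes I: "is_ideal I"
  obtains fs where "generates fs I"
proof -
  obtain F where F: "finite F" "F \<subseteq> leading_exponents I"
    "\<And>m. m \<in> leading_exponents I \<Longrightarrow> \<exists>k\<in>F. k \<le> m"
    using dickson_lemma[of "leading_exponents I"] by blast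
  have "\<forall>j\<in>F. \<exists>p. expands (fst p) (fst (snd p)) (snd (snd p)) \<and> abs_germ (snd (snd p)) \<in> I \<and>
     fst p j = 1 \<and> (\<forall>l. weight l < weight j \<longrightarrow> fst p l = 0)"
    using F(2) unfolding leading_exponents_def by force
  from bchoice[OF this] obtain p where p: "\<forall>j\<in>F. expands (fst (p j)) (fst (snd (p j))) (snd (snd (p j))) \<and>
     abs_germ (snd (snd (p j))) \<in> I \<and> fst (p j) j = 1 \<and>
     (\<forall>l. weight l < weight j \<longrightarrow> fst (p j) l = 0)" ..
  define c s h where "c j = fst (p j)" and "s j = fst (snd (p j))" and "h j = snd (snd (p j))" for j
  have h: "expands (c j) (s j) (h j)" "abs_germ (h j) \<in> I" "c j j = 1"
    "\<And>l. weight l < weight j \<Longrightarrow> c j l = 0" if "j \<in> F" for j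
    using p that unfolding c_def s_def h_def by blast+
  have an: "analytic0 (h j)" if "j \<in> F" for j
    using h(1)[OF that] analytic0_iff_expands by blast
  have "I = ideal_gen (abs_germ ` h ` F)"
  proof
    show "ideal_gen (abs_germ ` h ` F) \<subseteq> I"
      using I h(2) by (intro self_module.span_minimal) auto
    show "I \<subseteq> ideal_gen (abs_germ ` h ` F)"
    proof
      fix g assume g: "g \<in> I"
      obtain f where f: "analytic0 f" "abs_germ f = g" using ex_rep_germ by blast
      obtain q b \<rho> r where q: "\<And>j. j \<in> F \<Longrightarrow> analytic0 (q j)" and r: "expands b \<rho> r"
        and b: "\<And>m j. j \<in> F \<Longrightarrow> j \<le> m \<Longrightarrow> b m = 0"
        and eq: "\<forall>\<^sub>F x in nhds 0. f x = (\<Sum>j\<in>F. h j x * q j x) + r x"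
        using power_series_division[OF F(1) h(3) h(4) h(1) f(1)] by blast
      have anr: "analytic0 r" using r analytic0_iff_expands by blast
      have an2: "analytic0 (\<lambda>x. h j x * q j x)" if "j \<in> F" for j
        using an q that by (intro analytic0_mult)
      define G where "G = (\<Sum>j\<in>F. abs_germ (h j) * abs_germ (q j))"
      have sum: "analytic0 (\<lambda>x. \<Sum>j\<in>F. h j x * q j x)" "abs_germ (\<lambda>x. \<Sum>j\<in>F. h j x * q j x) = G"
        unfolding G_def using abs_germ_sum[OF F(1), of "\<lambda>j x. h j x * q j x", OF an2]
          abs_germ_mult[OF an q] by simp_all
      have "abs_germ f = abs_germ (\<lambda>x. (\<Sum>j\<in>F. h j x * q j x) + r x)"
        using eq abs_germ_eq_iff[OF f(1) analytic0_add[OF sum(1) anr]] by blast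
      then have gG: "g = G + abs_germ r"
        using abs_germ_add[OF sum(1) anr] f(2) sum(2) by simp
      have in_span: "G \<in> ideal_gen (abs_germ ` h ` F)"
        unfolding G_def
      proof (rule self_module.span_sum)
        fix j assume "j \<in> F"
        then have "abs_germ (h j) \<in> ideal_gen (abs_germ ` h ` F)"
          by (intro self_module.span_base) auto
        then have "abs_germ (q j) * abs_germ (h j) \<in> ideal_gen (abs_germ ` h ` F)"
          by (rule self_module.span_scale)
        then show "abs_germ (h j) * abs_germ (q j) \<in> ideal_gen (abs_germ ` h ` F)"
          by (simp only: mult.commute)
      qed
      then have "G \<in> I" using \<open>ideal_gen (abs_germ ` h ` F) \<subseteq> I\<close> by blast
      then have rI: "abs_germ r \<in> I"
        using self_module.subspace_diff[OF I g] gG by (metis add_diff_cancel_left')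
      have "abs_germ r = 0"
      proof (rule ccontr)
        assume "abs_germ r \<noteq> 0"
        then obtain m where "m \<in> leading_exponents I" "b m \<noteq> 0"
          using leading_exponent_of_nonzero[OF I r rI] by blast
        then show False using F(3) b by blast
      qed
      then show "g \<in> ideal_gen (abs_germ ` h ` F)" using gG in_span by simp
    qed
  qed
  moreover obtain fs where fs: "set fs = h ` F"
    using finite_list[of "h ` F"] F(1) by auto
  moreover have "\<forall>f\<in>set fs. analytic0 f" unfolding fs using an by blast
  ultimately have "generates fs I" unfolding generates_def by simp
  then show ?thesis using that by blast
qed

lemma monom_fun_zero: "monom_fun m 0 = (if m = (\<lambda>_. 0) then 1 else 0)"
proof (cases "m = (\<lambda>_. 0)")
  case False
  then obtain i where "m i \<noteq> 0" by auto
  then show ?thesis using False unfolding monom_fun_def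
    by (auto intro!: prod_zero bexI[of _ i])
qed (simp add: monom_fun_def)

lemma expands_at_zero:
  assumes "expands a r f"
  shows "f 0 = a (\<lambda>_. 0)"
proof -
  have "((\<lambda>m. a m * monom_fun m 0) has_sum f 0) UNIV"
    using assms unfolding expands_def by simp
  moreover have "((\<lambda>m. a m * monom_fun m 0) has_sum a (\<lambda>_. 0)) UNIV"
    by (rule has_sum_finite_neutralI[where B = "{\<lambda>_. 0}"]) (auto simp: monom_fun_zero)
  ultimately show ?thesis by (rule has_sum_unique)
qed

text \<open>A germ that does not vanish at \<open>0\<close> has leading exponent \<open>0\<close>, which divides every exponent. So division by it
leaves no remainder, and in particular it divides \<open>1\<close>.\<close>
lemma ideal_containing_unit:
  fixes f :: "complex ^ 'n::finite \<Rightarrow> complex"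
  assumes I: "is_ideal I" and f: "analytic0 f" "abs_germ f \<in> I" and f0: "f 0 \<noteq> 0"
  shows "I = UNIV"
proof -
  obtain a s where a: "expands a s f" using f(1) analytic0_iff_expands by blast
  let ?z = "\<lambda>_::'n. 0::nat"
  have h: "expands (\<lambda>m. (1 / f 0) * a m) s (\<lambda>x. (1 / f 0) * f x)"
    by (rule expands_cmult[OF a])
  obtain q b \<rho> r where q: "\<And>j. j \<in> {?z} \<Longrightarrow> analytic0 (q j)" and r: "expands b \<rho> r"
    and b: "\<And>m j. j \<in> {?z} \<Longrightarrow> j \<le> m \<Longrightarrow> b m = 0"
    and eq: "\<forall>\<^sub>F x in nhds 0. 1 = (\<Sum>j\<in>{?z}. ((1 / f 0) * f x) * q j x) + r x"
  proof (rule power_series_division[of "{?z}" "\<lambda>_ m. (1 / f 0) * a m" "\<lambda>_. s" "\<lambda>_ x. (1 / f 0) * f x" "\<lambda>_. 1"])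
    show "(1 / f 0) * a j = 1" if "j \<in> {?z}" for j
      using that f0 expands_at_zero[OF a] by simp
    show "(1 / f 0) * a l = 0" if "j \<in> {?z}" "weight l < weight j" for j l
    proof -
      have "weight j = 1" using that(1) by (simp add: weight_def)
      then show ?thesis using that(2) weight_pos[of l] by simp
    qed
  qed (use h analytic0_const in auto)
  have b0: "b = (\<lambda>_. 0)" using b by (auto simp: le_fun_def)
  have "\<rho> > 0" using r unfolding expands_def by (rule conjunct1)
  then have "\<forall>\<^sub>F x in nhds 0. r x = 0"
    using expands_unique[OF r[unfolded b0] expands_zero] by blast
  with eq have ev: "\<forall>\<^sub>F x in nhds 0. 1 = ((1 / f 0) * f x) * q ?z x"
    by eventually_elim simp
  have an: "analytic0 (\<lambda>x. (1 / f 0) * f x)" "analytic0 (q ?z)"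
    by (rule analytic0_mult[OF analytic0_const f(1)], rule q, simp)
  have "abs_germ (\<lambda>_. 1) = abs_germ (\<lambda>x. ((1 / f 0) * f x) * q ?z x)"
    using ev abs_germ_eq_iff[OF analytic0_const analytic0_mult[OF an]] by blast
  then have "1 = (abs_germ (\<lambda>_. 1 / f 0) * abs_germ f) * abs_germ (q ?z)"
    unfolding abs_germ_mult[OF an] abs_germ_mult[OF analytic0_const f(1)] by (simp add: one_germ.abs_eq)
  then have "1 = (abs_germ (\<lambda>_. 1 / f 0) * abs_germ (q ?z)) * abs_germ f" by (simp only: mult_ac)
  then have one: "1 \<in> I" using self_module.subspace_scale[OF I f(2)] by metis
  have "x \<in> I" for x using self_module.subspace_scale[OF I one, of x] by simp
  then show ?thesis by blast
qed

section \<open>Real functions with a derivative bounded below\<close>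

text \<open>The \<open>k\<close>-th member is the \<open>k\<close>-th derivative of \<open>u 0\<close>. Giving all derivatives as data makes the step from
\<open>u\<close> to its derivative a shift of the index.\<close>
definition derivative_chain :: "(nat \<Rightarrow> real \<Rightarrow> real) \<Rightarrow> real set \<Rightarrow> bool" where
  "derivative_chain u S \<longleftrightarrow> (\<forall>k. \<forall>t\<in>S. (u k has_real_derivative u (Suc k) t) (at t))"

lemma derivative_chain_Suc: "derivative_chain u S \<Longrightarrow> derivative_chain (\<lambda>k. u (Suc k)) S"
  by (simp add: derivative_chain_def)

lemma derivative_chain_subset: "derivative_chain u S \<Longrightarrow> T \<subseteq> S \<Longrightarrow> derivative_chain u T"
  by (auto simp: derivative_chain_def)

lemma derivative_chain_continuous: "derivative_chain u S \<Longrightarrow> continuous_on S (u k)"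
  unfolding derivative_chain_def
  by (intro continuous_at_imp_continuous_on) (blast intro: DERIV_isCont)

lemma nonvanishing_same_sign:
  fixes f :: "real \<Rightarrow> real"
  assumes "continuous_on {a<..<b} f" "\<And>t. t \<in> {a<..<b} \<Longrightarrow> f t \<noteq> 0"
  shows "(\<forall>t\<in>{a<..<b}. f t > 0) \<or> (\<forall>t\<in>{a<..<b}. f t < 0)"
proof (rule ccontr)
  assume "\<not> ?thesis"
  then obtain s t where st: "s \<in> {a<..<b}" "t \<in> {a<..<b}" "f s \<le> 0" "f t \<ge> 0"
    by (auto simp: not_less)
  have "connected (f ` {a<..<b})"
    using assms(1) by (intro connected_continuous_image) auto
  then have "0 \<in> f ` {a<..<b}"
    using st by (intro connectedD_interval[of "f ` {a<..<b}" "f s" "f t" 0]) auto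
  with assms(2) show False by auto
qed

text \<open>By induction the derivative \<open>u 1\<close> is bounded below near \<open>t\<close> in absolute value. Neither \<open>u 0\<close> nor \<open>u 1\<close> changes its sign
on the interval, so in one of the two directions \<open>\<bar>u 0\<bar>\<close> decreases at this rate without reaching \<open>0\<close>; it
must have been large at \<open>t\<close>.\<close>
lemma lower_bound_away_from_zeros:
  "\<exists>\<kappa>>0. \<forall>u t \<rho>. \<rho> > 0 \<longrightarrow> derivative_chain u {t-\<rho><..<t+\<rho>} \<longrightarrow>
     (\<forall>k<d. \<forall>s\<in>{t-\<rho><..<t+\<rho>}. u k s \<noteq> 0) \<longrightarrow> (\<forall>s\<in>{t-\<rho><..<t+\<rho>}. u d s \<ge> 1/2) \<longrightarrow>
     \<kappa> * \<rho> ^ d \<le> \<bar>u 0 t\<bar>"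
proof (induction d)
  case 0
  have "1/2 * \<rho> ^ 0 \<le> \<bar>u 0 t\<bar>" if "\<rho> > 0" "\<forall>s\<in>{t-\<rho><..<t+\<rho>}. u 0 s \<ge> 1/2"
    for u :: "nat \<Rightarrow> real \<Rightarrow> real" and t \<rho>
  proof -
    have "u 0 t \<ge> 1/2" using that by auto
    then show ?thesis by simp
  qed
  then show ?case by (intro exI[of _ "1/2"]) auto
next
  case (Suc d)
  then obtain \<kappa> where \<kappa>: "\<kappa> > 0" "\<And>u t \<rho>. \<rho> > 0 \<Longrightarrow> derivative_chain u {t-\<rho><..<t+\<rho>} \<Longrightarrow>
     (\<forall>k<d. \<forall>s\<in>{t-\<rho><..<t+\<rho>}. u k s \<noteq> 0) \<Longrightarrow> (\<forall>s\<in>{t-\<rho><..<t+\<rho>}. u d s \<ge> 1/2) \<Longrightarrow>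
     \<kappa> * \<rho> ^ d \<le> \<bar>u 0 t\<bar>"
    by blast
  \<comment> \<open>The bound for \<open>u 1\<close> is used within \<open>\<rho> / 4\<close> of \<open>t\<close>, with radius \<open>\<rho> / 2\<close>.\<close>
  define \<kappa>' where "\<kappa>' = \<kappa> / (4 * 2 ^ d)"
  have "\<kappa>' * \<rho> ^ Suc d \<le> \<bar>u 0 t\<bar>"
    if \<rho>: "\<rho> > 0" and ch: "derivative_chain u {t-\<rho><..<t+\<rho>}"
      and nz: "\<forall>k<Suc d. \<forall>s\<in>{t-\<rho><..<t+\<rho>}. u k s \<noteq> 0"
      and ge: "\<forall>s\<in>{t-\<rho><..<t+\<rho>}. u (Suc d) s \<ge> 1/2"
    for u :: "nat \<Rightarrow> real \<Rightarrow> real" and t \<rho>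
  proof -
    let ?I = "{t-\<rho><..<t+\<rho>}"
    have low: "\<kappa> * (\<rho> / 2) ^ d \<le> \<bar>u 1 s\<bar>" if s: "s \<in> {t - \<rho>/2..t + \<rho>/2}" for s
    proof -
      have sub: "{s-\<rho>/2<..<s+\<rho>/2} \<subseteq> ?I" using s by auto
      have "\<kappa> * (\<rho> / 2) ^ d \<le> \<bar>(\<lambda>k. u (Suc k)) 0 s\<bar>"
      proof (rule \<kappa>(2)[where u = "\<lambda>k. u (Suc k)"])
        show "derivative_chain (\<lambda>k. u (Suc k)) {s-\<rho>/2<..<s+\<rho>/2}"
          using derivative_chain_subset[OF derivative_chain_Suc[OF ch] sub] .
      qed (use \<rho> nz ge sub in auto)
      then show ?thesis by simp
    qed
    have d0: "(u 0 has_real_derivative u 1 s) (at s)" if "s \<in> ?I" for s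
      using ch that by (auto simp: derivative_chain_def)
    have nz1: "u 1 s \<noteq> 0" if "s \<in> ?I" for s
    proof (cases "d = 0")
      case True
      then have "u 1 s \<ge> 1/2" using ge that by auto
      then show ?thesis by simp
    next
      case False
      then show ?thesis using nz that by auto
    qed
    have sg0: "(\<forall>s\<in>?I. u 0 s > 0) \<or> (\<forall>s\<in>?I. u 0 s < 0)"
      using nz by (intro nonvanishing_same_sign derivative_chain_continuous[OF ch]) auto
    have sg1: "(\<forall>s\<in>?I. u 1 s > 0) \<or> (\<forall>s\<in>?I. u 1 s < 0)"
      using nz1 by (intro nonvanishing_same_sign derivative_chain_continuous[OF ch]) auto
    have "\<exists>z. t < z \<and> z < t + \<rho>/4 \<and> u 0 (t + \<rho>/4) - u 0 t = (t + \<rho>/4 - t) * u 1 z"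
      using \<rho> by (intro MVT2 d0) auto
    then obtain z where z: "t < z" "z < t + \<rho>/4" "u 0 (t + \<rho>/4) - u 0 t = \<rho>/4 * u 1 z" by auto
    have "\<exists>z. t - \<rho>/4 < z \<and> z < t \<and> u 0 t - u 0 (t - \<rho>/4) = (t - (t - \<rho>/4)) * u 1 z"
      using \<rho> by (intro MVT2 d0) auto
    then obtain y where y: "t - \<rho>/4 < y" "y < t" "u 0 t - u 0 (t - \<rho>/4) = \<rho>/4 * u 1 y" by auto
    have b: "\<kappa> * (\<rho> / 2) ^ d \<le> \<bar>u 1 z\<bar>" "\<kappa> * (\<rho> / 2) ^ d \<le> \<bar>u 1 y\<bar>"
      using low[of z] low[of y] z(1,2) y(1,2) \<rho> by auto
    have pts: "t + \<rho>/4 \<in> ?I" "t - \<rho>/4 \<in> ?I" "t \<in> ?I" "z \<in> ?I" "y \<in> ?I"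
      using z y \<rho> by auto
    have "\<rho>/4 * (\<kappa> * (\<rho> / 2) ^ d) \<le> \<bar>u 0 t\<bar>"
    proof -
      have "\<rho>/4 * (\<kappa> * (\<rho> / 2) ^ d) \<le> \<rho>/4 * \<bar>u 1 z\<bar>" "\<rho>/4 * (\<kappa> * (\<rho> / 2) ^ d) \<le> \<rho>/4 * \<bar>u 1 y\<bar>"
        using \<rho> b by (auto intro!: mult_left_mono)
      then have "\<rho>/4 * (\<kappa> * (\<rho> / 2) ^ d) \<le> \<bar>u 0 (t + \<rho>/4) - u 0 t\<bar>"
        "\<rho>/4 * (\<kappa> * (\<rho> / 2) ^ d) \<le> \<bar>u 0 t - u 0 (t - \<rho>/4)\<bar>"
        unfolding z(3) y(3) using \<rho> by (auto simp: abs_mult)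
      moreover have "u 0 (t + \<rho>/4) - u 0 t > 0 \<and> u 0 t - u 0 (t - \<rho>/4) > 0 \<or>
          u 0 (t + \<rho>/4) - u 0 t < 0 \<and> u 0 t - u 0 (t - \<rho>/4) < 0"
        unfolding z(3) y(3) using sg1 pts(4,5) \<rho> by (auto simp: mult_pos_neg)
      moreover have "u 0 (t + \<rho>/4) > 0 \<and> u 0 t > 0 \<and> u 0 (t - \<rho>/4) > 0 \<or>
          u 0 (t + \<rho>/4) < 0 \<and> u 0 t < 0 \<and> u 0 (t - \<rho>/4) < 0"
        using sg0 pts by blast
      ultimately show ?thesis by linarith
    qed
    also have "\<rho>/4 * (\<kappa> * (\<rho> / 2) ^ d) = \<kappa>' * \<rho> ^ Suc d"
      by (simp add: \<kappa>'_def power_divide)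
    finally show ?thesis .
  qed
  moreover have "\<kappa>' > 0" using \<kappa>(1) by (simp add: \<kappa>'_def)
  ultimately show ?case by blast
qed

text \<open>Between two points of a set that contains all zeros of \<open>u 1\<close> there is at most one zero of \<open>u 0\<close>, by Rolle's theorem.
So each derivative at most doubles the number of points, and the number depends on \<open>d\<close> only. The end points
are included so that a neighbourhood without points of the set lies in the interval.\<close>
lemma finite_zeros_of_derivatives:
  "\<exists>N::nat. \<forall>u a b. a < b \<longrightarrow> derivative_chain u {a..b} \<longrightarrow> (\<forall>s\<in>{a..b}. u d s \<ge> 1/2) \<longrightarrow>
     (\<exists>A. finite A \<and> card A \<le> N \<and> a \<in> A \<and> b \<in> A \<and> (\<forall>k<d. \<forall>s\<in>{a..b}. u k s = 0 \<longrightarrow> s \<in> A))"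
proof (induction d)
  case 0
  have "\<exists>A. finite A \<and> card A \<le> 2 \<and> a \<in> A \<and> b \<in> A" for a b :: real
    by (intro exI[of _ "{a, b}"]) (auto simp: card_insert_if)
  then show ?case by (intro exI[of _ 2]) auto
next
  case (Suc d)
  then obtain N :: nat where N: "\<And>u a b. a < b \<Longrightarrow> derivative_chain u {a..b} \<Longrightarrow> (\<forall>s\<in>{a..b}. u d s \<ge> 1/2) \<Longrightarrow>
     (\<exists>A. finite A \<and> card A \<le> N \<and> a \<in> A \<and> b \<in> A \<and> (\<forall>k<d. \<forall>s\<in>{a..b}. u k s = 0 \<longrightarrow> s \<in> A))"
    by blast
  have "\<exists>A. finite A \<and> card A \<le> N + N \<and> a \<in> A \<and> b \<in> A \<and> (\<forall>k<Suc d. \<forall>s\<in>{a..b}. u k s = 0 \<longrightarrow> s \<in> A)"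
    if ab: "a < b" and ch: "derivative_chain u {a..b}" and ge: "\<forall>s\<in>{a..b}. u (Suc d) s \<ge> 1/2"
    for u :: "nat \<Rightarrow> real \<Rightarrow> real" and a b
  proof -
    obtain A where A: "finite A" "card A \<le> N" "a \<in> A" "b \<in> A"
      "\<And>k s. k < d \<Longrightarrow> s \<in> {a..b} \<Longrightarrow> u (Suc k) s = 0 \<Longrightarrow> s \<in> A"
      using N[OF ab derivative_chain_Suc[OF ch]] ge by blast
    have A1: "s \<in> A" if "s \<in> {a..b}" "u 1 s = 0" for s
    proof (cases "d = 0")
      case True
      then have "u 1 s \<ge> 1/2" using ge that(1) by auto
      then show ?thesis using that(2) by simp
    next
      case False
      then show ?thesis using A(5)[of 0 s] that by auto
    qed
    define Z where "Z = {s\<in>{a..b}. u 0 s = 0}"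
    \<comment> \<open>By Rolle's theorem a zero of \<open>u 0\<close> is determined by the last point of \<open>A\<close> before it.\<close>
    define p where "p z = Max {x\<in>A. x \<le> z}" for z
    have p: "p z \<in> A" "p z \<le> z" "\<And>x. x \<in> A \<Longrightarrow> x \<le> z \<Longrightarrow> x \<le> p z" if "z \<in> Z" for z
    proof -
      have "a \<in> {x\<in>A. x \<le> z}" using A that by (auto simp: Z_def)
      moreover have fin: "finite {x\<in>A. x \<le> z}" using A by auto
      ultimately have "p z \<in> {x\<in>A. x \<le> z}" unfolding p_def by (intro Max_in) auto
      then show "p z \<in> A" "p z \<le> z" by auto
      show "x \<le> p z" if "x \<in> A" "x \<le> z" for x
        unfolding p_def using that fin by (intro Max_ge) auto
    qed
    have less: "p y \<noteq> p z" if yz: "y \<in> Z" "z \<in> Z" "y < z" for y z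
    proof
      assume eq: "p y = p z"
      have "\<exists>x. y < x \<and> x < z \<and> u 0 z - u 0 y = (z - y) * u 1 x"
        using yz ch by (intro MVT2) (auto simp: derivative_chain_def Z_def)
      then obtain x where x: "y < x" "x < z" "u 1 x = 0" using yz by (auto simp: Z_def)
      then have "x \<in> A" using yz by (intro A1) (auto simp: Z_def)
      then have "x \<le> p z" using p(3)[OF yz(2)] x by auto
      then show False using p(2)[OF yz(1)] eq x by auto
    qed
    have inj: "inj_on p Z"
    proof (rule inj_onI)
      fix y z assume "y \<in> Z" "z \<in> Z" "p y = p z"
      then show "y = z" using less[of y z] less[of z y] by (cases y z rule: linorder_cases) auto
    qed
    have im: "p ` Z \<subseteq> A" using p by auto
    have "finite Z" using inj im A(1) by (metis finite_imageD finite_subset)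
    moreover have "card Z \<le> N" using card_inj_on_le[OF inj im A(1)] A(2) by simp
    ultimately show ?thesis
      using A by (intro exI[of _ "A \<union> Z"]) 
        (auto simp: Z_def less_Suc_eq_0_disj intro: order_trans[OF card_Un_le])
  qed
  then show ?case by blast
qed

text \<open>The points are the zeros of the derivatives of order less than \<open>d\<close> and the end points. The distance from \<open>t\<close> to the
nearest one is a radius for which the preceding lower bound applies. The exponent is \<open>Suc d\<close> and not \<open>d\<close> in
order that the left-hand side is \<open>0\<close> at \<open>t = p\<close> also for \<open>d = 0\<close>.\<close>
lemma lower_bound_by_distance:
  "\<exists>(N::nat) \<kappa>. \<kappa> > 0 \<and> (\<forall>u a b. a < b \<longrightarrow> b \<le> a + 1 \<longrightarrow> derivative_chain u {a..b} \<longrightarrow>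
      (\<forall>s\<in>{a..b}. u d s \<ge> 1/2) \<longrightarrow>
      (\<exists>A. finite A \<and> card A \<le> N \<and> (\<forall>t\<in>{a..b}. \<exists>p\<in>A. \<kappa> * \<bar>t - p\<bar> ^ Suc d \<le> \<bar>u 0 t\<bar>)))"
proof -
  obtain N :: nat where N: "\<And>u a b. a < b \<Longrightarrow> derivative_chain u {a..b} \<Longrightarrow> (\<forall>s\<in>{a..b}. u d s \<ge> 1/2) \<Longrightarrow>
     (\<exists>A. finite A \<and> card A \<le> N \<and> a \<in> A \<and> b \<in> A \<and> (\<forall>k<d. \<forall>s\<in>{a..b}. u k s = 0 \<longrightarrow> s \<in> A))"
    using finite_zeros_of_derivatives[of d] by blast
  obtain \<kappa> where \<kappa>: "\<kappa> > 0" "\<And>u t \<rho>. \<rho> > 0 \<Longrightarrow> derivative_chain u {t-\<rho><..<t+\<rho>} \<Longrightarrow>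
     (\<forall>k<d. \<forall>s\<in>{t-\<rho><..<t+\<rho>}. u k s \<noteq> 0) \<Longrightarrow> (\<forall>s\<in>{t-\<rho><..<t+\<rho>}. u d s \<ge> 1/2) \<Longrightarrow>
     \<kappa> * \<rho> ^ d \<le> \<bar>u 0 t\<bar>"
    using lower_bound_away_from_zeros[of d] by blast
  have "\<exists>A. finite A \<and> card A \<le> N \<and> (\<forall>t\<in>{a..b}. \<exists>p\<in>A. \<kappa> * \<bar>t - p\<bar> ^ Suc d \<le> \<bar>u 0 t\<bar>)"
    if ab: "a < b" "b \<le> a + 1" and ch: "derivative_chain u {a..b}" and ge: "\<forall>s\<in>{a..b}. u d s \<ge> 1/2"
    for u :: "nat \<Rightarrow> real \<Rightarrow> real" and a b
  proof -
    obtain A where A: "finite A" "card A \<le> N" "a \<in> A" "b \<in> A"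
      "\<And>k s. k < d \<Longrightarrow> s \<in> {a..b} \<Longrightarrow> u k s = 0 \<Longrightarrow> s \<in> A"
      using N[OF ab(1) ch ge] by blast
    have "\<exists>p\<in>A. \<kappa> * \<bar>t - p\<bar> ^ Suc d \<le> \<bar>u 0 t\<bar>" if t: "t \<in> {a..b}" for t
    proof -
      obtain p where p: "p \<in> A" "\<And>q. q \<in> A \<Longrightarrow> \<bar>t - p\<bar> \<le> \<bar>t - q\<bar>"
        using ex_min_if_finite[of "(\<lambda>q. \<bar>t - q\<bar>) ` A"] A
        by (metis (mono_tags, lifting) arg_min_least arg_min_if_finite(1) emptyE)
      define \<rho> where "\<rho> = \<bar>t - p\<bar>"
      have "\<kappa> * \<rho> ^ Suc d \<le> \<bar>u 0 t\<bar>"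
      proof (cases "\<rho> = 0")
        case False
        then have \<rho>: "\<rho> > 0" by (simp add: \<rho>_def)
        have ta: "\<rho> \<le> t - a" "\<rho> \<le> b - t" using p(2)[OF A(3)] p(2)[OF A(4)] t by (auto simp: \<rho>_def)
        then have sub: "{t-\<rho><..<t+\<rho>} \<subseteq> {a..b}" by auto
        have notin: "s \<notin> A" if "s \<in> {t-\<rho><..<t+\<rho>}" for s
        proof
          assume "s \<in> A"
          then have "\<rho> \<le> \<bar>t - s\<bar>" unfolding \<rho>_def by (rule p(2))
          moreover have "\<bar>t - s\<bar> < \<rho>" using that unfolding abs_less_iff by auto
          ultimately show False by simp
        qed
        have "\<kappa> * \<rho> ^ d \<le> \<bar>u 0 t\<bar>"
        proof (rule \<kappa>(2)[where u = u and t = t, OF \<rho>])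
          show "derivative_chain u {t-\<rho><..<t+\<rho>}"
            using derivative_chain_subset[OF ch sub] .
          show "\<forall>k<d. \<forall>s\<in>{t-\<rho><..<t+\<rho>}. u k s \<noteq> 0"
            using A(5) notin sub by blast
          show "\<forall>s\<in>{t-\<rho><..<t+\<rho>}. u d s \<ge> 1/2"
            using ge sub by blast
        qed
        moreover have "\<rho> ^ Suc d \<le> \<rho> ^ d"
          using \<rho> ta ab t by (intro power_decreasing) auto
        then have "\<kappa> * \<rho> ^ Suc d \<le> \<kappa> * \<rho> ^ d"
          using \<kappa>(1) by (intro mult_left_mono) auto
        ultimately show ?thesis by linarith
      qed simp
      then show ?thesis using p(1) by (auto simp: \<rho>_def)
    qed
    then show ?thesis using A by blast
  qed
  then show ?thesis using \<kappa>(1) by blast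
qed

section \<open>Integrals of inverse powers\<close>

lemma nn_integral_inverse_powr_finite:
  assumes "\<beta> < 1"
  shows "(\<integral>\<^sup>+t. inverse (ennreal (\<bar>t\<bar> powr \<beta>)) * indicator {-1..1} t \<partial>lborel) < (\<infinity>::ennreal)"
proof -
  define g where "g t = (if t \<in> {0..1} then t powr -\<beta> else 0)" for t :: real
  have gm [measurable]: "g \<in> borel_measurable borel" unfolding g_def by measurable
  have "((\<lambda>x. x powr -\<beta>) has_integral (1 powr (-\<beta>+1) / (-\<beta>+1))) {0..1}"
    using assms by (intro has_integral_powr_from_0) auto
  then have "(g has_integral (1 powr (-\<beta>+1) / (-\<beta>+1))) UNIV"
    unfolding g_def by (subst has_integral_restrict_UNIV)
  then have g: "(\<integral>\<^sup>+t. ennreal (g t) \<partial>lborel) < \<infinity>"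
    using nn_integral_has_integral_lborel[OF gm] by (simp add: g_def)
  have g': "(\<integral>\<^sup>+t. ennreal (g (-t)) \<partial>lborel) = (\<integral>\<^sup>+t. ennreal (g t) \<partial>lborel)"
    by (subst nn_integral_real_affine[of "\<lambda>t. ennreal (g t)" "-1" 0]) (simp_all)
  have "AE t in lborel. inverse (ennreal (\<bar>t\<bar> powr \<beta>)) * indicator {-1..1} t \<le> ennreal (g t) + ennreal (g (-t))"
    using AE_lborel_singleton[of "0::real"]
  proof eventually_elim
    case (elim t)
    have e: "inverse (ennreal (\<bar>t\<bar> powr \<beta>)) = ennreal (\<bar>t\<bar> powr -\<beta>)"
      using elim by (simp add: inverse_ennreal powr_minus)
    show ?case
    proof (cases "t \<in> {-1..1}")
      case True
      then have "\<bar>t\<bar> powr -\<beta> \<le> g t + g (-t)" by (auto simp: g_def)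
      moreover have "g t \<ge> 0" "g (-t) \<ge> 0" by (auto simp: g_def)
      ultimately show ?thesis using True unfolding e by (simp flip: ennreal_plus)
    qed simp
  qed
  then have "(\<integral>\<^sup>+t. inverse (ennreal (\<bar>t\<bar> powr \<beta>)) * indicator {-1..1} t \<partial>lborel)
      \<le> (\<integral>\<^sup>+t. ennreal (g t) + ennreal (g (-t)) \<partial>lborel)"
    by (rule nn_integral_mono_AE)
  also have "\<dots> = (\<integral>\<^sup>+t. ennreal (g t) \<partial>lborel) + (\<integral>\<^sup>+t. ennreal (g (-t)) \<partial>lborel)"
    by (rule nn_integral_add) measurable
  also have "\<dots> < \<infinity>" using g unfolding g' by simp
  finally show ?thesis .
qed

lemma ennreal_inverse_le_of_le:
  assumes "0 \<le> x" "x \<le> y"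
  shows "inverse (ennreal y) \<le> inverse (ennreal x)"
proof (cases "x = 0")
  case False
  then have "x > 0" "y > 0" using assms by auto
  then show ?thesis using assms(2) by (simp add: inverse_ennreal ennreal_leI)
qed simp

lemma nn_integral_inverse_dist_powr_le:
  assumes \<beta>: "\<beta> \<ge> 0"
  shows "(\<integral>\<^sup>+t. inverse (ennreal (\<bar>t - p\<bar> powr \<beta>)) * indicator {a..b} t \<partial>lborel) \<le>
    emeasure lborel {a..b} + (\<integral>\<^sup>+t. inverse (ennreal (\<bar>t\<bar> powr \<beta>)) * indicator {-1..1} t \<partial>lborel)"
proof -
  let ?h = "\<lambda>t::real. inverse (ennreal (\<bar>t\<bar> powr \<beta>)) * indicator {-1..1} t :: ennreal"
  have "inverse (ennreal (\<bar>t - p\<bar> powr \<beta>)) * indicator {a..b} t \<le> indicator {a..b} t + ?h (-p + 1 * t)" for t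
  proof (cases "\<bar>t - p\<bar> \<le> 1")
    case True
    then have "?h (-p + 1 * t) = inverse (ennreal (\<bar>t - p\<bar> powr \<beta>))" by (auto simp: indicator_def)
    then show ?thesis by (auto simp: indicator_def intro: add_increasing)
  next
    case False
    then have "1 \<le> \<bar>t - p\<bar> powr \<beta>" using \<beta> by (simp add: ge_one_powr_ge_zero)
    then have "inverse (ennreal (\<bar>t - p\<bar> powr \<beta>)) \<le> inverse (ennreal 1)"
      by (intro ennreal_inverse_le_of_le) auto
    then show ?thesis by (auto simp: indicator_def intro: add_increasing2)
  qed
  then have "(\<integral>\<^sup>+t. inverse (ennreal (\<bar>t - p\<bar> powr \<beta>)) * indicator {a..b} t \<partial>lborel) \<le>
      (\<integral>\<^sup>+t. indicator {a..b} t + ?h (-p + 1 * t) \<partial>lborel)"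
    by (rule nn_integral_mono)
  also have "\<dots> = (\<integral>\<^sup>+t. indicator {a..b} t \<partial>lborel) + (\<integral>\<^sup>+t. ?h (-p + 1 * t) \<partial>lborel)"
    by (rule nn_integral_add) measurable
  also have "(\<integral>\<^sup>+t. ?h (-p + 1 * t) \<partial>lborel) = (\<integral>\<^sup>+t. ?h t \<partial>lborel)"
    by (subst nn_integral_real_affine[of ?h 1 "-p"]) simp_all
  also have "(\<integral>\<^sup>+t. indicator {a..b} t \<partial>lborel) = emeasure lborel {a..b}"
    by (rule nn_integral_indicator) simp
  finally show ?thesis .
qed

lemma power_powr_half:
  assumes "x \<ge> 0" "k > 0"
  shows "(x ^ k) powr (1 / (2 * real k)) = x powr (1/2)"
proof (cases "x = 0")
  case False
  then have "x > 0" using assms by simp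
  then have "(x ^ k) powr (1 / (2 * real k)) = x powr (real k * (1 / (2 * real k)))"
    by (simp add: powr_realpow[symmetric] powr_powr)
  then show ?thesis using assms by simp
qed (use assms in simp)

text \<open>With \<open>s = 1 / (2 (d + 1))\<close> the lower bound by distances turns the integrand into a sum of boundedly many terms
\<open>\<bar>t - p\<bar>\<close> to the power \<open>-1/2\<close>. It matters that neither \<open>s\<close> nor the bound depends on \<open>u\<close>.\<close>
lemma inverse_powr_integral_bound:
  "\<exists>s>0. \<exists>M<(\<infinity>::ennreal). \<forall>u a b. a < b \<longrightarrow> b \<le> a + 1 \<longrightarrow> derivative_chain u {a..b} \<longrightarrow>
      (\<forall>t\<in>{a..b}. u d t \<ge> 1/2) \<longrightarrow>
      (\<integral>\<^sup>+t. inverse (ennreal (\<bar>u 0 t\<bar> powr s)) * indicator {a..b} t \<partial>lborel) \<le> M"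
proof -
  obtain N :: nat and \<kappa> where \<kappa>: "\<kappa> > 0" and N: "\<And>u a b. a < b \<Longrightarrow> b \<le> a + 1 \<Longrightarrow>
      derivative_chain u {a..b} \<Longrightarrow> (\<forall>s\<in>{a..b}. u d s \<ge> 1/2) \<Longrightarrow>
      (\<exists>A. finite A \<and> card A \<le> N \<and> (\<forall>t\<in>{a..b}. \<exists>p\<in>A. \<kappa> * \<bar>t - p\<bar> ^ Suc d \<le> \<bar>u 0 t\<bar>))"
    using lower_bound_by_distance[of d] by blast
  define s where "s = 1 / (2 * real (Suc d))"
  have s: "s > 0" by (simp add: s_def)
  define J where "J = (\<integral>\<^sup>+t. inverse (ennreal (\<bar>t\<bar> powr (1/2))) * indicator {-1..1} t \<partial>lborel)"
  have J: "J < (\<infinity>::ennreal)" unfolding J_def by (rule nn_integral_inverse_powr_finite) simp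
  define C where "C = inverse (ennreal (\<kappa> powr s))"
  have C: "C < (\<infinity>::ennreal)" using \<kappa> by (simp add: C_def inverse_ennreal)
  define M where "M = of_nat N * (C * (1 + J))"
  have "M < (\<infinity>::ennreal)" unfolding M_def using J C by (simp add: ennreal_mult_less_top of_nat_less_top)
  moreover have "(\<integral>\<^sup>+t. inverse (ennreal (\<bar>u 0 t\<bar> powr s)) * indicator {a..b} t \<partial>lborel) \<le> M"
    if ab: "a < b" "b \<le> a + 1" and u: "derivative_chain u {a..b}" "\<forall>t\<in>{a..b}. u d t \<ge> 1/2"
    for u :: "nat \<Rightarrow> real \<Rightarrow> real" and a b
  proof -
    obtain A where A: "finite A" "card A \<le> N" "\<forall>t\<in>{a..b}. \<exists>p\<in>A. \<kappa> * \<bar>t - p\<bar> ^ Suc d \<le> \<bar>u 0 t\<bar>"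
      using N[OF ab u] by blast
    let ?h = "\<lambda>p t. inverse (ennreal (\<bar>t - p\<bar> powr (1/2))) * indicator {a..b} t :: ennreal"
    have le: "inverse (ennreal (\<bar>u 0 t\<bar> powr s)) * indicator {a..b} t \<le> (\<Sum>p\<in>A. C * ?h p t)" for t
    proof (cases "t \<in> {a..b}")
      case True
      then obtain p where p: "p \<in> A" "\<kappa> * \<bar>t - p\<bar> ^ Suc d \<le> \<bar>u 0 t\<bar>" using A(3) by blast
      have "(\<kappa> * \<bar>t - p\<bar> ^ Suc d) powr s = \<kappa> powr s * (\<bar>t - p\<bar> ^ Suc d) powr s"
        by (rule powr_mult)
      also have "(\<bar>t - p\<bar> ^ Suc d) powr s = \<bar>t - p\<bar> powr (1/2)"
        unfolding s_def by (rule power_powr_half) auto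
      finally have "\<kappa> powr s * \<bar>t - p\<bar> powr (1/2) = (\<kappa> * \<bar>t - p\<bar> ^ Suc d) powr s" by simp
      also have "\<dots> \<le> \<bar>u 0 t\<bar> powr s"
        using p(2) \<kappa> s by (intro powr_mono2) auto
      finally have "inverse (ennreal (\<bar>u 0 t\<bar> powr s)) \<le> inverse (ennreal (\<kappa> powr s * \<bar>t - p\<bar> powr (1/2)))"
        by (intro ennreal_inverse_le_of_le) auto
      also have "\<dots> = C * inverse (ennreal (\<bar>t - p\<bar> powr (1/2)))"
        unfolding C_def by (subst ennreal_mult) (auto simp: ennreal_inverse_mult)
      finally have "inverse (ennreal (\<bar>u 0 t\<bar> powr s)) * indicator {a..b} t \<le> C * ?h p t"
        using True by simp
      also have "\<dots> \<le> (\<Sum>p\<in>A. C * ?h p t)"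
        using p(1) A(1) by (intro member_le_sum) auto
      finally show ?thesis .
    qed simp
    have "(\<integral>\<^sup>+t. inverse (ennreal (\<bar>u 0 t\<bar> powr s)) * indicator {a..b} t \<partial>lborel)
        \<le> (\<integral>\<^sup>+t. (\<Sum>p\<in>A. C * ?h p t) \<partial>lborel)"
      using le by (rule nn_integral_mono)
    also have "\<dots> = (\<Sum>p\<in>A. \<integral>\<^sup>+t. C * ?h p t \<partial>lborel)"
      by (rule nn_integral_sum) measurable
    also have "\<dots> = (\<Sum>p\<in>A. C * (\<integral>\<^sup>+t. ?h p t \<partial>lborel))"
      by (intro sum.cong refl nn_integral_cmult) measurable
    also have "\<dots> \<le> (\<Sum>p\<in>A. C * (1 + J))"
    proof (rule sum_mono, rule mult_left_mono)
      fix p assume "p \<in> A"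
      have "(\<integral>\<^sup>+t. ?h p t \<partial>lborel) \<le> emeasure lborel {a..b} + J"
        unfolding J_def by (rule nn_integral_inverse_dist_powr_le) simp
      also have "emeasure lborel {a..b} \<le> 1"
        using ab by (simp add: ennreal_le_1)
      finally show "(\<integral>\<^sup>+t. ?h p t \<partial>lborel) \<le> 1 + J" by (simp add: add_right_mono)
    qed simp
    also have "\<dots> = of_nat (card A) * (C * (1 + J))" by simp
    also have "\<dots> \<le> M" unfolding M_def using A(2) by (intro mult_right_mono) auto
    finally show ?thesis .
  qed
  ultimately show ?thesis using s by blast
qed

text \<open>The real basis of the space consists of the vectors \<open>e\<^sub>i\<close> and \<open>\<i> e\<^sub>i\<close>.\<close>
lemma prod_Basis_complex_vec:
  fixes g :: "complex ^ 'n::finite \<Rightarrow> 'a::comm_monoid_mult"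
  shows "(\<Prod>b\<in>Basis. g b) = (\<Prod>i\<in>UNIV. g (axis i 1) * g (axis i \<i>))"
proof -
  have B: "(Basis :: (complex ^ 'n) set) = (\<lambda>(i, u). axis i u) ` (UNIV \<times> {1, \<i>})"
    by (auto simp: Basis_vec_def Basis_complex_def)
  have inj: "inj_on (\<lambda>(i, u). axis i u :: complex ^ 'n) (UNIV \<times> {1, \<i>})"
    by (auto simp: inj_on_def axis_eq_axis)
  have "(\<Prod>b\<in>Basis. g b) = (\<Prod>p\<in>UNIV \<times> {1, \<i>}. g (case p of (i, u) \<Rightarrow> axis i u))"
    unfolding B by (subst prod.reindex[OF inj]) simp
  also have "\<dots> = (\<Prod>i\<in>UNIV. \<Prod>u\<in>{1, \<i>}. g (axis i u))"
    by (subst prod.cartesian_product) (simp add: case_prod_unfold)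
  also have "\<dots> = (\<Prod>i\<in>UNIV. g (axis i 1) * g (axis i \<i>))"
    by (intro prod.cong refl) (simp add: complex_eq_iff)
  finally show ?thesis .
qed

lemma inverse_ennreal_prod:
  assumes "finite A" "\<And>b. b \<in> A \<Longrightarrow> f b \<ge> 0"
  shows "inverse (ennreal (\<Prod>b\<in>A. f b)) = (\<Prod>b\<in>A. inverse (ennreal (f b)))"
  using assms
proof (induction A rule: finite_induct)
  case (insert b A)
  have "inverse (ennreal (f b * (\<Prod>b\<in>A. f b))) = inverse (ennreal (f b)) * inverse (ennreal (\<Prod>b\<in>A. f b))"
    using insert.prems by (subst ennreal_mult) (auto intro!: prod_nonneg simp: ennreal_inverse_mult)
  then show ?case using insert by simp
qed simp

lemma inner_axis_1: "x \<bullet> axis i (1::complex) = Re (x $ i)"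
  by (simp add: inner_axis inner_complex_def)

lemma inner_axis_i: "x \<bullet> axis i \<i> = Im (x $ i)"
  by (simp add: inner_axis inner_complex_def)

text \<open>Since \<open>\<bar>z\<bar>\<^sup>2 \<ge> \<bar>Re z\<bar> \<bar>Im z\<bar>\<close>, the integrand is dominated by a product of functions of the real coordinates
\<open>u\<close>, each being \<open>\<bar>u\<bar>\<close> to the power \<open>-\<beta>\<close>, and the integral of such a product is the product of the integrals.\<close>
lemma coord_prod_integral_finite:
  assumes "0 \<le> \<beta>" "\<beta> < 1"
  shows "(\<integral>\<^sup>+x. inverse (ennreal (cmod (coord_prod x) powr (2 * \<beta>))) *
      indicator {x :: complex ^ 'n::finite. \<forall>i. cmod (x $ i) \<le> 1} x \<partial>lborel) < (\<infinity>::ennreal)"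
proof -
  define h where "h t = (inverse (ennreal (\<bar>t\<bar> powr \<beta>)) * indicator {-1..1} t :: ennreal)" for t :: real
  have hm: "h \<in> borel_measurable borel" unfolding h_def by measurable
  have "inverse (ennreal (cmod (coord_prod x) powr (2 * \<beta>))) * indicator {x. \<forall>i. cmod (x $ i) \<le> 1} x
      \<le> (\<Prod>b\<in>Basis. h (x \<bullet> b))" for x :: "complex ^ 'n"
  proof (cases "\<forall>i. cmod (x $ i) \<le> 1")
    case True
    have b1: "\<bar>x \<bullet> b\<bar> \<le> 1" if "b \<in> Basis" for b
    proof -
      have "(\<bar>Re (x $ i)\<bar> \<le> 1) \<and> (\<bar>Im (x $ i)\<bar> \<le> 1)" for i
        using True order_trans[OF abs_Re_le_cmod, of "x $ i" 1] order_trans[OF abs_Im_le_cmod, of "x $ i" 1] by blast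
      then show ?thesis
        using that by (auto simp: Basis_vec_def Basis_complex_def inner_axis_1 inner_axis_i)
    qed
    have "(\<Prod>b\<in>Basis. h (x \<bullet> b)) = (\<Prod>b\<in>Basis. inverse (ennreal (\<bar>x \<bullet> b\<bar> powr \<beta>)))"
    proof (rule prod.cong[OF refl])
      fix b :: "complex ^ 'n" assume "b \<in> Basis"
      then have "x \<bullet> b \<in> {-1..1}" using b1[of b] by (auto simp: abs_le_iff)
      then show "h (x \<bullet> b) = inverse (ennreal (\<bar>x \<bullet> b\<bar> powr \<beta>))" unfolding h_def by simp
    qed
    also have "\<dots> = inverse (ennreal (\<Prod>b\<in>Basis. \<bar>x \<bullet> b\<bar> powr \<beta>))"
      by (rule inverse_ennreal_prod[symmetric]) auto
    finally have e: "(\<Prod>b\<in>Basis. h (x \<bullet> b)) = inverse (ennreal (\<Prod>b\<in>Basis. \<bar>x \<bullet> b\<bar> powr \<beta>))" .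
    have "(\<Prod>b\<in>Basis. \<bar>x \<bullet> b\<bar> powr \<beta>) = (\<Prod>i\<in>UNIV. \<bar>Re (x $ i)\<bar> powr \<beta> * \<bar>Im (x $ i)\<bar> powr \<beta>)"
      unfolding prod_Basis_complex_vec inner_axis_1 inner_axis_i ..
    also have "\<dots> \<le> (\<Prod>i\<in>UNIV. cmod (x $ i) powr \<beta> * cmod (x $ i) powr \<beta>)"
      using assms by (intro prod_mono conjI mult_mono powr_mono2 abs_Re_le_cmod abs_Im_le_cmod) auto
    also have "\<dots> = (\<Prod>i\<in>UNIV. cmod (x $ i)) powr (2 * \<beta>)"
      by (simp only: prod_powr_distrib mult_2 powr_add prod.distrib)
    also have "(\<Prod>i\<in>UNIV. cmod (x $ i)) = cmod (coord_prod x)"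
      by (simp add: coord_prod_def prod_norm)
    finally have "inverse (ennreal (cmod (coord_prod x) powr (2 * \<beta>))) \<le> (\<Prod>b\<in>Basis. h (x \<bullet> b))"
      unfolding e by (intro ennreal_inverse_le_of_le prod_nonneg) auto
    then show ?thesis using True by simp
  qed simp
  then have "(\<integral>\<^sup>+x. inverse (ennreal (cmod (coord_prod x) powr (2 * \<beta>))) *
      indicator {x :: complex ^ 'n. \<forall>i. cmod (x $ i) \<le> 1} x \<partial>lborel)
      \<le> (\<integral>\<^sup>+x. (\<Prod>b\<in>Basis. h (x \<bullet> b)) \<partial>(lborel :: (complex ^ 'n) measure))"
    by (rule nn_integral_mono)
  also have "\<dots> = (\<Prod>b\<in>(Basis :: (complex ^ 'n) set). \<integral>\<^sup>+t. h t \<partial>lborel)"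
    by (rule nn_integral_lborel_prod) (use hm in auto)
  also have "\<dots> < \<infinity>"
    using nn_integral_inverse_powr_finite[OF assms(2)]
    by (simp add: h_def power_less_top_ennreal)
  finally show ?thesis .
qed

text \<open>A box inside the polydisc is enough, because only a lower bound for the volume matters. The
square with side \<open>\<bar>a\<^sub>i\<bar>\<close> and centre \<open>0\<close> lies in the disc of radius \<open>\<bar>a\<^sub>i\<bar>\<close>.\<close>
lemma polydisc_contains_box:
  fixes a :: "complex ^ 'n::finite"
  shows "\<exists>B. B \<in> sets lborel \<and> B \<subseteq> {x. \<forall>i. cmod (x $ i) \<le> cmod (a $ i)} \<and>
     emeasure lborel B = ennreal (cmod (coord_prod a) ^ 2)"
proof -
  define u :: "complex ^ 'n" where "u = (\<chi> i. Complex (cmod (a $ i) / 2) (cmod (a $ i) / 2))"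
  have sub: "cbox (-u) u \<subseteq> {x. \<forall>i. cmod (x $ i) \<le> cmod (a $ i)}"
  proof (intro subsetI CollectI allI)
    fix x i assume x: "x \<in> cbox (-u) u"
    have "axis i 1 \<in> (Basis :: (complex ^ 'n) set)" "axis i \<i> \<in> (Basis :: (complex ^ 'n) set)"
      by (simp_all add: Basis_complex_def)
    then have "-u \<bullet> axis i 1 \<le> x \<bullet> axis i 1 \<and> x \<bullet> axis i 1 \<le> u \<bullet> axis i 1"
      "-u \<bullet> axis i \<i> \<le> x \<bullet> axis i \<i> \<and> x \<bullet> axis i \<i> \<le> u \<bullet> axis i \<i>"
      using x unfolding mem_box by blast+
    then have "\<bar>Re (x $ i)\<bar> \<le> cmod (a $ i) / 2" "\<bar>Im (x $ i)\<bar> \<le> cmod (a $ i) / 2"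
      unfolding inner_axis_1 inner_axis_i by (auto simp: u_def abs_le_iff)
    then show "cmod (x $ i) \<le> cmod (a $ i)" using cmod_le[of "x $ i"] by linarith
  qed
  have "\<forall>b\<in>Basis. -u \<bullet> b \<le> u \<bullet> b"
    by (auto simp: Basis_vec_def Basis_complex_def inner_axis_1 inner_axis_i u_def)
  then have "emeasure lborel (cbox (-u) u) = ennreal (\<Prod>b\<in>Basis. (u - -u) \<bullet> b)"
    by (subst emeasure_lborel_cbox_eq) simp
  also have "(\<Prod>b\<in>Basis. (u - -u) \<bullet> b) = (\<Prod>i\<in>UNIV. cmod (a $ i) * cmod (a $ i))"
    unfolding prod_Basis_complex_vec inner_axis_1 inner_axis_i by (simp add: u_def)
  also have "\<dots> = cmod (coord_prod a) ^ 2"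
    by (simp add: prod.distrib coord_prod_def prod_norm power2_eq_square flip: prod_norm)
  finally show ?thesis using sub by (intro exI[of _ "cbox (-u) u"]) auto
qed

section \<open>Polydiscs and slices of analytic functions\<close>

definition polydisc :: "real \<Rightarrow> (complex ^ 'n::finite) set" where
  "polydisc r = {x. \<forall>i. cmod (x $ i) \<le> r}"

lemma polydisc_eq_Inter: "polydisc r = (\<Inter>i. {x. cmod (x $ i) \<le> r})"
  by (auto simp: polydisc_def)

lemma closed_polydisc: "closed (polydisc r)"
  unfolding polydisc_eq_Inter by (intro closed_INT ballI closed_Collect_le continuous_intros)

lemma norm_le_sum_cmod: "norm (x :: complex ^ 'n::finite) \<le> (\<Sum>i\<in>UNIV. cmod (x $ i))"
  unfolding norm_vec_def by (rule L2_set_le_sum) simp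

lemma norm_polydisc: "x \<in> polydisc r \<Longrightarrow> norm (x :: complex ^ 'n::finite) \<le> real CARD('n) * r"
  using sum_bounded_above[of "UNIV :: 'n set" "\<lambda>i. cmod (x $ i)" r] norm_le_sum_cmod[of x]
  unfolding polydisc_def by auto

lemma compact_polydisc: "compact (polydisc r :: (complex ^ 'n::finite) set)"
proof -
  have "bounded (polydisc r :: (complex ^ 'n) set)"
    unfolding bounded_iff using norm_polydisc by blast
  then show ?thesis using closed_polydisc compact_eq_bounded_closed by blast
qed

lemma interior_polydisc:
  assumes "r > 0"
  shows "(0 :: complex ^ 'n::finite) \<in> interior (polydisc r)"
proof -
  obtain S :: "(complex ^ 'n) set" where "open S" "0 \<in> S" "\<And>x. x \<in> S \<Longrightarrow> \<forall>i. cmod (x $ i) < r"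
    using eventually_polydisc[OF assms] unfolding eventually_nhds by blast
  moreover have "S \<subseteq> polydisc r"
    using \<open>\<And>x. x \<in> S \<Longrightarrow> \<forall>i. cmod (x $ i) < r\<close> by (auto simp: polydisc_def less_imp_le)
  ultimately show ?thesis by (auto simp: interior_def)
qed

lemma eventually_nhds_polydisc:
  assumes "\<forall>\<^sub>F x in nhds (0 :: complex ^ 'n::finite). P x"
  shows "\<exists>\<rho>>0. \<forall>x\<in>polydisc \<rho>. P x"
proof -
  obtain e where e: "e > 0" "\<And>x. dist x 0 < e \<Longrightarrow> P x"
    using assms unfolding eventually_nhds_metric by blast
  define \<rho> where "\<rho> = e / (2 * CARD('n))"
  have "P x" if "x \<in> polydisc \<rho>" for x
  proof -
    have "norm x \<le> real CARD('n) * \<rho>" using that by (rule norm_polydisc)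
    also have "\<dots> < e" using e(1) by (simp add: \<rho>_def)
    finally show ?thesis using e(2)[of x] by simp
  qed
  moreover have "\<rho> > 0" using e(1) by (simp add: \<rho>_def)
  ultimately show ?thesis by blast
qed

text \<open>The terms are dominated on the closed polydisc by their absolute values at the point \<open>(r', \<dots>, r')\<close>.\<close>
lemma expands_uniform_limit:
  fixes f :: "complex ^ 'n::finite \<Rightarrow> complex"
  assumes f: "expands a r f" and r: "0 \<le> r'" "r' < r"
  shows "uniform_limit (polydisc r') (\<lambda>X x. \<Sum>m\<in>X. a m * monom_fun m x) f (finite_subsets_at_top UNIV)"
proof -
  define y :: "complex ^ 'n" where "y = (\<chi> i. of_real r')"
  have ex: "((\<lambda>m. a m * monom_fun m x) has_sum f x) UNIV" if "\<forall>i. cmod (x $ i) < r" for x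
    using f that unfolding expands_def by blast
  show ?thesis
  proof (rule Weierstrass_m_test_general'[where M = "\<lambda>m. cmod (a m * monom_fun m y)"])
    fix m and x :: "complex ^ 'n" assume x: "x \<in> polydisc r'"
    have "cmod (monom_fun m x) \<le> cmod (monom_fun m y)"
      unfolding monom_fun_def prod_norm[symmetric] norm_power
      using x r by (intro prod_mono conjI power_mono) (auto simp: y_def polydisc_def)
    then show "cmod (a m * monom_fun m x) \<le> cmod (a m * monom_fun m y)"
      unfolding norm_mult by (intro mult_left_mono) auto
  next
    fix x :: "complex ^ 'n" assume "x \<in> polydisc r'"
    then have "\<forall>i. cmod (x $ i) < r" using r by (auto simp: polydisc_def intro: le_less_trans)
    then show "((\<lambda>m. a m * monom_fun m x) has_sum f x) UNIV" by (rule ex)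
  next
    have "((\<lambda>m. a m * monom_fun m y) has_sum f y) UNIV"
      by (rule ex) (use r in \<open>auto simp: y_def\<close>)
    then show "(\<lambda>m. cmod (a m * monom_fun m y)) summable_on UNIV"
      by (rule iffD1[OF summable_on_iff_abs_summable_on_complex has_sum_imp_summable])
  qed
qed

lemma continuous_on_monom_fun: "continuous_on S (monom_fun m)"
  unfolding monom_fun_def by (intro continuous_intros)

lemma expands_continuous_on:
  assumes "expands a r f" "0 \<le> r'" "r' < r"
  shows "continuous_on (polydisc r') f"
  by (rule uniform_limit_theorem[OF _ expands_uniform_limit[OF assms]])
     (auto intro!: always_eventually continuous_intros continuous_on_monom_fun)

lemma expands_slice_holomorphic:
  fixes f :: "complex ^ 'n::finite \<Rightarrow> complex"
  assumes f: "expands a r f" and r: "0 \<le> r'" "r' < r"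
    and sub: "\<And>t. t \<in> cball 0 R \<Longrightarrow> x + t *s v \<in> polydisc r'"
  shows "continuous_on (cball 0 R) (\<lambda>t. f (x + t *s v)) \<and> (\<lambda>t. f (x + t *s v)) holomorphic_on ball 0 R"
proof -
  let ?p = "\<lambda>X t. \<Sum>m\<in>X. a m * monom_fun m (x + t *s v)"
  have hol: "?p X holomorphic_on UNIV" for X
    unfolding monom_fun_def by (simp add: vector_smult_component) (intro holomorphic_intros)
  have "uniform_limit (cball 0 R) ?p (\<lambda>t. f (x + t *s v)) (finite_subsets_at_top UNIV)"
    unfolding uniform_limit_iff
  proof (intro allI impI)
    fix e :: real assume "e > 0"
    then have "\<forall>\<^sub>F X in finite_subsets_at_top UNIV.
        \<forall>x\<in>polydisc r'. dist (\<Sum>m\<in>X. a m * monom_fun m x) (f x) < e"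
      using expands_uniform_limit[OF f r] unfolding uniform_limit_iff by blast
    then show "\<forall>\<^sub>F X in finite_subsets_at_top UNIV. \<forall>t\<in>cball 0 R. dist (?p X t) (f (x + t *s v)) < e"
      by eventually_elim (use sub in blast)
  qed
  then show ?thesis
    by (rule holomorphic_uniform_limit[rotated])
      (auto intro!: always_eventually holomorphic_on_imp_continuous_on intro: holomorphic_on_subset[OF hol])
qed

lemma derivative_chain_Re:
  assumes g: "g holomorphic_on S" "open S" and I: "\<And>t. t \<in> I \<Longrightarrow> complex_of_real t \<in> S"
  shows "derivative_chain (\<lambda>k t. Re ((deriv ^^ k) g (of_real t) / c)) I"
  unfolding derivative_chain_def
proof (intro allI ballI)
  fix k t assume t: "t \<in> I"
  have "(deriv ^^ k) g holomorphic_on S" using g by (rule holomorphic_higher_deriv)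
  then have "((deriv ^^ k) g has_field_derivative deriv ((deriv ^^ k) g) (of_real t)) (at (of_real t))"
    using g(2) I[OF t] by (rule holomorphic_derivI)
  then have "((\<lambda>z. (deriv ^^ k) g z / c) has_field_derivative (deriv ^^ Suc k) g (of_real t) / c) (at (of_real t))"
    by (auto intro: DERIV_cdivide)
  then have "((\<lambda>t. (deriv ^^ k) g (of_real t) / c) has_vector_derivative (deriv ^^ Suc k) g (of_real t) / c) (at t)"
    by (rule has_vector_derivative_real_field)
  then have "((\<lambda>t. Re ((deriv ^^ k) g (of_real t) / c)) has_vector_derivative Re ((deriv ^^ Suc k) g (of_real t) / c)) (at t)"
    by (rule bounded_linear.has_vector_derivative[OF bounded_linear_Re])
  then show "((\<lambda>t. Re ((deriv ^^ k) g (of_real t) / c)) has_real_derivative Re ((deriv ^^ Suc k) g (of_real t) / c)) (at t)"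
    unfolding has_real_derivative_iff_has_vector_derivative .
qed

text \<open>Cauchy's estimate on the disc of radius \<open>1\<close> about \<open>t\<close>.\<close>
lemma higher_deriv_close:
  assumes g: "g holomorphic_on ball 0 2" and h: "h holomorphic_on ball 0 2"
    and close: "\<And>z. z \<in> ball 0 2 \<Longrightarrow> cmod (g z - h z) < E" and t: "cmod t < 1/2"
  shows "cmod ((deriv ^^ d) g t - (deriv ^^ d) h t) \<le> fact d * E"
proof (cases "d = 0")
  case True
  then show ?thesis using close[of t] t by auto
next
  case False
  have sub: "cball t 1 \<subseteq> ball 0 2"
  proof
    fix z assume "z \<in> cball t 1"
    then show "z \<in> ball 0 2" using t norm_triangle_ineq[of "z - t" t] by (auto simp: dist_norm norm_minus_commute)
  qed
  have hol: "(\<lambda>z. g z - h z) holomorphic_on ball 0 2" using g h by (intro holomorphic_intros)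
  have "cmod ((deriv ^^ d) (\<lambda>z. g z - h z) t) \<le> fact d * E / 1 ^ d"
  proof (rule Cauchy_higher_deriv_bound[where y = 0])
    show "(\<lambda>z. g z - h z) holomorphic_on ball t 1"
      using hol sub ball_subset_cball by (blast intro: holomorphic_on_subset)
    show "continuous_on (cball t 1) (\<lambda>z. g z - h z)"
      using holomorphic_on_imp_continuous_on[OF hol] sub by (rule continuous_on_subset)
    show "g w - h w \<in> ball 0 E" if "w \<in> ball t 1" for w
      using close[of w] sub that ball_subset_cball[of t 1] by (auto simp: subset_iff)
  qed (use False in auto)
  moreover have "(deriv ^^ d) (\<lambda>z. g z - h z) t = (deriv ^^ d) g t - (deriv ^^ d) h t"
    by (rule higher_deriv_diff[OF g h]) (use t in auto)
  ultimately show ?thesis by simp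
qed

text \<open>Choose \<open>v\<close> close to \<open>0\<close> with \<open>f v \<noteq> 0\<close>. The function \<open>t \<mapsto> f (t v)\<close> is holomorphic and not identically zero, so
its derivative of some order \<open>d\<close> at \<open>0\<close> is a number \<open>c \<noteq> 0\<close>. By Cauchy's estimate the derivative of order \<open>d\<close> of
\<open>t \<mapsto> f (x + t v)\<close> stays within \<open>\<bar>c\<bar> / 2\<close> of \<open>c\<close> for all small \<open>x\<close> and \<open>t\<close>. After division by \<open>c\<close>
its real part is at least \<open>1/2\<close>, which reduces the problem to functions of a real variable.\<close>
lemma analytic_slices:
  fixes f :: "complex ^ 'n::finite \<Rightarrow> complex"
  assumes f: "analytic0 f" and nz: "\<not> (\<forall>\<^sub>F x in nhds 0. f x = 0)"
  obtains v r d c \<eta> \<delta> where "r > 0" "continuous_on (polydisc r) f" "\<eta> > 0" "\<delta> > 0" "\<delta> \<le> 1/2" "c \<noteq> 0"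
    "\<And>x t. x \<in> polydisc \<eta> \<Longrightarrow> \<bar>t\<bar> \<le> \<delta> \<Longrightarrow> x + t *\<^sub>R v \<in> polydisc r"
    "\<And>x. x \<in> polydisc \<eta> \<Longrightarrow> \<exists>u. derivative_chain u {-\<delta>..\<delta>} \<and> (\<forall>t\<in>{-\<delta>..\<delta>}. u d t \<ge> (1/2::real)) \<and>
       (\<forall>t\<in>{-\<delta>..\<delta>}. u 0 t = Re (f (x + t *\<^sub>R v) / c))"
proof -
  obtain a R where f: "expands a R f" using f analytic0_iff_expands by blast
  have R: "R > 0" using f unfolding expands_def by (rule conjunct1)
  have "\<exists>v. (\<forall>i. cmod (v $ i) < R / 4) \<and> f v \<noteq> 0"
  proof (rule ccontr)
    assume "\<not> ?thesis"
    then have "\<forall>v. (\<forall>i. cmod (v $ i) < R / 4) \<longrightarrow> f v = 0" by blast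
    then have "\<forall>\<^sub>F x in nhds 0. f x = 0"
      using eventually_polydisc[of "R / 4"] R by (auto elim: eventually_mono)
    then show False using nz by blast
  qed
  then obtain v where v: "\<And>i. cmod (v $ i) < R / 4" "f v \<noteq> 0" by blast
  \<comment> \<open>For \<open>x\<close> in the polydisc of radius \<open>R / 4\<close> and \<open>\<bar>t\<bar> \<le> 2\<close>, the points \<open>x + t v\<close> have coordinates at most \<open>3 R / 4\<close>.\<close>
  define r where "r = 3 * R / 4"
  have r: "0 \<le> r" "r < R" "r > 0" using R by (auto simp: r_def)
  define g where "g x t = f (x + t *s v)" for x t
  have inP: "x + t *s v \<in> polydisc r" if "x \<in> polydisc (R / 4)" "t \<in> cball 0 2" for x t
    unfolding polydisc_def
  proof (intro CollectI allI)
    fix i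
    have "cmod ((x + t *s v) $ i) \<le> cmod (x $ i) + cmod t * cmod (v $ i)"
      using norm_triangle_ineq[of "x $ i" "t * v $ i"] by (simp add: norm_mult)
    also have "\<dots> \<le> R / 4 + 2 * (R / 4)"
      using that v(1)[of i] by (intro add_mono mult_mono) (auto simp: polydisc_def less_imp_le)
    finally show "cmod ((x + t *s v) $ i) \<le> r" by (simp add: r_def)
  qed
  have g: "g x holomorphic_on ball 0 2" if "x \<in> polydisc (R / 4)" for x
    using expands_slice_holomorphic[OF f r(1,2), of 2 x v] inP[OF that] unfolding g_def by blast
  have z: "0 \<in> polydisc (R / 4)" using R by (simp add: polydisc_def)
  have "\<exists>d. (deriv ^^ d) (g 0) 0 \<noteq> 0"
  proof (rule ccontr)
    assume "\<not> ?thesis"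
    then have "\<And>d. (deriv ^^ d) (g 0) 0 = 0" by blast
    then have "g 0 1 = 0"
      by (intro holomorphic_fun_eq_0_on_connected[OF g[OF z], of 0]) auto
    then show False using v(2) by (simp add: g_def)
  qed
  then obtain d where d: "(deriv ^^ d) (g 0) 0 \<noteq> 0" by blast
  define c where "c = (deriv ^^ d) (g 0) 0"
  have c: "c \<noteq> 0" using d by (simp add: c_def)
  have cd: "continuous_on (ball 0 2) ((deriv ^^ d) (g 0))"
    by (intro holomorphic_on_imp_continuous_on holomorphic_higher_deriv g z) auto
  obtain \<delta>1 where \<delta>1: "\<delta>1 > 0"
    "\<forall>t\<in>ball 0 2. dist t 0 < \<delta>1 \<longrightarrow> dist ((deriv ^^ d) (g 0) t) c < cmod c / 4"
    using spec[OF bspec[OF iffD1[OF continuous_on_iff cd], of 0], of "cmod c / 4"] c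
    unfolding c_def[symmetric] by auto
  define \<delta>0 where "\<delta>0 = min \<delta>1 2"
  have \<delta>0: "\<delta>0 > 0" "\<And>t. cmod t < \<delta>0 \<Longrightarrow> cmod ((deriv ^^ d) (g 0) t - c) < cmod c / 4"
    using \<delta>1 by (auto simp: \<delta>0_def dist_norm)
  define E where "E = cmod c / (4 * fact d)"
  have E: "E > 0" using c by (simp add: E_def)
  have cont: "continuous_on (polydisc r) f" using expands_continuous_on[OF f r(1,2)] .
  then have "uniformly_continuous_on (polydisc r) f"
    by (intro compact_uniformly_continuous compact_polydisc)
  then obtain e where e: "e > 0" "\<And>x y. x \<in> polydisc r \<Longrightarrow> y \<in> polydisc r \<Longrightarrow> dist y x < e \<Longrightarrow> dist (f y) (f x) < E"
    using E unfolding uniformly_continuous_on_def by metis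
  have "\<forall>\<^sub>F x in nhds (0 :: complex ^ 'n). dist x 0 < e"
    using e(1) eventually_nhds_metric by blast
  from eventually_nhds_polydisc[OF this]
  obtain \<eta>0 where \<eta>0: "\<eta>0 > 0" "\<forall>x\<in>polydisc \<eta>0. dist x (0 :: complex ^ 'n) < e" by blast
  define \<eta> where "\<eta> = min \<eta>0 (R / 4)"
  define \<delta> where "\<delta> = min (\<delta>0 / 2) (1/4)"
  have \<eta>: "\<eta> > 0" and \<delta>: "\<delta> > 0" "\<delta> \<le> 1/2" using \<eta>0 R \<delta>0 by (auto simp: \<eta>_def \<delta>_def)
  have scale: "t *\<^sub>R v = complex_of_real t *s v" for t
    unfolding vec_eq_iff vector_scaleR_component vector_smult_component
    by (simp add: scaleR_conv_of_real)
  have sub: "x \<in> polydisc (R / 4)" "x \<in> polydisc \<eta>0" if "x \<in> polydisc \<eta>" for x :: "complex ^ 'n"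
    using that by (auto simp: polydisc_def \<eta>_def)
  show ?thesis
  proof (rule that[OF r(3) cont \<eta> \<delta> c])
    fix x :: "complex ^ 'n" and t assume x: "x \<in> polydisc \<eta>" and t: "\<bar>t\<bar> \<le> \<delta>"
    show "x + t *\<^sub>R v \<in> polydisc r"
      unfolding scale using sub(1)[OF x] t \<delta> by (intro inP) auto
  next
    fix x :: "complex ^ 'n" assume x: "x \<in> polydisc \<eta>"
    let ?u = "\<lambda>k t. Re ((deriv ^^ k) (g x) (complex_of_real t) / c)"
    have gx: "g x holomorphic_on ball 0 2" using g[OF sub(1)[OF x]] .
    have close: "cmod (g x w - g 0 w) < E" if "w \<in> ball 0 2" for w
    proof -
      have w: "w \<in> cball 0 2" using that by auto
      have "dist (x + w *s v) (0 + w *s v) < e" using bspec[OF \<eta>0(2) sub(2)[OF x]] by (simp add: dist_norm)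
      then have "dist (f (x + w *s v)) (f (0 + w *s v)) < E"
        by (intro e(2) inP[OF z w] inP[OF sub(1)[OF x] w])
      then show ?thesis by (simp add: g_def dist_norm)
    qed
    have "derivative_chain ?u {-\<delta>..\<delta>}"
      by (rule derivative_chain_Re[OF gx]) (use \<delta> in auto)
    moreover have "?u d t \<ge> 1/2" if t: "t \<in> {-\<delta>..\<delta>}" for t
    proof -
      let ?w = "(deriv ^^ d) (g x) (complex_of_real t)" and ?y = "(deriv ^^ d) (g 0) (complex_of_real t)"
      have t': "\<bar>t\<bar> \<le> \<delta>" using t by auto
      have "cmod (?w - ?y) \<le> fact d * E"
        by (rule higher_deriv_close[OF gx g[OF z] close]) (use t' in \<open>auto simp: \<delta>_def\<close>)
      also have "fact d * E = cmod c / 4" by (simp add: E_def)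
      finally have "cmod (?w - ?y) \<le> cmod c / 4" .
      moreover have "cmod (?y - c) < cmod c / 4"
        by (rule \<delta>0(2)) (use t' \<delta>0(1) in \<open>auto simp: \<delta>_def\<close>)
      ultimately have "cmod (?w - c) \<le> cmod c / 2"
        using norm_triangle_ineq[of "?w - ?y" "?y - c"] by simp
      then have "cmod ((?w - c) / c) \<le> 1/2" using c by (simp add: norm_divide field_simps)
      then have "cmod (?w / c - 1) \<le> 1/2" using c by (simp add: diff_divide_distrib)
      then have "\<bar>Re (?w / c - 1)\<bar> \<le> 1/2" using abs_Re_le_cmod order_trans by blast
      then show ?thesis unfolding abs_le_iff by simp
    qed
    moreover have "?u 0 t = Re (f (x + t *\<^sub>R v) / c)" for t by (simp add: g_def scale)
    ultimately show "\<exists>u. derivative_chain u {-\<delta>..\<delta>} \<and> (\<forall>t\<in>{-\<delta>..\<delta>}. u d t \<ge> (1/2::real)) \<and>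
       (\<forall>t\<in>{-\<delta>..\<delta>}. u 0 t = Re (f (x + t *\<^sub>R v) / c))" by (intro exI[of _ ?u]) simp
  qed
qed

section \<open>Local integrability of a small negative power\<close>

text \<open>The integral over a small polydisc \<open>K\<close> is at most the integral of \<open>x \<mapsto> F (x + t v)\<close> over a larger polydisc \<open>B\<close>,
for every small real \<open>t\<close>. Integrating over \<open>t\<close> and exchanging the integrals leaves, for each \<open>x \<in> B\<close>, an integral over a
real slice, and these are bounded uniformly in \<open>x\<close>.\<close>
lemma local_integrability:
  fixes f :: "complex ^ 'n::finite \<Rightarrow> complex"
  assumes f: "analytic0 f" and nz: "\<not> (\<forall>\<^sub>F x in nhds 0. f x = 0)"
  shows "\<exists>s>0. \<exists>\<rho>>0. (\<integral>\<^sup>+x. inverse (ennreal (cmod (f x) powr s)) * indicator (polydisc \<rho>) x \<partial>lborel) < (\<infinity>::ennreal)"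
proof -
  obtain v r d c \<eta> \<delta>0 where r: "r > 0" "continuous_on (polydisc r) f" and \<eta>: "\<eta> > 0"
    and \<delta>0: "\<delta>0 > 0" "\<delta>0 \<le> 1/2" and c: "c \<noteq> 0"
    and inP: "\<And>x t. x \<in> polydisc \<eta> \<Longrightarrow> \<bar>t\<bar> \<le> \<delta>0 \<Longrightarrow> x + t *\<^sub>R v \<in> polydisc r"
    and u: "\<And>x. x \<in> polydisc \<eta> \<Longrightarrow> \<exists>u. derivative_chain u {-\<delta>0..\<delta>0} \<and> (\<forall>t\<in>{-\<delta>0..\<delta>0}. u d t \<ge> (1/2::real)) \<and>
       (\<forall>t\<in>{-\<delta>0..\<delta>0}. u 0 t = Re (f (x + t *\<^sub>R v) / c))"
    by (rule analytic_slices[OF f nz]) blast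
  obtain s M where s: "s > 0" and M: "M < (\<infinity>::ennreal)"
    and uM: "\<And>u a b. a < b \<Longrightarrow> b \<le> a + 1 \<Longrightarrow> derivative_chain u {a..b} \<Longrightarrow>
      (\<forall>t\<in>{a..b}. u d t \<ge> 1/2) \<Longrightarrow>
      (\<integral>\<^sup>+t. inverse (ennreal (\<bar>u 0 t\<bar> powr s)) * indicator {a..b} t \<partial>lborel) \<le> M"
    using inverse_powr_integral_bound[of d] by blast
  define C where "C = inverse (ennreal (cmod c powr s))"
  have Ce: "C = ennreal (inverse (cmod c powr s))" using c by (simp add: C_def inverse_ennreal)
  then have C: "C < (\<infinity>::ennreal)" by simp
  define V where "V = (\<Sum>i\<in>UNIV. cmod (v $ i)) + 1"
  have V: "V > 0" "\<And>i. cmod (v $ i) \<le> V"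
    using member_le_sum[of _ UNIV "\<lambda>i. cmod (v $ i)"] sum_nonneg[of UNIV "\<lambda>i. cmod (v $ i)"]
    by (auto simp: V_def intro: add_increasing2 add_nonneg_pos)
  define \<rho> where "\<rho> = \<eta> / 2"
  define \<delta> where "\<delta> = min \<delta>0 (\<rho> / V)"
  have \<rho>: "\<rho> > 0" using \<eta> by (simp add: \<rho>_def)
  have \<delta>: "\<delta> > 0" "\<delta> \<le> \<delta>0" "\<delta> * V \<le> \<rho>"
    using \<delta>0 V(1) \<rho> by (auto simp: \<delta>_def min_def field_simps)
  \<comment> \<open>Outside the polydisc nothing is known about \<open>f\<close>; there \<open>F\<close> is \<open>\<infinity>\<close>, which makes it measurable.\<close>
  define F where "F x = inverse (ennreal (cmod (indicator (polydisc r) x *\<^sub>R f x) powr s))" for x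
  have Km [measurable]: "polydisc a \<in> sets (borel :: (complex ^ 'n) measure)" for a
    by (rule borel_closed[OF closed_polydisc])
  have "(\<lambda>x. indicator (polydisc r) x *\<^sub>R f x) \<in> borel_measurable borel"
    using Km r(2) by (rule borel_measurable_continuous_on_indicator)
  then have Fm [measurable]: "F \<in> borel_measurable borel" unfolding F_def by measurable
  let ?K = "polydisc \<rho> :: (complex ^ 'n) set" and ?B = "polydisc \<eta> :: (complex ^ 'n) set"
  let ?X = "\<integral>\<^sup>+x. F x * indicator ?K x \<partial>lborel"
  have line: "(\<integral>\<^sup>+t. F (x + t *\<^sub>R v) * indicator ?B x * indicator {-\<delta>..\<delta>} t \<partial>lborel) \<le> (C * M) * indicator ?B x" for x
  proof (cases "x \<in> ?B")
    case True
    obtain u where u: "derivative_chain u {-\<delta>0..\<delta>0}" "\<forall>t\<in>{-\<delta>0..\<delta>0}. u d t \<ge> (1/2::real)"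
       "\<forall>t\<in>{-\<delta>0..\<delta>0}. u 0 t = Re (f (x + t *\<^sub>R v) / c)"
      using u[OF True] by blast
    have "F (x + t *\<^sub>R v) * indicator {-\<delta>..\<delta>} t \<le> C * (inverse (ennreal (\<bar>u 0 t\<bar> powr s)) * indicator {-\<delta>0..\<delta>0} t)" for t
    proof (cases "t \<in> {-\<delta>..\<delta>}")
      case t: True
      then have t0: "t \<in> {-\<delta>0..\<delta>0}" "\<bar>t\<bar> \<le> \<delta>0" using \<delta> by auto
      have F: "F (x + t *\<^sub>R v) = inverse (ennreal (cmod (f (x + t *\<^sub>R v)) powr s))"
        using inP[OF True t0(2)] by (simp add: F_def)
      have "\<bar>u 0 t\<bar> \<le> cmod (f (x + t *\<^sub>R v) / c)"
        using u(3) t0(1) abs_Re_le_cmod by auto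
      then have "cmod c * \<bar>u 0 t\<bar> \<le> cmod (f (x + t *\<^sub>R v))"
        using c by (simp add: norm_divide field_simps)
      then have "(cmod c * \<bar>u 0 t\<bar>) powr s \<le> cmod (f (x + t *\<^sub>R v)) powr s"
        using s by (intro powr_mono2) auto
      then have "F (x + t *\<^sub>R v) \<le> inverse (ennreal (cmod c powr s * \<bar>u 0 t\<bar> powr s))"
        unfolding F powr_mult by (intro ennreal_inverse_le_of_le) auto
      also have "\<dots> = C * inverse (ennreal (\<bar>u 0 t\<bar> powr s))"
        unfolding C_def by (subst ennreal_mult) (auto simp: ennreal_inverse_mult)
      finally show ?thesis using t t0 by simp
    qed simp
    then have "(\<integral>\<^sup>+t. F (x + t *\<^sub>R v) * indicator {-\<delta>..\<delta>} t \<partial>lborel)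
        \<le> (\<integral>\<^sup>+t. C * (inverse (ennreal (\<bar>u 0 t\<bar> powr s)) * indicator {-\<delta>0..\<delta>0} t) \<partial>lborel)"
      by (rule nn_integral_mono)
    also have "\<dots> \<le> C * (\<integral>\<^sup>+t. inverse (ennreal (\<bar>u 0 t\<bar> powr s)) * indicator {-\<delta>0..\<delta>0} t \<partial>lborel)"
      unfolding Ce by (rule nn_integral_cmult_le) (use c in simp)
    also have "\<dots> \<le> C * M"
      by (intro mult_left_mono uM u(1,2)) (use \<delta>0 in auto)
    finally show ?thesis using True by simp
  qed simp
  have shift: "?X * indicator {-\<delta>..\<delta>} t \<le> (\<integral>\<^sup>+x. F (x + t *\<^sub>R v) * indicator ?B x * indicator {-\<delta>..\<delta>} t \<partial>lborel)" for t
  proof (cases "t \<in> {-\<delta>..\<delta>}")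
    case t: True
    have "?X = (\<integral>\<^sup>+x. F x * indicator ?K x \<partial>distr lborel borel ((+) (t *\<^sub>R v)))"
      unfolding lborel_distr_plus ..
    also have "\<dots> = (\<integral>\<^sup>+x. F (t *\<^sub>R v + x) * indicator ?K (t *\<^sub>R v + x) \<partial>lborel)"
      by (rule nn_integral_distr) measurable
    also have "\<dots> \<le> (\<integral>\<^sup>+x. F (x + t *\<^sub>R v) * indicator ?B x * indicator {-\<delta>..\<delta>} t \<partial>lborel)"
    proof (rule nn_integral_mono)
      fix x
      have "x \<in> ?B" if "t *\<^sub>R v + x \<in> ?K"
        unfolding polydisc_def
      proof (intro CollectI allI)
        fix i
        have "cmod (x $ i) \<le> cmod ((t *\<^sub>R v + x) $ i) + cmod ((t *\<^sub>R v) $ i)"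
          using norm_triangle_ineq4[of "(t *\<^sub>R v + x) $ i" "(t *\<^sub>R v) $ i"] by simp
        also have "cmod ((t *\<^sub>R v + x) $ i) \<le> \<rho>" using that unfolding polydisc_def by blast
        also have "cmod ((t *\<^sub>R v) $ i) \<le> \<delta> * V"
          using t V by (simp add: abs_le_iff) (intro mult_mono, auto)
        also have "\<rho> + \<delta> * V \<le> \<eta>" using \<delta>(3) by (simp add: \<rho>_def)
        finally show "cmod (x $ i) \<le> \<eta>" by simp
      qed
      then show "F (t *\<^sub>R v + x) * indicator ?K (t *\<^sub>R v + x) \<le> F (x + t *\<^sub>R v) * indicator ?B x * indicator {-\<delta>..\<delta>} t"
        using t by (auto simp: indicator_def add.commute)
    qed
    finally show ?thesis using t by simp
  qed simp
  have "?X * emeasure lborel {-\<delta>..\<delta>} = (\<integral>\<^sup>+t. ?X * indicator {-\<delta>..\<delta>} t \<partial>lborel)"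
    by (rule nn_integral_cmult_indicator[symmetric]) simp
  also have "\<dots> \<le> (\<integral>\<^sup>+t. \<integral>\<^sup>+x. F (x + t *\<^sub>R v) * indicator ?B x * indicator {-\<delta>..\<delta>} t \<partial>lborel \<partial>lborel)"
    using shift by (rule nn_integral_mono)
  also have "\<dots> = (\<integral>\<^sup>+x. \<integral>\<^sup>+t. F (x + t *\<^sub>R v) * indicator ?B x * indicator {-\<delta>..\<delta>} t \<partial>lborel \<partial>lborel)"
    by (rule lborel_pair.Fubini') measurable
  also have "\<dots> \<le> (\<integral>\<^sup>+x. (C * M) * indicator ?B x \<partial>lborel)"
    using line by (rule nn_integral_mono)
  also have "\<dots> = (C * M) * emeasure lborel ?B"
    by (rule nn_integral_cmult_indicator) simp
  also have "emeasure lborel ?B < \<infinity>"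
    by (rule emeasure_compact_finite[OF compact_polydisc])
  then have "(C * M) * emeasure lborel ?B < \<infinity>"
    using C M by (simp add: ennreal_mult_less_top)
  finally have "?X * emeasure lborel {-\<delta>..\<delta>} < \<infinity>" .
  moreover have "emeasure lborel {-\<delta>..\<delta>} \<noteq> 0" using \<delta>(1) by simp
  ultimately have X: "?X < \<infinity>" by (auto simp: ennreal_mult_less_top)
  define \<rho>' where "\<rho>' = min \<rho> r"
  have "inverse (ennreal (cmod (f x) powr s)) * indicator (polydisc \<rho>') x \<le> F x * indicator ?K x" for x
    by (auto simp: F_def indicator_def polydisc_def \<rho>'_def)
  then have "(\<integral>\<^sup>+x. inverse (ennreal (cmod (f x) powr s)) * indicator (polydisc \<rho>') x \<partial>lborel) \<le> ?X"
    by (rule nn_integral_mono)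
  then have "(\<integral>\<^sup>+x. inverse (ennreal (cmod (f x) powr s)) * indicator (polydisc \<rho>') x \<partial>lborel) < \<infinity>"
    using X by (rule le_less_trans)
  moreover have "\<rho>' > 0" using \<rho> r(1) by (simp add: \<rho>'_def)
  ultimately show ?thesis using s by blast
qed

section \<open>Integral closure and growth\<close>

text \<open>One representative that is \<open>O(N)\<close> suffices, because any two representatives agree near the origin.\<close>
definition bounded_germs :: "(complex ^ 'n::finite \<Rightarrow> real) \<Rightarrow> 'n germ set" where
  "bounded_germs N = {h. \<exists>f C. analytic0 f \<and> abs_germ f = h \<and> C > 0 \<and>
     (\<forall>\<^sub>F x in nhds 0. cmod (f x) \<le> C * N x)}"

lemma bounded_germsD:
  assumes "abs_germ f \<in> bounded_germs N" "analytic0 f"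
  obtains C where "C > 0" "\<forall>\<^sub>F x in nhds 0. cmod (f x) \<le> C * N x"
proof -
  obtain g C where g: "analytic0 g" "abs_germ g = abs_germ f" "C > 0"
    "\<forall>\<^sub>F x in nhds 0. cmod (g x) \<le> C * N x"
    using assms(1) unfolding bounded_germs_def by blast
  have "\<forall>\<^sub>F x in nhds 0. g x = f x"
    using g(2) abs_germ_eq_iff[OF g(1) assms(2)] by blast
  with g(4) have "\<forall>\<^sub>F x in nhds 0. cmod (f x) \<le> C * N x"
    by eventually_elim simp
  with g(3) show ?thesis by (rule that)
qed

lemma bounded_germs_mult:
  assumes "a \<in> bounded_germs N" "b \<in> bounded_germs N'"
  shows "a * b \<in> bounded_germs (\<lambda>x. N x * N' x)"
proof -
  obtain f C where f: "analytic0 f" "abs_germ f = a" "C > 0" "\<forall>\<^sub>F x in nhds 0. cmod (f x) \<le> C * N x"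
    using assms(1) unfolding bounded_germs_def by blast
  obtain g D where g: "analytic0 g" "abs_germ g = b" "D > 0" "\<forall>\<^sub>F x in nhds 0. cmod (g x) \<le> D * N' x"
    using assms(2) unfolding bounded_germs_def by blast
  have "\<forall>\<^sub>F x in nhds 0. cmod (f x * g x) \<le> (C * D) * (N x * N' x)"
    using f(4) g(4)
  proof eventually_elim
    case (elim x)
    have "cmod (f x) * cmod (g x) \<le> (C * N x) * (D * N' x)"
      using elim order_trans[OF norm_ge_zero elim(1)] by (intro mult_mono) auto
    then show ?case unfolding norm_mult by (simp only: mult_ac)
  qed
  moreover have "abs_germ (\<lambda>x. f x * g x) = a * b" using abs_germ_mult[OF f(1) g(1)] f(2) g(2) by simp
  moreover have "analytic0 (\<lambda>x. f x * g x)" by (rule analytic0_mult[OF f(1) g(1)])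
  moreover have "C * D > 0" using f(3) g(3) by simp
  ultimately show ?thesis unfolding bounded_germs_def by blast
qed

lemma bounded_germs_UNIV: "bounded_germs (\<lambda>_. 1) = UNIV"
proof -
  have "h \<in> bounded_germs (\<lambda>_. 1)" for h :: "'a germ"
  proof -
    obtain f where f: "analytic0 f" "abs_germ f = h" using ex_rep_germ by blast
    obtain C where "C > 0" "\<forall>\<^sub>F x in nhds 0. cmod (f x) \<le> C" using analytic0_bounded[OF f(1)] .
    then show ?thesis using f unfolding bounded_germs_def by auto
  qed
  then show ?thesis by blast
qed

lemma is_ideal_bounded_germs:
  assumes N: "\<And>x. N x \<ge> 0"
  shows "is_ideal (bounded_germs N)"
proof (rule self_module.subspaceI)
  have "\<forall>\<^sub>F x in nhds 0. cmod 0 \<le> 1 * N x" using N by simp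
  then show "0 \<in> bounded_germs N"
    unfolding bounded_germs_def zero_germ.abs_eq using analytic0_const[of 0] zero_less_one by blast
next
  fix a b assume "a \<in> bounded_germs N" "b \<in> bounded_germs N"
  then obtain f C g D where f: "analytic0 f" "abs_germ f = a" "C > 0" "\<forall>\<^sub>F x in nhds 0. cmod (f x) \<le> C * N x"
    and g: "analytic0 g" "abs_germ g = b" "D > 0" "\<forall>\<^sub>F x in nhds 0. cmod (g x) \<le> D * N x"
    unfolding bounded_germs_def by blast
  have "\<forall>\<^sub>F x in nhds 0. cmod (f x + g x) \<le> (C + D) * N x"
    using f(4) g(4)
  proof eventually_elim
    case (elim x)
    then have "cmod (f x) + cmod (g x) \<le> (C + D) * N x" by (simp add: distrib_right)
    then show ?case by (rule order_trans[OF norm_triangle_ineq])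
  qed
  moreover have "abs_germ (\<lambda>x. f x + g x) = a + b" using abs_germ_add[OF f(1) g(1)] f(2) g(2) by simp
  moreover have "analytic0 (\<lambda>x. f x + g x)" by (rule analytic0_add[OF f(1) g(1)])
  moreover have "C + D > 0" using f(3) g(3) by simp
  ultimately show "a + b \<in> bounded_germs N" unfolding bounded_germs_def by blast
next
  fix c a assume "a \<in> bounded_germs N"
  then show "c * a \<in> bounded_germs N"
    using bounded_germs_mult[of c "\<lambda>_. 1" a N] by (simp add: bounded_germs_UNIV)
qed

lemma ideal_power_subset_bounded_germs:
  assumes N: "\<And>x. N x \<ge> 0" and I: "I \<subseteq> bounded_germs N"
  shows "ideal_power I k \<subseteq> bounded_germs (\<lambda>x. N x ^ k)"
proof (induction k)
  case (Suc k)
  show ?case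
    unfolding ideal_power.simps ideal_mult_def
  proof (rule self_module.span_minimal)
    show "is_ideal (bounded_germs (\<lambda>x. N x ^ Suc k))"
      by (rule is_ideal_bounded_germs) (use N in simp)
    show "{a * b |a b. a \<in> I \<and> b \<in> ideal_power I k} \<subseteq> bounded_germs (\<lambda>x. N x ^ Suc k)"
      using bounded_germs_mult[of _ N _ "\<lambda>x. N x ^ k"] I Suc by auto
  qed
qed (simp add: bounded_germs_UNIV)

lemma abs_germ_power:
  assumes "analytic0 f"
  shows "analytic0 (\<lambda>x. f x ^ k) \<and> abs_germ (\<lambda>x. f x ^ k) = abs_germ f ^ k"
proof (induction k)
  case 0
  show ?case using analytic0_const[of 1] by (simp add: one_germ.abs_eq)
next
  case (Suc k)
  then show ?case using analytic0_mult[OF assms] abs_germ_mult[OF assms] by simp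
qed

text \<open>This bounds the roots of a monic polynomial whose \<open>i\<close>-th coefficient is of size \<open>n ^ i\<close>. If \<open>y\<close> exceeded \<open>D * n\<close> for
\<open>D = 1 + (\<Sum>i=1..k. C i)\<close>, then each \<open>n ^ i * y ^ (k - i)\<close> would be at most \<open>y ^ k / D\<close>, and the sum would be too small.\<close>
lemma root_bound:
  fixes y n :: real
  assumes y: "y \<ge> 0" and n: "n \<ge> 0" and C: "\<And>i. C i \<ge> 0"
    and le: "y ^ k \<le> (\<Sum>i=1..k. C i * n ^ i * y ^ (k - i))"
  shows "y \<le> (1 + (\<Sum>i=1..k. C i)) * n"
proof (rule ccontr)
  let ?S = "\<Sum>i=1..k. C i"
  assume "\<not> ?thesis"
  then have gt: "(1 + ?S) * n < y" by simp
  have S: "?S \<ge> 0" using C by (intro sum_nonneg) auto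
  have yp: "y > 0" using gt S n by (meson add_nonneg_nonneg le_less_trans mult_nonneg_nonneg zero_le_one)
  have n_le: "n \<le> y / (1 + ?S)" using gt S by (simp add: field_simps)
  have "C i * n ^ i * y ^ (k - i) \<le> C i * (y ^ k / (1 + ?S))" if i: "i \<in> {1..k}" for i
  proof -
    have "n ^ i \<le> (y / (1 + ?S)) ^ i" using n_le n by (intro power_mono)
    also have "\<dots> = y ^ i * (1 / (1 + ?S)) ^ i" by (simp add: power_divide)
    also have "\<dots> \<le> y ^ i * (1 / (1 + ?S)) ^ 1"
      using S y i by (intro mult_left_mono power_decreasing) auto
    finally have "n ^ i * y ^ (k - i) \<le> (y ^ i * (1 / (1 + ?S)) ^ 1) * y ^ (k - i)"
      using y by (intro mult_right_mono) auto
    also have "\<dots> = y ^ (i + (k - i)) / (1 + ?S)" by (simp add: power_add)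
    also have "i + (k - i) = k" using i by simp
    finally show ?thesis using mult_left_mono[OF _ C[of i]] by (simp only: mult.assoc)
  qed
  then have "(\<Sum>i=1..k. C i * n ^ i * y ^ (k - i)) \<le> (\<Sum>i=1..k. C i * (y ^ k / (1 + ?S)))"
    by (rule sum_mono)
  also have "\<dots> = ?S * (y ^ k / (1 + ?S))" by (rule sum_distrib_right[symmetric])
  also have "\<dots> = (?S / (1 + ?S)) * y ^ k" by simp
  also have "\<dots> < 1 * y ^ k" using S yp by (intro mult_strict_right_mono) (auto simp: field_simps)
  finally show False using le by simp
qed

text \<open>In an equation of integral dependence the \<open>i\<close>-th coefficient is \<open>O(N ^ i)\<close>, and a root of a monic polynomial
with such coefficients is \<open>O(N)\<close>.\<close>
lemma integral_closure_subset_bounded_germs: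
  fixes I :: "'n::finite germ set"
  assumes N: "\<And>x. N x \<ge> 0" and I: "I \<subseteq> bounded_germs N"
  shows "integral_closure I \<subseteq> bounded_germs N"
proof
  fix h assume "h \<in> integral_closure I"
  then obtain k a where a: "\<forall>i\<in>{1..k}. a i \<in> ideal_power I i"
    and eq: "h ^ k + (\<Sum>i=1..k. a i * h ^ (k - i)) = 0"
    unfolding integral_closure_def by blast
  obtain f where f: "analytic0 f" "abs_germ f = h" using ex_rep_germ by blast
  have "\<forall>i\<in>{1..k}. \<exists>p. analytic0 (fst p) \<and> abs_germ (fst p) = a i \<and> snd p > 0 \<and>
      (\<forall>\<^sub>F x in nhds 0. cmod (fst p x) \<le> snd p * N x ^ i)"
    using a ideal_power_subset_bounded_germs[OF N I] unfolding bounded_germs_def by fastforce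
  from bchoice[OF this] obtain p where p: "\<forall>i\<in>{1..k}. analytic0 (fst (p i)) \<and> abs_germ (fst (p i)) = a i \<and>
      snd (p i) > 0 \<and> (\<forall>\<^sub>F x in nhds 0. cmod (fst (p i) x) \<le> snd (p i) * N x ^ i)" ..
  define g C where "g i = fst (p i)" and "C i = (if i \<in> {1..k} then snd (p i) else 0)" for i
  have g: "analytic0 (g i)" "abs_germ (g i) = a i" "\<forall>\<^sub>F x in nhds 0. cmod (g i x) \<le> C i * N x ^ i"
    if "i \<in> {1..k}" for i
    using p that by (simp_all add: g_def C_def)
  have C: "C i \<ge> 0" for i using p by (auto simp: C_def less_imp_le)
  have an: "analytic0 (\<lambda>x. g i x * f x ^ (k - i))"
    "abs_germ (\<lambda>x. g i x * f x ^ (k - i)) = a i * h ^ (k - i)" if "i \<in> {1..k}" for i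
    using analytic0_mult[OF g(1)[OF that]] abs_germ_mult[OF g(1)[OF that]] abs_germ_power[OF f(1)] g(2)[OF that] f(2)
    by simp_all
  have sum: "analytic0 (\<lambda>x. \<Sum>i=1..k. g i x * f x ^ (k - i))"
    "abs_germ (\<lambda>x. \<Sum>i=1..k. g i x * f x ^ (k - i)) = (\<Sum>i=1..k. a i * h ^ (k - i))"
    using abs_germ_sum[of "{1..k}" "\<lambda>i x. g i x * f x ^ (k - i)", OF _ an(1)] an(2) by simp_all
  have pw: "analytic0 (\<lambda>x. f x ^ k)" "abs_germ (\<lambda>x. f x ^ k) = h ^ k"
    using abs_germ_power[OF f(1)] f(2) by auto
  have "abs_germ (\<lambda>x. f x ^ k + (\<Sum>i=1..k. g i x * f x ^ (k - i))) = abs_germ (\<lambda>_. 0)"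
    unfolding abs_germ_add[OF pw(1) sum(1)] pw(2) sum(2) eq by (rule zero_germ.abs_eq)
  then have ev: "\<forall>\<^sub>F x in nhds 0. f x ^ k + (\<Sum>i=1..k. g i x * f x ^ (k - i)) = 0"
    using abs_germ_eq_iff[OF analytic0_add[OF pw(1) sum(1)] analytic0_const] by blast
  have "\<forall>\<^sub>F x in nhds 0. \<forall>i\<in>{1..k}. cmod (g i x) \<le> C i * N x ^ i"
    using g(3) by (intro eventually_ball_finite) auto
  with ev have "\<forall>\<^sub>F x in nhds 0. cmod (f x) \<le> (1 + (\<Sum>i=1..k. C i)) * N x"
  proof eventually_elim
    case (elim x)
    have "f x ^ k = - (\<Sum>i=1..k. g i x * f x ^ (k - i))" using elim(1) by (simp add: eq_neg_iff_add_eq_0)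
    then have "cmod (f x) ^ k = cmod (\<Sum>i=1..k. g i x * f x ^ (k - i))"
      by (metis norm_minus_cancel norm_power)
    also have "\<dots> \<le> (\<Sum>i=1..k. cmod (g i x) * cmod (f x) ^ (k - i))"
      by (intro order_trans[OF norm_sum]) (simp add: norm_mult norm_power)
    also have "\<dots> \<le> (\<Sum>i=1..k. C i * N x ^ i * cmod (f x) ^ (k - i))"
      using elim(2) by (intro sum_mono mult_right_mono) auto
    finally show ?case by (intro root_bound N C) auto
  qed
  moreover have "1 + (\<Sum>i=1..k. C i) > 0" using C by (intro add_pos_nonneg sum_nonneg) auto
  ultimately show "h \<in> bounded_germs N" unfolding bounded_germs_def using f by blast
qed

lemma subset_integral_closure: "is_ideal I \<Longrightarrow> I \<subseteq> integral_closure I"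
proof
  fix h assume I: "is_ideal I" and h: "h \<in> I"
  have "- h \<in> I" using self_module.subspace_neg[OF I h] .
  then have "- h * 1 \<in> ideal_mult I (ideal_power I 0)"
    unfolding ideal_mult_def
    by (intro self_module.span_base CollectI exI[of _ "- h"] exI[of _ 1]) simp
  then have "\<forall>i\<in>{1..1}. - h \<in> ideal_power I i" by simp
  moreover have "h ^ 1 + (\<Sum>i=1..1::nat. - h * h ^ (1 - i)) = 0" by simp
  ultimately show "h \<in> integral_closure I"
    unfolding integral_closure_def
    by (intro CollectI exI[of _ 1] exI[of _ "\<lambda>_. - h"]) simp
qed

lemma norm_sq_bound_of_generator_bounds:
  assumes "\<And>f. f \<in> set fs \<Longrightarrow> \<exists>C>0. \<forall>\<^sub>F x in nhds 0. cmod (f x) \<le> C * sqrt (norm_sq gs x)"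
  shows "\<exists>C>0. \<forall>\<^sub>F x in nhds 0. norm_sq fs x \<le> C * norm_sq gs x"
  using assms
proof (induction fs)
  case Nil
  have "norm_sq [] x \<le> 1 * norm_sq gs x" for x
    using norm_sq_nonneg[of gs x] by (simp add: norm_sq_def)
  then show ?case by (intro exI[of _ 1]) auto
next
  case (Cons f fs)
  obtain C where C: "C > 0" "\<forall>\<^sub>F x in nhds 0. norm_sq fs x \<le> C * norm_sq gs x"
    using Cons by auto
  obtain B where B: "B > 0" "\<forall>\<^sub>F x in nhds 0. cmod (f x) \<le> B * sqrt (norm_sq gs x)"
    using Cons.prems by auto
  have "\<forall>\<^sub>F x in nhds 0. norm_sq (f # fs) x \<le> (B\<^sup>2 + C) * norm_sq gs x"
    using B(2) C(2)
  proof eventually_elim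
    case (elim x)
    have "(cmod (f x))\<^sup>2 \<le> (B * sqrt (norm_sq gs x))\<^sup>2"
      using elim by (intro power_mono) auto
    then have "(cmod (f x))\<^sup>2 \<le> B\<^sup>2 * norm_sq gs x"
      by (simp add: power_mult_distrib norm_sq_nonneg)
    then show ?case
      using elim by (simp add: norm_sq_def distrib_right)
  qed
  moreover have "B\<^sup>2 + C > 0" using C by (simp add: add_nonneg_pos)
  ultimately show ?case by blast
qed

text \<open>The generators lie in the integral closure, and expressing them by monomials takes only finitely many of these.
The other estimate holds because each monomial is in the integral closure.\<close>
lemma monomial_integral_closure_comparison:
  fixes I :: "'n::finite germ set"
  assumes I: "is_ideal I" and fs: "generates fs I" and mono: "monomial_ideal (integral_closure I)"
  obtains ms C D where "C > 0" "D > 0"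
    "\<forall>\<^sub>F x in nhds 0. norm_sq fs x \<le> C * norm_sq (map monom_fun ms) x"
    "\<forall>\<^sub>F x in nhds 0. norm_sq (map monom_fun ms) x \<le> D * norm_sq fs x"
proof -
  let ?N = "\<lambda>x. sqrt (norm_sq fs x)"
  obtain M where M: "integral_closure I = ideal_gen (monom_germ ` M)"
    using mono unfolding monomial_ideal_def by blast
  have an: "analytic0 f" if "f \<in> set fs" for f using fs that by (simp add: generates_def)
  have "\<forall>f\<in>set fs. \<exists>t. finite t \<and> t \<subseteq> monom_germ ` M \<and> abs_germ f \<in> ideal_gen t"
  proof
    fix f assume "f \<in> set fs"
    then have "abs_germ f \<in> I" using fs unfolding generates_def by (auto intro: self_module.span_base)
    then have "abs_germ f \<in> ideal_gen (monom_germ ` M)"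
      using subset_integral_closure[OF I] M by blast
    then obtain t u where t: "finite t" "t \<subseteq> monom_germ ` M" "abs_germ f = (\<Sum>a\<in>t. u a * a)"
      unfolding self_module.span_explicit by blast
    have "abs_germ f \<in> ideal_gen t"
      unfolding t(3) by (intro self_module.span_sum self_module.span_scale self_module.span_base)
    then show "\<exists>t. finite t \<and> t \<subseteq> monom_germ ` M \<and> abs_germ f \<in> ideal_gen t" using t by blast
  qed
  from bchoice[OF this] obtain T where T: "\<forall>f\<in>set fs. finite (T f) \<and> T f \<subseteq> monom_germ ` M \<and>
      abs_germ f \<in> ideal_gen (T f)" ..
  have "finite (\<Union>f\<in>set fs. T f)" "(\<Union>f\<in>set fs. T f) \<subseteq> monom_germ ` M" using T by auto
  from finite_subset_image[OF this] obtain M' where M': "M' \<subseteq> M" "finite M'" "(\<Union>f\<in>set fs. T f) = monom_germ ` M'"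
    by blast
  obtain ms where ms: "set ms = M'" using finite_list[OF M'(2)] by blast
  let ?gs = "map monom_fun ms"
  have gs: "abs_germ ` set ?gs = monom_germ ` M'"
    by (simp add: ms image_image monom_germ.abs_eq)
  have "\<exists>C>0. \<forall>\<^sub>F x in nhds 0. norm_sq fs x \<le> C * norm_sq ?gs x"
  proof (rule norm_sq_bound_of_generator_bounds)
    fix f assume f: "f \<in> set fs"
    have "ideal_gen (T f) \<subseteq> ideal_gen (monom_germ ` M')"
      using f M'(3) by (intro self_module.span_mono) blast
    then have "abs_germ f \<in> ideal_gen (abs_germ ` set ?gs)" using T f unfolding gs by blast
    then show "\<exists>C>0. \<forall>\<^sub>F x in nhds 0. cmod (f x) \<le> C * sqrt (norm_sq ?gs x)"
      using ideal_gen_bound[of "abs_germ f" ?gs] an[OF f] analytic0_monom_fun by auto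
  qed
  then obtain C where C: "C > 0" "\<forall>\<^sub>F x in nhds 0. norm_sq fs x \<le> C * norm_sq ?gs x" by blast
  have IB: "I \<subseteq> bounded_germs ?N"
  proof
    fix h assume "h \<in> I"
    moreover obtain f where f: "analytic0 f" "abs_germ f = h" using ex_rep_germ by blast
    ultimately show "h \<in> bounded_germs ?N"
      using ideal_gen_bound[of h fs] fs unfolding generates_def bounded_germs_def by blast
  qed
  have "\<exists>C>0. \<forall>\<^sub>F x in nhds 0. norm_sq ?gs x \<le> C * norm_sq fs x"
  proof (rule norm_sq_bound_of_generator_bounds)
    fix g :: "complex ^ 'n \<Rightarrow> complex" assume "g \<in> set ?gs"
    then obtain m where m: "m \<in> M'" "g = monom_fun m" using ms by auto
    have "monom_germ m \<in> ideal_gen (monom_germ ` M)" using m M'(1) by (intro self_module.span_base) auto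
    then have "monom_germ m \<in> bounded_germs ?N"
      using integral_closure_subset_bounded_germs[of ?N, OF _ IB] M norm_sq_nonneg by auto
    then have "abs_germ g \<in> bounded_germs ?N" by (simp add: m(2) monom_germ.abs_eq)
    moreover have "analytic0 g" using m(2) analytic0_monom_fun by simp
    ultimately show "\<exists>C>0. \<forall>\<^sub>F x in nhds 0. cmod (g x) \<le> C * sqrt (norm_sq fs x)"
      using bounded_germsD by metis
  qed
  then obtain D where "D > 0" "\<forall>\<^sub>F x in nhds 0. norm_sq ?gs x \<le> D * norm_sq fs x" by blast
  then show ?thesis using C that by blast
qed

section \<open>Admissible exponents\<close>

text \<open>The conditions under the infimum and the supremum in the two invariants are named, so that their relation can
be stated for single exponents.\<close>
definition loj_admissible :: "(complex ^ 'n::finite \<Rightarrow> complex) list \<Rightarrow> real \<Rightarrow> bool" where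
  "loj_admissible fs \<alpha> \<longleftrightarrow> \<alpha> \<ge> 0 \<and> (\<exists>C>0. \<exists>U. open U \<and> 0 \<in> U \<and>
     (\<forall>x\<in>U. rpow (cmod (coord_prod x)) \<alpha> \<le> C * sqrt (norm_sq fs x)))"

definition lct_admissible :: "(complex ^ 'n::finite \<Rightarrow> complex) list \<Rightarrow> real \<Rightarrow> bool" where
  "lct_admissible fs s \<longleftrightarrow> s \<ge> 0 \<and> (\<exists>K. compact K \<and> 0 \<in> interior K \<and>
     (\<integral>\<^sup>+x\<in>K. inverse (ennreal (rpow (norm_sq fs x) s)) \<partial>lborel) < \<infinity>)"

lemma loj_tuple_eq: "loj_tuple fs = Inf (ereal ` {\<alpha>. loj_admissible fs \<alpha>})"
  unfolding loj_tuple_def loj_admissible_def ..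

lemma lct_tuple_eq: "lct_tuple fs = Sup (ereal ` {s. lct_admissible fs s})"
  unfolding lct_tuple_def lct_admissible_def ..

lemma loj_admissible_iff:
  fixes fs :: "(complex ^ 'n::finite \<Rightarrow> complex) list"
  shows "loj_admissible fs \<alpha> \<longleftrightarrow> \<alpha> \<ge> 0 \<and> (\<exists>C>0. \<exists>\<rho>>0. \<forall>x\<in>polydisc \<rho>.
     rpow (cmod (coord_prod x)) \<alpha> \<le> C * sqrt (norm_sq fs x))"
proof -
  have "(\<exists>U. open U \<and> 0 \<in> U \<and> (\<forall>x\<in>U. P x)) \<longleftrightarrow> (\<exists>\<rho>>0. \<forall>x\<in>polydisc \<rho>. P x)" for P :: "complex ^ 'n \<Rightarrow> bool"
  proof
    assume "\<exists>U. open U \<and> 0 \<in> U \<and> (\<forall>x\<in>U. P x)"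
    then have "\<forall>\<^sub>F x in nhds 0. P x" unfolding eventually_nhds .
    then show "\<exists>\<rho>>0. \<forall>x\<in>polydisc \<rho>. P x" by (rule eventually_nhds_polydisc)
  next
    assume "\<exists>\<rho>>0. \<forall>x\<in>polydisc \<rho>. P x"
    then obtain \<rho> where \<rho>: "\<rho> > 0" "\<forall>x\<in>polydisc \<rho>. P x" by blast
    then show "\<exists>U. open U \<and> 0 \<in> U \<and> (\<forall>x\<in>U. P x)"
      using interior_polydisc[OF \<rho>(1), where 'n = 'n] interior_subset[of "polydisc \<rho> :: (complex ^ 'n) set"]
      by (intro exI[of _ "interior (polydisc \<rho>)"]) auto
  qed
  then show ?thesis unfolding loj_admissible_def by simp
qed

lemma lct_admissibleI:
  assumes "s \<ge> 0" "\<rho> > 0"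
    and "\<And>x. x \<in> polydisc \<rho> \<Longrightarrow> inverse (ennreal (rpow (norm_sq fs x) s)) \<le> ennreal C * h x"
    and "C > 0" "(\<integral>\<^sup>+x. h x * indicator (polydisc \<rho>) x \<partial>lborel) < \<infinity>"
  shows "lct_admissible fs s"
proof -
  have "(\<integral>\<^sup>+x\<in>polydisc \<rho>. inverse (ennreal (rpow (norm_sq fs x) s)) \<partial>lborel)
      \<le> (\<integral>\<^sup>+x. ennreal C * (h x * indicator (polydisc \<rho>) x) \<partial>lborel)"
    by (rule nn_integral_mono) (use assms(3) in \<open>auto simp: indicator_def\<close>)
  also have "\<dots> \<le> ennreal C * (\<integral>\<^sup>+x. h x * indicator (polydisc \<rho>) x \<partial>lborel)"
    by (rule nn_integral_cmult_le[OF assms(4)])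
  also have "\<dots> < \<infinity>" using assms(5) by (simp add: ennreal_mult_less_top)
  finally have "(\<integral>\<^sup>+x\<in>polydisc \<rho>. inverse (ennreal (rpow (norm_sq fs x) s)) \<partial>lborel) < \<infinity>" .
  then show ?thesis
    unfolding lct_admissible_def using assms(1,2) compact_polydisc interior_polydisc by blast
qed

text \<open>The integrand is at most a constant times \<open>\<bar>x\<^sub>1 \<cdots> x\<^sub>n\<bar>\<close> to the power \<open>-2\<alpha>s\<close>, and \<open>\<alpha>s < 1\<close>.\<close>
lemma lct_admissible_of_loj_admissible:
  fixes fs :: "(complex ^ 'n::finite \<Rightarrow> complex) list"
  assumes \<alpha>: "loj_admissible fs \<alpha>" "\<alpha> > 0" and s: "0 < s" "s < 1 / \<alpha>"
  shows "lct_admissible fs s"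
proof -
  obtain C \<rho> where C: "C > 0" and \<rho>: "\<rho> > 0"
    and le: "\<And>x. x \<in> polydisc \<rho> \<Longrightarrow> rpow (cmod (coord_prod x)) \<alpha> \<le> C * sqrt (norm_sq fs x)"
    using \<alpha>(1) unfolding loj_admissible_iff by blast
  define \<beta> where "\<beta> = \<alpha> * s"
  have \<beta>: "0 \<le> \<beta>" "\<beta> < 1" using s \<alpha>(2) by (auto simp: \<beta>_def field_simps)
  define D where "D = inverse ((1 / C\<^sup>2) powr s)"
  have D: "D > 0" using C by (simp add: D_def)
  define \<rho>' where "\<rho>' = min \<rho> 1"
  let ?h = "\<lambda>x :: complex ^ 'n. inverse (ennreal (cmod (coord_prod x) powr (2 * \<beta>)))"
  show ?thesis
  proof (rule lct_admissibleI[of s \<rho>' fs D ?h])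
    show "\<rho>' > 0" using \<rho> by (simp add: \<rho>'_def)
    fix x :: "complex ^ 'n" assume x: "x \<in> polydisc \<rho>'"
    let ?p = "cmod (coord_prod x)"
    have "x \<in> polydisc \<rho>" using x by (auto simp: polydisc_def \<rho>'_def)
    then have "?p powr \<alpha> \<le> C * sqrt (norm_sq fs x)" using le[of x] \<alpha>(2) by (simp add: rpow_def)
    then have "(?p powr \<alpha>)\<^sup>2 \<le> (C * sqrt (norm_sq fs x))\<^sup>2" by (intro power_mono) auto
    then have "(1 / C\<^sup>2) * (?p powr \<alpha>)\<^sup>2 \<le> norm_sq fs x"
      using C by (simp add: power_mult_distrib norm_sq_nonneg field_simps)
    then have "((1 / C\<^sup>2) * (?p powr \<alpha>)\<^sup>2) powr s \<le> norm_sq fs x powr s"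
      using s by (intro powr_mono2) auto
    also have "((1 / C\<^sup>2) * (?p powr \<alpha>)\<^sup>2) powr s = (1 / C\<^sup>2) powr s * ((?p powr \<alpha>)\<^sup>2) powr s"
      by (rule powr_mult)
    also have "(?p powr \<alpha>)\<^sup>2 = ?p powr (\<alpha> + \<alpha>)"
      by (simp only: power2_eq_square powr_add)
    also have "(?p powr (\<alpha> + \<alpha>)) powr s = ?p powr (2 * \<beta>)"
      unfolding powr_powr \<beta>_def by (simp only: mult_2 distrib_right)
    finally have "inverse (ennreal (norm_sq fs x powr s)) \<le> inverse (ennreal ((1 / C\<^sup>2) powr s * ?p powr (2 * \<beta>)))"
      by (intro ennreal_inverse_le_of_le) auto
    also have "\<dots> = inverse (ennreal ((1 / C\<^sup>2) powr s)) * ?h x"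
      by (subst ennreal_mult) (auto simp: ennreal_inverse_mult)
    also have "inverse (ennreal ((1 / C\<^sup>2) powr s)) = ennreal D"
      unfolding D_def using C by (intro inverse_ennreal) simp
    finally show "inverse (ennreal (rpow (norm_sq fs x) s)) \<le> ennreal D * ?h x"
      using s(1) by (simp add: rpow_def)
  next
    have "(\<integral>\<^sup>+x. ?h x * indicator (polydisc \<rho>') x \<partial>lborel) \<le>
        (\<integral>\<^sup>+x. ?h x * indicator {x. \<forall>i. cmod (x $ i) \<le> 1} x \<partial>lborel)"
      by (rule nn_integral_mono) (auto simp: indicator_def polydisc_def \<rho>'_def)
    also have "\<dots> < \<infinity>" by (rule coord_prod_integral_finite[OF \<beta>])
    finally show "(\<integral>\<^sup>+x. ?h x * indicator (polydisc \<rho>') x \<partial>lborel) < \<infinity>" .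
  qed (use s D in auto)
qed

definition diagonal :: "complex \<Rightarrow> complex ^ 'n::finite" where
  "diagonal t = (\<chi> i. t)"

lemma coord_prod_diagonal: "coord_prod (diagonal t :: complex ^ 'n::finite) = t ^ CARD('n)"
  by (simp add: coord_prod_def diagonal_def)

lemma diagonal_in_polydisc: "diagonal t \<in> polydisc \<rho> \<longleftrightarrow> cmod t \<le> \<rho>"
  by (simp add: polydisc_def diagonal_def)

text \<open>Otherwise the zero set would be a full neighbourhood of \<open>0\<close>, but the product of the coordinates is not zero on
the diagonal.\<close>
lemma exists_nonvanishing_generator:
  fixes fs :: "(complex ^ 'n::finite \<Rightarrow> complex) list"
  assumes "germ_subset (common_zeros fs) (common_zeros [coord_prod])"
  shows "\<exists>f\<in>set fs. \<not> (\<forall>\<^sub>F x in nhds 0. f x = 0)"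
proof (rule ccontr)
  assume "\<not> ?thesis"
  then have "\<forall>\<^sub>F x in nhds 0. \<forall>f\<in>set fs. f x = 0"
    by (intro eventually_ball_finite) auto
  then have "\<forall>\<^sub>F x in nhds 0. coord_prod (x :: complex ^ 'n) = 0"
    using assms unfolding germ_subset_def by eventually_elim (auto simp: common_zeros_def)
  from eventually_nhds_polydisc[OF this]
  obtain \<rho> where \<rho>: "\<rho> > 0" "\<forall>x\<in>polydisc \<rho>. coord_prod (x :: complex ^ 'n) = 0" by blast
  have "coord_prod (diagonal (of_real \<rho>) :: complex ^ 'n) = 0"
    using \<rho> by (intro bspec[OF \<rho>(2)]) (simp add: diagonal_in_polydisc)
  then show False using \<rho>(1) by (simp add: coord_prod_diagonal)
qed

lemma lct_admissible_pos:
  fixes fs :: "(complex ^ 'n::finite \<Rightarrow> complex) list"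
  assumes f: "f \<in> set fs" "analytic0 f" "\<not> (\<forall>\<^sub>F x in nhds 0. f x = 0)"
  shows "\<exists>s>0. lct_admissible fs s"
proof -
  obtain s \<rho> where s: "s > 0" and \<rho>: "\<rho> > 0"
    and int: "(\<integral>\<^sup>+x. inverse (ennreal (cmod (f x) powr s)) * indicator (polydisc \<rho>) x \<partial>lborel) < \<infinity>"
    using local_integrability[OF f(2,3)] by blast
  have "lct_admissible fs (s / 2)"
  proof (rule lct_admissibleI[of "s / 2" \<rho> fs 1 "\<lambda>x. inverse (ennreal (cmod (f x) powr s))"])
    fix x :: "complex ^ 'n"
    have "cmod (f x) powr s = (cmod (f x) powr 2) powr (s / 2)" by (simp only: powr_powr) simp
    also have "cmod (f x) powr 2 = (cmod (f x))\<^sup>2" by simp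
    also have "(cmod (f x))\<^sup>2 powr (s / 2) \<le> norm_sq fs x powr (s / 2)"
    proof (rule powr_mono2)
      have "(cmod (f x))\<^sup>2 \<le> (sqrt (norm_sq fs x))\<^sup>2"
        using norm_le_norm_sq[OF f(1)] by (intro power_mono) auto
      then show "(cmod (f x))\<^sup>2 \<le> norm_sq fs x" by (simp add: norm_sq_nonneg)
    qed (use s in auto)
    finally have "inverse (ennreal (norm_sq fs x powr (s / 2))) \<le> inverse (ennreal (cmod (f x) powr s))"
      by (intro ennreal_inverse_le_of_le) auto
    then show "inverse (ennreal (rpow (norm_sq fs x) (s / 2))) \<le> ennreal 1 * inverse (ennreal (cmod (f x) powr s))"
      using s by (simp add: rpow_def)
  qed (use s \<rho> int in auto)
  then show ?thesis using s by (intro exI[of _ "s / 2"]) auto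
qed

text \<open>On the diagonal the germ is a holomorphic function of one variable that vanishes at \<open>0\<close>.\<close>
lemma diagonal_bound:
  fixes f :: "complex ^ 'n::finite \<Rightarrow> complex"
  assumes f: "analytic0 f" "f 0 = 0"
  shows "\<exists>C>0. \<exists>\<rho>>0. \<forall>t. 0 < t \<longrightarrow> t \<le> \<rho> \<longrightarrow> cmod (f (diagonal (complex_of_real t))) \<le> C * t"
proof -
  obtain a r where a: "expands a r f" using f(1) analytic0_iff_expands by blast
  have r: "r > 0" using a unfolding expands_def by (rule conjunct1)
  define h where "h t = f (0 + t *s (\<chi> i. 1))" for t
  have hd: "h t = f (diagonal t)" for t
    unfolding h_def diagonal_def by (rule arg_cong[where f = f]) (simp add: vec_eq_iff)
  have "h holomorphic_on ball 0 (r / 2)"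
    unfolding h_def
    by (rule conjunct2[OF expands_slice_holomorphic[OF a, of "r / 2"]]) (use r in \<open>auto simp: polydisc_def\<close>)
  then have "(h has_field_derivative deriv h 0) (at 0)"
    using r by (intro holomorphic_derivI[of h "ball 0 (r / 2)"]) auto
  then have "((\<lambda>t. (h (0 + t) - h 0) / t) \<longlongrightarrow> deriv h 0) (at 0)"
    unfolding DERIV_def .
  then have "((\<lambda>t. cmod (h t / t)) \<longlongrightarrow> cmod (deriv h 0)) (at 0)"
    using tendsto_norm f(2) by (fastforce simp: hd diagonal_def zero_vec_def)
  then have "\<forall>\<^sub>F t in at 0. cmod (h t / t) < cmod (deriv h 0) + 1"
    by (intro order_tendstoD) auto
  then obtain d where d: "d > 0" "\<And>t. t \<noteq> 0 \<Longrightarrow> dist t 0 < d \<Longrightarrow> cmod (h t / t) < cmod (deriv h 0) + 1"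
    unfolding eventually_at by blast
  have "cmod (f (diagonal (complex_of_real t))) \<le> (cmod (deriv h 0) + 1) * t" if t: "0 < t" "t \<le> d / 2" for t
  proof -
    have "cmod (h (of_real t) / of_real t) < cmod (deriv h 0) + 1" using t d(1) by (intro d(2)) auto
    then show ?thesis using t by (simp add: hd norm_divide field_simps)
  qed
  moreover have "cmod (deriv h 0) + 1 > 0" by (simp add: add_nonneg_pos)
  moreover have "d / 2 > 0" using d(1) by simp
  ultimately show ?thesis by blast
qed

lemma norm_sq_diagonal_bound:
  fixes fs :: "(complex ^ 'n::finite \<Rightarrow> complex) list"
  assumes "\<And>f. f \<in> set fs \<Longrightarrow> analytic0 f \<and> f 0 = 0"
  shows "\<exists>C>0. \<exists>\<rho>>0. \<forall>t. 0 < t \<longrightarrow> t \<le> \<rho> \<longrightarrow> norm_sq fs (diagonal (complex_of_real t)) \<le> (C * t)\<^sup>2"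
  using assms
proof (induction fs)
  case Nil
  show ?case by (rule exI[of _ 1], rule conjI, simp, rule exI[of _ 1]) (simp add: norm_sq_def)
next
  case (Cons f fs)
  obtain C \<rho> where C: "C > 0" "\<rho> > 0" "\<And>t. 0 < t \<Longrightarrow> t \<le> \<rho> \<Longrightarrow> norm_sq fs (diagonal (complex_of_real t)) \<le> (C * t)\<^sup>2"
    using Cons by auto
  obtain D \<sigma> where D: "D > 0" "\<sigma> > 0" "\<And>t. 0 < t \<Longrightarrow> t \<le> \<sigma> \<Longrightarrow> cmod (f (diagonal (complex_of_real t))) \<le> D * t"
    using diagonal_bound[of f] Cons.prems[of f] by auto
  have "norm_sq (f # fs) (diagonal (complex_of_real t)) \<le> ((C + D) * t)\<^sup>2" if t: "0 < t" "t \<le> min \<rho> \<sigma>" for t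
  proof -
    have "(cmod (f (diagonal (complex_of_real t))))\<^sup>2 \<le> (D * t)\<^sup>2"
      using D(3)[of t] t by (intro power_mono) auto
    moreover have "norm_sq fs (diagonal (complex_of_real t)) \<le> (C * t)\<^sup>2" using C(3)[of t] t by simp
    ultimately have "norm_sq (f # fs) (diagonal (complex_of_real t)) \<le> (D * t)\<^sup>2 + (C * t)\<^sup>2"
      by (simp add: norm_sq_def)
    also have "\<dots> \<le> (D * t + C * t)\<^sup>2"
      using t C(1) D(1) unfolding power2_sum by (simp add: less_imp_le)
    also have "D * t + C * t = (C + D) * t" by (simp only: distrib_right add.commute)
    finally show ?thesis .
  qed
  moreover have "C + D > 0" "min \<rho> \<sigma> > 0" using C D by auto
  ultimately show ?case by blast
qed

text \<open>On the diagonal the condition reads \<open>t powr (n * \<alpha>) \<le> C * t\<close> for all small \<open>t > 0\<close>, which forces \<open>n * \<alpha> \<ge> 1\<close>.\<close>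
lemma loj_admissible_ge:
  fixes fs :: "(complex ^ 'n::finite \<Rightarrow> complex) list"
  assumes fs: "\<And>f. f \<in> set fs \<Longrightarrow> analytic0 f \<and> f 0 = 0" and \<alpha>: "loj_admissible fs \<alpha>"
  shows "\<alpha> \<ge> 1 / real CARD('n)"
proof (rule ccontr)
  assume "\<not> ?thesis"
  then have lt: "real CARD('n) * \<alpha> < 1" by (simp add: field_simps)
  obtain C \<rho> where C: "C > 0" and \<rho>: "\<rho> > 0"
    and le: "\<And>x. x \<in> polydisc \<rho> \<Longrightarrow> rpow (cmod (coord_prod x)) \<alpha> \<le> C * sqrt (norm_sq fs x)"
    using \<alpha> unfolding loj_admissible_iff by blast
  obtain D \<sigma> where D: "D > 0" "\<sigma> > 0"
    "\<And>t. 0 < t \<Longrightarrow> t \<le> \<sigma> \<Longrightarrow> norm_sq fs (diagonal (complex_of_real t)) \<le> (D * t)\<^sup>2"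
    using norm_sq_diagonal_bound[OF fs] by blast
  define \<gamma> where "\<gamma> = 1 - real CARD('n) * \<alpha>"
  have \<gamma>: "\<gamma> > 0" using lt by (simp add: \<gamma>_def)
  \<comment> \<open>For this \<open>t\<close> the bound \<open>t powr (n * \<alpha>) \<le> C * D * t\<close> is violated by a factor of at least \<open>2\<close>.\<close>
  define t where "t = min (min \<rho> \<sigma>) ((1 / (2 * (C * D))) powr (1 / \<gamma>))"
  have t: "t > 0" "t \<le> \<rho>" "t \<le> \<sigma>" using \<rho> D C by (auto simp: t_def)
  have "t powr \<gamma> \<le> ((1 / (2 * (C * D))) powr (1 / \<gamma>)) powr \<gamma>"
    using \<gamma> t(1) by (intro powr_mono2) (auto simp: t_def)
  also have "\<dots> = 1 / (2 * (C * D))" using \<gamma> C D by (simp add: powr_powr)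
  finally have "C * D * t powr \<gamma> \<le> C * D * (1 / (2 * (C * D)))"
    using C D by (intro mult_left_mono) auto
  also have "\<dots> = 1 / 2" using C D by simp
  finally have small: "C * D * t powr \<gamma> \<le> 1 / 2" .
  have t_eq: "t powr \<gamma> * t powr (real CARD('n) * \<alpha>) = t"
    using t(1) by (simp add: \<gamma>_def flip: powr_add)
  let ?x = "diagonal (complex_of_real t) :: complex ^ 'n"
  have "rpow (cmod (coord_prod ?x)) \<alpha> = t powr (real CARD('n) * \<alpha>)"
  proof -
    have "cmod (coord_prod ?x) = t powr real CARD('n)"
      using t(1) by (simp add: coord_prod_diagonal norm_power powr_realpow)
    then show ?thesis using t(1) by (simp add: rpow_def powr_powr)
  qed
  then have "t powr (real CARD('n) * \<alpha>) \<le> C * sqrt (norm_sq fs ?x)"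
    using le[of ?x] t by (simp add: diagonal_in_polydisc)
  also have "\<dots> \<le> C * sqrt ((D * t)\<^sup>2)"
    using D(3)[OF t(1,3)] C by (intro mult_left_mono real_sqrt_le_mono) auto
  also have "\<dots> = C * D * t" using D t by simp
  also have "\<dots> = (C * D * t powr \<gamma>) * t powr (real CARD('n) * \<alpha>)"
    using t_eq by (simp only: mult.assoc)
  also have "\<dots> \<le> (1 / 2) * t powr (real CARD('n) * \<alpha>)"
    using small by (intro mult_right_mono) auto
  finally have "t powr (real CARD('n) * \<alpha>) \<le> 0" by simp
  then show False using t(1) by simp
qed

lemma norm_sq_monomials_mono:
  assumes "\<And>i. cmod (x $ i) \<le> cmod (a $ i)"
  shows "norm_sq (map monom_fun ms) x \<le> norm_sq (map monom_fun ms) a"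
proof -
  have "(cmod (monom_fun m x))\<^sup>2 \<le> (cmod (monom_fun m a))\<^sup>2" for m
    unfolding monom_fun_def prod_norm[symmetric] norm_power
    using assms by (intro power_mono prod_mono conjI prod_nonneg) auto
  then show ?thesis unfolding norm_sq_def map_map o_def by (intro sum_list_mono)
qed

text \<open>For \<open>a\<close> near \<open>0\<close> the norm of the generators at a point of the polydisc with radii \<open>\<bar>a\<^sub>i\<bar>\<close> is at most a constant times its
value at \<open>a\<close>, because this holds for the monomials. So the integral over this
polydisc is at least a constant times \<open>\<bar>a\<^sub>1 \<cdots> a\<^sub>n\<bar>\<^sup>2\<close> times the value of the integrand at \<open>a\<close>.\<close>
lemma loj_admissible_of_lct_admissible:
  fixes fs :: "(complex ^ 'n::finite \<Rightarrow> complex) list"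
  assumes C: "C > 0" "\<forall>\<^sub>F x in nhds 0. norm_sq fs x \<le> C * norm_sq (map monom_fun ms) x"
    and D: "D > 0" "\<forall>\<^sub>F x in nhds 0. norm_sq (map monom_fun ms) x \<le> D * norm_sq fs x"
    and s: "s > 0" "lct_admissible fs s"
  shows "loj_admissible fs (1 / s)"
proof -
  let ?g = "norm_sq (map monom_fun ms)"
  obtain K where K: "0 \<in> interior K" and fin: "(\<integral>\<^sup>+x\<in>K. inverse (ennreal (rpow (norm_sq fs x) s)) \<partial>lborel) < \<infinity>"
    using s(2) unfolding lct_admissible_def by blast
  obtain R where R: "R \<ge> 0" "(\<integral>\<^sup>+x\<in>K. inverse (ennreal (rpow (norm_sq fs x) s)) \<partial>lborel) = ennreal R"
    using fin by (cases "\<integral>\<^sup>+x\<in>K. inverse (ennreal (rpow (norm_sq fs x) s)) \<partial>lborel" rule: ennreal_cases) auto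
  have "\<forall>\<^sub>F x in nhds 0. x \<in> K"
    using K interior_subset[of K] unfolding eventually_nhds by (intro exI[of _ "interior K"]) auto
  with C(2) D(2) have "\<forall>\<^sub>F x in nhds 0. norm_sq fs x \<le> C * ?g x \<and> ?g x \<le> D * norm_sq fs x \<and> x \<in> K"
    by eventually_elim auto
  from eventually_nhds_polydisc[OF this]
  obtain \<rho> where \<rho>: "\<rho> > 0" "\<And>x. x \<in> polydisc \<rho> \<Longrightarrow> norm_sq fs x \<le> C * ?g x"
    "\<And>x. x \<in> polydisc \<rho> \<Longrightarrow> ?g x \<le> D * norm_sq fs x" "\<And>x. x \<in> polydisc \<rho> \<Longrightarrow> x \<in> K" by blast
  \<comment> \<open>The summand \<open>1\<close> only makes the constant positive.\<close>
  define E where "E = R powr (1 / (2 * s)) * sqrt (C * D) + 1"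
  have E: "E > 0" unfolding E_def using C(1) D(1) by (intro add_nonneg_pos mult_nonneg_nonneg) auto
  have "rpow (cmod (coord_prod a)) (1 / s) \<le> E * sqrt (norm_sq fs a)" if a: "a \<in> polydisc \<rho>" for a :: "complex ^ 'n"
  proof -
    let ?p = "cmod (coord_prod a)"
    define Q where "Q = C * (D * norm_sq fs a)"
    have Q: "Q \<ge> 0" using C D by (simp add: Q_def norm_sq_nonneg)
    obtain B where B: "B \<in> sets lborel" "B \<subseteq> {x. \<forall>i. cmod (x $ i) \<le> cmod (a $ i)}"
      "emeasure lborel B = ennreal (?p\<^sup>2)"
      using polydisc_contains_box[of a] by blast
    have le: "inverse (ennreal (Q powr s)) * indicator B x
        \<le> inverse (ennreal (rpow (norm_sq fs x) s)) * indicator K x" for x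
    proof (cases "x \<in> B")
      case True
      then have xa: "cmod (x $ i) \<le> cmod (a $ i)" for i using B(2) by blast
      have xP: "x \<in> polydisc \<rho>" using xa a order_trans unfolding polydisc_def by blast
      have "norm_sq fs x \<le> C * ?g x" by (rule \<rho>(2)[OF xP])
      also have "\<dots> \<le> C * ?g a" using C(1) norm_sq_monomials_mono[OF xa] by (intro mult_left_mono) auto
      also have "\<dots> \<le> Q" unfolding Q_def using C(1) \<rho>(3)[OF a] by (intro mult_left_mono) auto
      finally have "norm_sq fs x powr s \<le> Q powr s"
        using s(1) norm_sq_nonneg by (intro powr_mono2) auto
      then have "inverse (ennreal (Q powr s)) \<le> inverse (ennreal (norm_sq fs x powr s))"
        by (intro ennreal_inverse_le_of_le) auto
      then show ?thesis using True \<rho>(4)[OF xP] s(1) by (simp add: rpow_def)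
    qed simp
    have "inverse (ennreal (Q powr s)) * ennreal (?p\<^sup>2) = (\<integral>\<^sup>+x. inverse (ennreal (Q powr s)) * indicator B x \<partial>lborel)"
      unfolding B(3)[symmetric] by (rule nn_integral_cmult_indicator[OF B(1), symmetric])
    also have "\<dots> \<le> ennreal R" unfolding R(2)[symmetric] using le by (rule nn_integral_mono)
    finally have meas: "inverse (ennreal (Q powr s)) * ennreal (?p\<^sup>2) \<le> ennreal R" .
    have p2: "?p\<^sup>2 \<le> R * Q powr s"
    proof (cases "Q powr s = 0")
      case True
      then have "top * ennreal (?p\<^sup>2) \<le> ennreal R"
        using meas by (simp only: ennreal_0 ennreal_inverse_zero)
      then have "ennreal (?p\<^sup>2) = 0"
        unfolding ennreal_top_mult by (simp add: top_unique split: if_splits)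
      then show ?thesis using True by simp
    next
      case False
      then have q: "Q powr s > 0" by simp
      then have "ennreal (inverse (Q powr s) * ?p\<^sup>2) \<le> ennreal R"
        using meas by (simp add: inverse_ennreal ennreal_mult)
      then have "inverse (Q powr s) * ?p\<^sup>2 \<le> R" using R(1) by simp
      then show ?thesis using q by (simp add: field_simps)
    qed
    have "?p powr (1 / s) = (?p powr 2) powr (1 / (2 * s))" by (simp only: powr_powr) simp
    also have "?p powr 2 = ?p\<^sup>2" by simp
    also have "(?p\<^sup>2) powr (1 / (2 * s)) \<le> (R * Q powr s) powr (1 / (2 * s))"
      using p2 s(1) by (intro powr_mono2) auto
    also have "\<dots> = R powr (1 / (2 * s)) * (Q powr s) powr (1 / (2 * s))" by (rule powr_mult)
    also have "(Q powr s) powr (1 / (2 * s)) = sqrt Q"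
      using s(1) Q by (simp add: powr_powr powr_half_sqrt)
    also have "sqrt Q = sqrt (C * D) * sqrt (norm_sq fs a)"
      unfolding Q_def by (simp only: real_sqrt_mult mult.assoc)
    also have "R powr (1 / (2 * s)) * (sqrt (C * D) * sqrt (norm_sq fs a)) \<le> E * sqrt (norm_sq fs a)"
      unfolding E_def mult.assoc[symmetric] using norm_sq_nonneg by (intro mult_right_mono) auto
    finally show ?thesis using s(1) by (simp add: rpow_def)
  qed
  then show ?thesis unfolding loj_admissible_iff using s(1) E \<rho>(1) by auto
qed

text \<open>The positive lower bound for \<open>A\<close> and the positive element of \<open>B\<close> exclude the indeterminate products \<open>\<infinity> \<cdot> 0\<close> and
\<open>0 \<cdot> \<infinity>\<close>, which are \<open>0\<close> in the extended reals. The set \<open>A\<close> may be empty.\<close>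
lemma Sup_times_Inf_ge_1:
  fixes A B :: "real set"
  assumes A: "\<And>\<alpha>. \<alpha> \<in> A \<Longrightarrow> \<kappa> \<le> \<alpha>" "\<kappa> > 0"
    and AB: "\<And>\<alpha> s. \<alpha> \<in> A \<Longrightarrow> 0 < s \<Longrightarrow> s < 1 / \<alpha> \<Longrightarrow> s \<in> B"
    and B: "\<exists>s\<in>B. s > 0"
  shows "1 \<le> Sup (ereal ` B) * Inf (ereal ` A)"
proof -
  obtain s0 where s0: "s0 \<in> B" "s0 > 0" using B by blast
  have up: "ereal s \<le> Sup (ereal ` B)" if "s \<in> B" for s using that by (intro Sup_upper) auto
  have pos: "0 < Sup (ereal ` B)" using up[OF s0(1)] s0(2) by (meson ereal_less(2) less_le_trans)
  show ?thesis
  proof (cases "A = {}")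
    case True
    then have "Inf (ereal ` A) = \<infinity>" by (simp add: top_ereal_def)
    then show ?thesis using pos by simp
  next
    case False
    define L where "L = Inf A"
    have bdd: "bdd_below A" using A(1) by (auto simp: bdd_below_def)
    have InfA: "Inf (ereal ` A) = ereal L"
      unfolding L_def using bdd False by (intro ereal_Inf'[symmetric])
    have "\<kappa> \<le> L" unfolding L_def using A(1) False by (intro cInf_greatest) auto
    then have L: "L > 0" using A(2) by simp
    have "ereal (1 / L) \<le> Sup (ereal ` B)"
    proof (rule ccontr)
      assume "\<not> ?thesis"
      then have lt: "Sup (ereal ` B) < ereal (1 / L)" by simp
      then obtain s where s: "Sup (ereal ` B) < ereal s" "ereal s < ereal (1 / L)"
        using ereal_dense2 by blast
      have sp: "s > 0" using pos s(1) by (metis ereal_less(2) less_trans)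
      then have "L < 1 / s" using s(2) L by (simp add: field_simps)
      then obtain \<alpha> where \<alpha>: "\<alpha> \<in> A" "\<alpha> < 1 / s"
        using False bdd unfolding L_def by (metis cInf_lessD)
      have "\<alpha> > 0" using A(1)[OF \<alpha>(1)] A(2) by simp
      then have "s < 1 / \<alpha>" using \<alpha>(2) sp by (simp add: field_simps)
      then have "s \<in> B" using AB[OF \<alpha>(1) sp] by simp
      then show False using up[of s] s(1) by simp
    qed
    then have "ereal (1 / L) * ereal L \<le> Sup (ereal ` B) * ereal L"
      using L by (intro ereal_mult_right_mono) auto
    then show ?thesis using L by (simp add: InfA one_ereal_def)
  qed
qed

lemma Sup_times_Inf_le_1:
  fixes A B :: "real set"
  assumes A: "\<And>\<alpha>. \<alpha> \<in> A \<Longrightarrow> \<kappa> \<le> \<alpha>" "\<kappa> > 0"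
    and BA: "\<And>s. s \<in> B \<Longrightarrow> s > 0 \<Longrightarrow> 1 / s \<in> A"
    and B: "\<exists>s\<in>B. s > 0"
  shows "Sup (ereal ` B) * Inf (ereal ` A) \<le> 1"
proof -
  have ne: "A \<noteq> {}" using B BA by blast
  define L where "L = Inf A"
  have bdd: "bdd_below A" using A(1) by (auto simp: bdd_below_def)
  have InfA: "Inf (ereal ` A) = ereal L"
    unfolding L_def using bdd ne by (intro ereal_Inf'[symmetric])
  have "\<kappa> \<le> L" unfolding L_def using A(1) ne by (intro cInf_greatest) auto
  then have L: "L > 0" using A(2) by simp
  have "Sup (ereal ` B) \<le> ereal (1 / L)"
  proof (rule Sup_least, clarify)
    fix s assume s: "s \<in> B"
    show "ereal s \<le> ereal (1 / L)"
    proof (cases "s > 0")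
      case True
      have "L \<le> 1 / s" unfolding L_def using BA[OF s True] bdd by (rule cInf_lower)
      then show ?thesis using True L by (simp add: field_simps)
    next
      case False
      then have "s \<le> 0" by simp
      also have "0 \<le> 1 / L" using L by simp
      finally show ?thesis by simp
    qed
  qed
  then have "Sup (ereal ` B) * ereal L \<le> ereal (1 / L) * ereal L"
    using L by (intro ereal_mult_right_mono) auto
  then show ?thesis using L by (simp add: InfA one_ereal_def)
qed

theorem theorem7p4:
  fixes I :: "'n::finite germ set"
  assumes "is_ideal I" and "I \<noteq> UNIV"
    and "germ_subset (zero_set I) (common_zeros [coord_prod])"
  shows "1 \<le> lct I * loj_exponent I \<and>
    (monomial_ideal (integral_closure I) \<longrightarrow> lct I * loj_exponent I = 1)"
proof -
  define fs where "fs = some_generators I"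
  have gen: "generates fs I"
    unfolding fs_def using ideal_finitely_generated[OF assms(1)] generates_some_generators by blast
  have lct: "lct I = Sup (ereal ` {s. lct_admissible fs s})"
    unfolding lct_def fs_def lct_tuple_eq ..
  have loj: "loj_exponent I = Inf (ereal ` {\<alpha>. loj_admissible fs \<alpha>})"
    unfolding loj_exponent_def fs_def loj_tuple_eq ..
  have fs: "analytic0 f \<and> f 0 = 0" if "f \<in> set fs" for f
  proof -
    have an: "analytic0 f" and "abs_germ f \<in> I"
      using gen that unfolding generates_def by (auto intro: self_module.span_base)
    then show ?thesis using ideal_containing_unit[OF assms(1)] assms(2) by blast
  qed
  obtain f where f: "f \<in> set fs" "\<not> (\<forall>\<^sub>F x in nhds 0. f x = 0)"
    using exists_nonvanishing_generator[of fs] assms(3) unfolding zero_set_def fs_def by blast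
  then have pos: "\<exists>s\<in>{s. lct_admissible fs s}. s > 0"
    using lct_admissible_pos[of f fs] fs by auto
  have low: "1 / real CARD('n) \<le> \<alpha>" if "\<alpha> \<in> {\<alpha>. loj_admissible fs \<alpha>}" for \<alpha>
    using loj_admissible_ge[OF fs] that by blast
  have n: "1 / real CARD('n) > 0" by simp
  have ge: "1 \<le> lct I * loj_exponent I"
    unfolding lct loj
  proof (rule Sup_times_Inf_ge_1[OF low n _ pos])
    fix \<alpha> s assume \<alpha>: "\<alpha> \<in> {\<alpha>. loj_admissible fs \<alpha>}" and s: "0 < s" "s < 1 / \<alpha>"
    have "\<alpha> > 0" by (rule less_le_trans[OF n low[OF \<alpha>]])
    then show "s \<in> {s. lct_admissible fs s}"
      using lct_admissible_of_loj_admissible[of fs \<alpha> s] \<alpha> s by blast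
  qed
  moreover have "lct I * loj_exponent I = 1" if mono: "monomial_ideal (integral_closure I)"
  proof (rule antisym[OF _ ge])
    obtain ms C D where "C > 0" "D > 0"
      "\<forall>\<^sub>F x in nhds 0. norm_sq fs x \<le> C * norm_sq (map monom_fun ms) x"
      "\<forall>\<^sub>F x in nhds 0. norm_sq (map monom_fun ms) x \<le> D * norm_sq fs x"
      by (rule monomial_integral_closure_comparison[OF assms(1) gen mono]) (rule that)
    note adm = loj_admissible_of_lct_admissible[OF this(1,3,2,4)]
    show "lct I * loj_exponent I \<le> 1"
      unfolding lct loj
    proof (rule Sup_times_Inf_le_1[OF low n _ pos])
      fix s assume "s \<in> {s. lct_admissible fs s}" "s > 0"
      then show "1 / s \<in> {\<alpha>. loj_admissible fs \<alpha>}" using adm by blast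
    qed
  qed
  ultimately show ?thesis by blast
qed

end
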